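(* Let $(M,g)$ be a simply-connected minimal Lorentzian surface in $\mathbb{H}^{2,1}$, represented by a spinor field $\varphi\in\Gamma(\Sigma)$ with $$D\varphi=e_0\cdot\varphi,\qquad H(\varphi,\varphi)=1.$$ Then the spinor field $\tilde\varphi:=\varphi^++e_1\cdot(\varphi^+\bullet I)\in\Gamma(\Sigma)$ satisfies $$D\tilde\varphi=e_0\cdot\tilde\varphi,\qquad H(\tilde\varphi,\tilde\varphi)=1,\qquad e_1\cdot\tilde\varphi=-\tilde\varphi\bullet I,$$ and thus induces an isometric immersion of $(M,g)$ into $\mathbb{R}^{1,2}$ with constant mean curvature $1$.
   Context: Algebra. $\mathcal{A}=\{u+\sigma v:u,v\in\mathbb{R}\}$ with $\sigma^2=1$ (Lorentz numbers), $\mathcal{A}_{\mathbb{C}}=\{u+\sigma v:u,v\in\mathbb{C}\}$, $\widehat{u+\sigma v}=u-\sigma v$. $\mathbb{H}^{\mathcal{A}_{\mathbb C}}$ is the algebra of quaternions $\zeta_0 1+\zeta_1I+\zeta_2J+\zeta_3K$ with $\zeta_k\in\mathcal{A}_{\mathbb{C}}$ ($I^2=J^2=K^2=-1$, $IJ=-JI=K$); $\overline\zeta$ is quaternionic conjugation, $\widehat\zeta$ is $\widehat{\cdot}$ applied to each coefficient, $H(\zeta,\zeta')=\sum_k\zeta_k\zeta_k'$. Set $\mathbb{H}_0=\{p_01+ip_1I+p_2J+ip_3K:p_k\in\mathcal{A}\}$ and $\mathbb{H}_1=\{iq_01+q_1I+iq_2J+q_3K:q_k\in\mathcal{A}\}$.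 $\mathbb{R}^{2,2}$ ($\mathbb{R}^4$ with metric $-dx_0^2+dx_1^2-dx_2^2+dx_3^2$) is identified with $\{\sigma ix_01+x_1I+ix_2J+x_3K:x_k\in\mathbb{R}\}\subset\mathbb{H}_1$, the metric being $H$. $\mathbb{H}^{2,1}=\{x\in\mathbb{R}^{2,2}:\langle x,x\rangle=-1\}$; $\mathbb{R}^{1,2}=I^\perp\subset\mathbb{R}^{2,2}$. Bundles. $(M,g)$ is a Lorentzian surface (metric of signature $(1,1)$) and $E=\mathbb{R}e_0\oplus\mathbb{R}e_1$ is a rank $2$ bundle on $M$ with a Lorentzian fibre metric and compatible connection, $e_0,e_1$ being orthogonal parallel sections with $\langle e_0,e_0\rangle=-1$, $\langle e_1,e_1\rangle=1$; $M$ and $E$ are oriented in space and time with spin structures $\tilde Q_M,\tilde Q_E$; $\tilde Q=\tilde Q_E\times_M\tilde Q_M$. $\Sigma=\Sigma E\otimes\Sigma M=\tilde Q\times\mathbb{H}_0/\rho$, where the structure group acts through $\{\pm(\cosh a+i\sinh a\,I):a\in\mathcal{A}\}\subset\mathbb{H}_0$ by left multiplication; $\nabla$ is the tensor product of the spin connections. In a spinorial frame above an adapted orthonormal frame $(e_0,e_1,e_2,e_3)$ ($e_2,e_3$ tangent, $|e_2|^2=-1$, $|e_3|^2=1$), a spinor $\varphi$ has coordinates $[\varphi]\in\mathbb{H}_0$, the vectors $e_0,e_1,e_2,e_3$ have coordinates $\sigma i1,I,iJ,K$, and Clifford multiplication by $X\in E\oplus TM$ is $[X\cdot\varphi]=\sigma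 i[X]\widehat{[\varphi]}$ (so $X\cdot X\cdot\varphi=-\langle X,X\rangle\varphi$). $H(\varphi,\varphi'):=H([\varphi],[\varphi'])$. The right action of $q\in\mathbb{H}_1$ is $[\varphi\bullet q]=\sigma i[\varphi]q$. $\varphi=\varphi^++\varphi^-$ is the decomposition with $\sigma[\varphi^\pm]=\pm[\varphi^\pm]$. $D\varphi=-e_2\cdot\nabla_{e_2}\varphi+e_3\cdot\nabla_{e_3}\varphi$. The pairing $\langle\langle\varphi,\varphi'\rangle\rangle=\sigma i\,\overline{[\varphi']}[\varphi]\in\mathbb{H}_1$. Known facts. If $M$ is simply connected, $\vec H\in\Gamma(E)$, $D\varphi=\vec H\cdot\varphi$ and $H(\varphi,\varphi)=1$, then $\xi(X)=\langle\langle X\cdot\varphi,\varphi\rangle\rangle$ ($X\in TM$) is a closed $\mathbb{R}^{2,2}$-valued $1$-form and $F=\int\xi$ is an isometric immersion in $\mathbb{R}^{2,2}$ (unique up to translation, said to be induced by $\varphi$) with normal bundle $E$ (through $X\in E\mapsto\langle\langle X\cdot\varphi,\varphi\rangle\rangle$) and mean curvature vector $\vec H=\frac12\mathrm{tr}_gB$. An immersion in $\mathbb{H}^{2,1}$ of mean curvature function $H$ is represented by such a $\varphi$ with $\vec H=e_0+He_1$ and $F=\langle\langle e_0\cdot\varphi,\varphi\rangle\rangle$; minimal means $H=0$. Immersions into $\mathbb{R}^{1,2}$ are understood up to translation; there the mean curvature is the function $H$ with $\vec H=He_0$, $e_0$ the unit timelike normal. *)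

theory Defs
  imports "HOL-Analysis.Analysis"
begin

section \<open>Complexified Lorentz numbers and quaternions over them\<close>

text \<open>\<open>Lor u v\<close> is \<open>u + \<sigma>v\<close> with \<open>\<sigma>\<^sup>2 = 1\<close> and \<open>u, v\<close> complex.\<close>

datatype lorc = Lor (sc: complex) (sg: complex)

instantiation lorc :: comm_ring_1
begin
definition "0 = Lor 0 0"
definition "1 = Lor 1 0"
definition "a + b = Lor (sc a + sc b) (sg a + sg b)"
definition "- a = Lor (- sc a) (- sg a)"
definition "a - b = Lor (sc a - sc b) (sg a - sg b)"
definition "a * b = Lor (sc a * sc b + sg a * sg b) (sc a * sg b + sg a * sc b)"
instance
  by standard
    (auto simp: zero_lorc_def one_lorc_def plus_lorc_def uminus_lorc_def minus_lorc_def
      times_lorc_def algebra_simps)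
end

definition lorentz_numbers :: "lorc set" where
  "lorentz_numbers = {z. sc z \<in> \<real> \<and> sg z \<in> \<real>}"

definition lhat :: "lorc \<Rightarrow> lorc" where
  "lhat z = Lor (sc z) (- sg z)"

definition lreal :: "real \<Rightarrow> lorc" where
  "lreal x = Lor (complex_of_real x) 0"

text \<open>\<open>HQ a b c d\<close> is \<open>a 1 + b I + c J + d K\<close>.\<close>

datatype hquat = HQ (q0: lorc) (q1: lorc) (q2: lorc) (q3: lorc)

instantiation hquat :: ring_1
begin
definition "0 = HQ 0 0 0 0"
definition "1 = HQ 1 0 0 0"
definition "x + y = HQ (q0 x + q0 y) (q1 x + q1 y) (q2 x + q2 y) (q3 x + q3 y)"
definition "- x = HQ (- q0 x) (- q1 x) (- q2 x) (- q3 x)"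
definition "x - y = HQ (q0 x - q0 y) (q1 x - q1 y) (q2 x - q2 y) (q3 x - q3 y)"
definition "x * y = HQ
   (q0 x * q0 y - q1 x * q1 y - q2 x * q2 y - q3 x * q3 y)
   (q0 x * q1 y + q1 x * q0 y + q2 x * q3 y - q3 x * q2 y)
   (q0 x * q2 y - q1 x * q3 y + q2 x * q0 y + q3 x * q1 y)
   (q0 x * q3 y + q1 x * q2 y - q2 x * q1 y + q3 x * q0 y)"
instance
proof
  fix a b c :: hquat
  show "a * b * c = a * (b * c)"
    by (simp add: times_hquat_def algebra_simps)
qed (auto simp: zero_hquat_def one_hquat_def plus_hquat_def uminus_hquat_def minus_hquat_def
      times_hquat_def algebra_simps)
end

definition qscal :: "lorc \<Rightarrow> hquat" where "qscal a = HQ a 0 0 0"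
definition qreal :: "real \<Rightarrow> hquat" where "qreal x = qscal (lreal x)"
definition q\<sigma> :: hquat where "q\<sigma> = qscal (Lor 0 1)"
definition qi :: hquat where "qi = qscal (Lor \<i> 0)"
definition qI :: hquat where "qI = HQ 0 1 0 0"
definition qJ :: hquat where "qJ = HQ 0 0 1 0"
definition qK :: hquat where "qK = HQ 0 0 0 1"

definition qconj :: "hquat \<Rightarrow> hquat" where
  "qconj x = HQ (q0 x) (- q1 x) (- q2 x) (- q3 x)"

definition qhat :: "hquat \<Rightarrow> hquat" where
  "qhat x = HQ (lhat (q0 x)) (lhat (q1 x)) (lhat (q2 x)) (lhat (q3 x))"

definition qH :: "hquat \<Rightarrow> hquat \<Rightarrow> lorc" where
  "qH x y = q0 x * q0 y + q1 x * q1 y + q2 x * q2 y + q3 x * q3 y"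

definition H0 :: "hquat set" where
  "H0 = {qscal p0 + qi * qscal p1 * qI + qscal p2 * qJ + qi * qscal p3 * qK | p0 p1 p2 p3.
           {p0, p1, p2, p3} \<subseteq> lorentz_numbers}"

definition H1 :: "hquat set" where
  "H1 = {qi * qscal p0 + qscal p1 * qI + qi * qscal p2 * qJ + qscal p3 * qK | p0 p1 p2 p3.
           {p0, p1, p2, p3} \<subseteq> lorentz_numbers}"

text \<open>On \<open>R22\<close> the pairing \<open>qH\<close> is real valued and equals
  \<open>- x0\<^sup>2 + x1\<^sup>2 - x2\<^sup>2 + x3\<^sup>2\<close>.\<close>

definition R22 :: "hquat set" where
  "R22 = {q\<sigma> * qi * qreal x0 + qreal x1 * qI + qi * qreal x2 * qJ + qreal x3 * qK | x0 x1 x2 x3. True}"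

definition H21 :: "hquat set" where
  "H21 = {x \<in> R22. qH x x = - 1}"

definition R12 :: "hquat set" where
  "R12 = {x \<in> R22. qH x qI = 0}"


section \<open>Smooth surfaces\<close>

primrec Ck_on :: "nat \<Rightarrow> ('a::real_normed_vector \<Rightarrow> 'b::real_normed_vector) \<Rightarrow> 'a set \<Rightarrow> bool" where
  "Ck_on 0 f S \<longleftrightarrow> continuous_on S f"
| "Ck_on (Suc k) f S \<longleftrightarrow>
     (\<forall>x\<in>S. f differentiable (at x)) \<and> (\<forall>v. Ck_on k (\<lambda>x. frechet_derivative f (at x) v) S)"

definition Cinf_on :: "('a::real_normed_vector \<Rightarrow> 'b::real_normed_vector) \<Rightarrow> 'a set \<Rightarrow> bool" where
  "Cinf_on f S \<longleftrightarrow> open S \<and> (\<forall>k. Ck_on k f S)"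

text \<open>A surface is the whole of a topological type \<open>'m\<close>.\<close>

type_synonym 'm chart = "'m set \<times> ('m \<Rightarrow> real ^ 2)"

definition smooth_atlas :: "'m::topological_space chart set \<Rightarrow> bool" where
  "smooth_atlas A \<longleftrightarrow>
     (\<forall>(U, c)\<in>A. open U \<and> open (c ` U) \<and> (\<exists>c'. homeomorphism U (c ` U) c c')) \<and>
     (\<Union>(U, c)\<in>A. U) = UNIV \<and>
     (\<forall>(U, c)\<in>A. \<forall>(V, d)\<in>A. Cinf_on (d \<circ> inv_into U c) (c ` (U \<inter> V)))"

definition smooth_on :: "'m::topological_space chart set \<Rightarrow> 'm set \<Rightarrow> ('m \<Rightarrow> real) \<Rightarrow> bool" where
  "smooth_on A U f \<longleftrightarrow>
     open U \<and> (\<forall>(V, c)\<in>A. Cinf_on (f \<circ> inv_into V c) (c ` (U \<inter> V)))"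

definition smooth_at :: "'m::topological_space chart set \<Rightarrow> 'm \<Rightarrow> ('m \<Rightarrow> real) \<Rightarrow> bool" where
  "smooth_at A p f \<longleftrightarrow> (\<exists>U. p \<in> U \<and> smooth_on A U f)"

text \<open>Tangent vectors are derivations of the functions that are smooth near the point. The value
  on all other functions is fixed to be \<open>0\<close>, so that a derivation is determined as a function.\<close>

type_synonym 'm tvec = "('m \<Rightarrow> real) \<Rightarrow> real"

definition lincomb :: "real \<Rightarrow> 'm tvec \<Rightarrow> real \<Rightarrow> 'm tvec \<Rightarrow> 'm tvec" where
  "lincomb a u b v = (\<lambda>f. a * u f + b * v f)"

definition tangent_space :: "'m::topological_space chart set \<Rightarrow> 'm \<Rightarrow> 'm tvec set" where
  "tangent_space A p = {v.
     (\<forall>f. \<not> smooth_at A p f \<longrightarrow> v f = 0) \<and>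
     (\<forall>f h a b. smooth_at A p f \<and> smooth_at A p h \<longrightarrow>
        v (\<lambda>x. a * f x + b * h x) = a * v f + b * v h) \<and>
     (\<forall>f h. smooth_at A p f \<and> smooth_at A p h \<longrightarrow>
        v (\<lambda>x. f x * h x) = v f * h p + f p * v h)}"

definition smooth_vf :: "'m::topological_space chart set \<Rightarrow> 'm set \<Rightarrow> ('m \<Rightarrow> 'm tvec) \<Rightarrow> bool" where
  "smooth_vf A U X \<longleftrightarrow> open U \<and> (\<forall>p\<in>U. X p \<in> tangent_space A p) \<and>
     (\<forall>V f. V \<subseteq> U \<and> smooth_on A V f \<longrightarrow> smooth_on A V (\<lambda>p. X p f))"

definition lie_bracket ::
  "'m::topological_space chart set \<Rightarrow> ('m \<Rightarrow> 'm tvec) \<Rightarrow> ('m \<Rightarrow> 'm tvec) \<Rightarrow> 'm \<Rightarrow> 'm tvec" where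
  "lie_bracket A X Y p =
     (\<lambda>f. if smooth_at A p f then X p (\<lambda>q. Y q f) - Y p (\<lambda>q. X q f) else 0)"

text \<open>Smoothness and directional derivatives of \<open>hquat\<close>-valued functions are componentwise.\<close>

definition hsmooth_on :: "'m::topological_space chart set \<Rightarrow> 'm set \<Rightarrow> ('m \<Rightarrow> hquat) \<Rightarrow> bool" where
  "hsmooth_on A U F \<longleftrightarrow>
     (\<forall>c\<in>{q0, q1, q2, q3}. \<forall>d\<in>{sc, sg}. \<forall>r\<in>{Re, Im}. smooth_on A U (\<lambda>x. r (d (c (F x)))))"

definition dC :: "'m tvec \<Rightarrow> ('m \<Rightarrow> complex) \<Rightarrow> complex" where
  "dC v f = Complex (v (\<lambda>x. Re (f x))) (v (\<lambda>x. Im (f x)))"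

definition dL :: "'m tvec \<Rightarrow> ('m \<Rightarrow> lorc) \<Rightarrow> lorc" where
  "dL v f = Lor (dC v (\<lambda>x. sc (f x))) (dC v (\<lambda>x. sg (f x)))"

definition dH :: "'m tvec \<Rightarrow> ('m \<Rightarrow> hquat) \<Rightarrow> hquat" where
  "dH v F = HQ (dL v (\<lambda>x. q0 (F x))) (dL v (\<lambda>x. q1 (F x)))
               (dL v (\<lambda>x. q2 (F x))) (dL v (\<lambda>x. q3 (F x)))"


section \<open>Lorentzian metrics, Levi-Civita connection, orientations\<close>

type_synonym 'm metric = "'m \<Rightarrow> 'm tvec \<Rightarrow> 'm tvec \<Rightarrow> real"

definition on_basis :: "'m::topological_space chart set \<Rightarrow> 'm metric \<Rightarrow> 'm \<Rightarrow> 'm tvec \<Rightarrow> 'm tvec \<Rightarrow> bool" where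
  "on_basis A g p u v \<longleftrightarrow> u \<in> tangent_space A p \<and> v \<in> tangent_space A p \<and>
     g p u u = - 1 \<and> g p v v = 1 \<and> g p u v = 0 \<and>
     tangent_space A p = {lincomb a u b v | a b. True}"

definition lorentzian_metric :: "'m::topological_space chart set \<Rightarrow> 'm metric \<Rightarrow> bool" where
  "lorentzian_metric A g \<longleftrightarrow>
     (\<forall>p. \<forall>u\<in>tangent_space A p. \<forall>v\<in>tangent_space A p. g p u v = g p v u) \<and>
     (\<forall>p a b. \<forall>u\<in>tangent_space A p. \<forall>v\<in>tangent_space A p. \<forall>w\<in>tangent_space A p.
        g p (lincomb a u b v) w = a * g p u w + b * g p v w) \<and>
     (\<forall>p. \<exists>u v. on_basis A g p u v) \<and>
     (\<forall>U X Y. smooth_vf A U X \<and> smooth_vf A U Y \<longrightarrow> smooth_on A U (\<lambda>p. g p (X p) (Y p)))"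

type_synonym 'm connection = "('m \<Rightarrow> 'm tvec) \<Rightarrow> ('m \<Rightarrow> 'm tvec) \<Rightarrow> 'm \<Rightarrow> 'm tvec"

definition levi_civita :: "'m::topological_space chart set \<Rightarrow> 'm metric \<Rightarrow> 'm connection \<Rightarrow> bool" where
  "levi_civita A g nab \<longleftrightarrow> (\<forall>U X Y Z f h. smooth_vf A U X \<and> smooth_vf A U Y \<and> smooth_vf A U Z \<and>
      smooth_on A U f \<and> smooth_on A U h \<longrightarrow>
     smooth_vf A U (nab X Y) \<and>
     (\<forall>p\<in>U.
        nab (\<lambda>q. lincomb (f q) (X q) (h q) (Y q)) Z p = lincomb (f p) (nab X Z p) (h p) (nab Y Z p) \<and>
        nab X (\<lambda>q. lincomb 1 (Y q) 1 (Z q)) p = lincomb 1 (nab X Y p) 1 (nab X Z p) \<and>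
        nab X (\<lambda>q. lincomb (f q) (Y q) 0 (Y q)) p = lincomb (X p f) (Y p) (f p) (nab X Y p) \<and>
        X p (\<lambda>q. g q (Y q) (Z q)) = g p (nab X Y p) (Z p) + g p (Y p) (nab X Z p) \<and>
        lincomb 1 (nab X Y p) (- 1) (nab Y X p) = lie_bracket A X Y p))"

text \<open>Frames are triples consisting of a base point, a timelike and a spacelike unit vector. The
  connected group \<open>SO(1,1)\<close> acts on them from the right through the rapidity.\<close>

type_synonym ('m, 'v) frame = "'m \<times> 'v \<times> 'v"

fun boostM :: "real \<Rightarrow> ('m, 'm tvec) frame \<Rightarrow> ('m, 'm tvec) frame" where
  "boostM a (p, u, v) =
     (p, lincomb (cosh a) u (- sinh a) v, lincomb (cosh a) v (- sinh a) u)"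

text \<open>An orientation in space and in time is a smooth reduction of the bundle of
  orthonormal frames to the identity component of the Lorentz group.\<close>

definition frame_fieldM ::
  "'m::topological_space chart set \<Rightarrow> ('m, 'm tvec) frame set \<Rightarrow> 'm set \<Rightarrow>
     ('m \<Rightarrow> ('m, 'm tvec) frame) \<Rightarrow> bool" where
  "frame_fieldM A Q U e \<longleftrightarrow>
     (\<forall>x\<in>U. e x \<in> Q \<and> fst (e x) = x) \<and>
     smooth_vf A U (\<lambda>x. fst (snd (e x))) \<and> smooth_vf A U (\<lambda>x. snd (snd (e x)))"

definition space_time_oriented ::
  "'m::topological_space chart set \<Rightarrow> 'm metric \<Rightarrow> ('m, 'm tvec) frame set \<Rightarrow> bool" where
  "space_time_oriented A g Q \<longleftrightarrow>
     (\<forall>(p, u, v)\<in>Q. on_basis A g p u v) \<and>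
     (\<forall>e\<in>Q. {e'\<in>Q. fst e' = fst e} = range (\<lambda>a. boostM a e)) \<and>
     (\<forall>p. \<exists>U e. p \<in> U \<and> frame_fieldM A Q U e)"

text \<open>The bundle \<open>E\<close> with parallel sections \<open>e\<^sub>0, e\<^sub>1\<close>: a vector of
  a fibre is the pair of its components with respect to \<open>e\<^sub>0, e\<^sub>1\<close>.\<close>

type_synonym evec = "real \<times> real"

definition eprod :: "evec \<Rightarrow> evec \<Rightarrow> real" where
  "eprod w z = - fst w * fst z + snd w * snd z"

fun boostE :: "real \<Rightarrow> ('m, evec) frame \<Rightarrow> ('m, evec) frame" where
  "boostE a (p, u, v) =
     (p, cosh a *\<^sub>R u - sinh a *\<^sub>R v, cosh a *\<^sub>R v - sinh a *\<^sub>R u)"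

definition framesE :: "('m, evec) frame set" where
  "framesE = {boostE a (p, (1, 0), (0, 1)) | a p. True}"

definition frame_fieldE ::
  "'m::topological_space chart set \<Rightarrow> 'm set \<Rightarrow> ('m \<Rightarrow> ('m, evec) frame) \<Rightarrow> bool" where
  "frame_fieldE A U e \<longleftrightarrow>
     (\<forall>x\<in>U. e x \<in> framesE \<and> fst (e x) = x) \<and>
     (\<forall>c\<in>{fst, snd}. \<forall>d\<in>{fst, snd}. smooth_on A U (\<lambda>x. d (c (snd (e x)))))"


section \<open>Spin structures\<close>

text \<open>\<open>Spin(1,1)\<close> is the group of pairs \<open>(\<epsilon>, a)\<close>, \<open>\<epsilon> = \<plusminus>1\<close>, standing for
  \<open>\<epsilon> (cosh a + i sinh a I)\<close> in the case of \<open>TM\<close>, and for the same expression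
  with \<open>\<sigma>a\<close> in place of \<open>a\<close> in the case of \<open>E\<close>; both lie over the boost of rapidity
  \<open>2a\<close>. Together they yield \<open>\<plusminus>(cosh a + i sinh a I)\<close> for all Lorentz numbers \<open>a\<close>.\<close>

definition spin11 :: "(real \<times> real) set" where
  "spin11 = {- 1, 1} \<times> UNIV"

fun spin_mult :: "real \<times> real \<Rightarrow> real \<times> real \<Rightarrow> real \<times> real" where
  "spin_mult (\<epsilon>, a) (\<delta>, b) = (\<epsilon> * \<delta>, a + b)"

fun spinM :: "real \<times> real \<Rightarrow> hquat" where
  "spinM (\<epsilon>, a) = qreal \<epsilon> * (qreal (cosh a) + qi * qreal (sinh a) * qI)"

fun spinE :: "real \<times> real \<Rightarrow> hquat" where
  "spinE (\<epsilon>, a) = qreal \<epsilon> * (qreal (cosh a) + qi * q\<sigma> * qreal (sinh a) * qI)"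

text \<open>A spin structure is a principal \<open>Spin(1,1)\<close>-bundle (total space \<open>'q\<close>, right action \<open>act\<close>)
  with an equivariant map \<open>cov\<close> to the frame bundle; by equivariance, \<open>cov\<close> is two-to-one.\<close>

definition spin_section ::
  "('m::topological_space set \<Rightarrow> ('m \<Rightarrow> ('m, 'v) frame) \<Rightarrow> bool) \<Rightarrow> ('q::topological_space \<Rightarrow> ('m, 'v) frame) \<Rightarrow>
     'm set \<Rightarrow> ('m \<Rightarrow> 'q) \<Rightarrow> bool" where
  "spin_section ff cov U s \<longleftrightarrow> open U \<and> continuous_on U s \<and> ff U (\<lambda>x. cov (s x))"

definition spin_structure ::
  "('m::topological_space, 'v) frame set \<Rightarrow> (real \<Rightarrow> ('m, 'v) frame \<Rightarrow> ('m, 'v) frame) \<Rightarrow>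
     ('m set \<Rightarrow> ('m \<Rightarrow> ('m, 'v) frame) \<Rightarrow> bool) \<Rightarrow>
     ('q::topological_space \<Rightarrow> ('m, 'v) frame) \<Rightarrow> ('q \<Rightarrow> real \<times> real \<Rightarrow> 'q) \<Rightarrow> bool" where
  "spin_structure Q boost ff cov act \<longleftrightarrow>
     range cov = Q \<and>
     (\<forall>q. act q (1, 0) = q) \<and>
     (\<forall>q. \<forall>g\<in>spin11. \<forall>h\<in>spin11. act (act q g) h = act q (spin_mult g h)) \<and>
     (\<forall>q. \<forall>g\<in>spin11. cov (act q g) = boost (2 * snd g) (cov q)) \<and>
     (\<forall>p. \<exists>U s. p \<in> U \<and> spin_section ff cov U s \<and>
        (\<exists>t. homeomorphism (U \<times> spin11) {q. fst (cov q) \<in> U} (\<lambda>(x, g). act (s x) g) t))"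

record ('m, 'e, 'q) spin_surface =
  atlas :: "'m chart set"
  metric :: "'m metric"
  nabla :: "'m connection"
  framesM :: "('m, 'm tvec) frame set"
  covM :: "'q \<Rightarrow> ('m, 'm tvec) frame"
  actM :: "'q \<Rightarrow> real \<times> real \<Rightarrow> 'q"
  covE :: "'e \<Rightarrow> ('m, evec) frame"
  actE :: "'e \<Rightarrow> real \<times> real \<Rightarrow> 'e"

definition lorentzian_spin_surface ::
  "('m::{t2_space, second_countable_topology}, 'e::topological_space, 'q::topological_space) spin_surface
     \<Rightarrow> bool" where
  "lorentzian_spin_surface S \<longleftrightarrow>
     smooth_atlas (atlas S) \<and>
     lorentzian_metric (atlas S) (metric S) \<and>
     levi_civita (atlas S) (metric S) (nabla S) \<and>
     space_time_oriented (atlas S) (metric S) (framesM S) \<and>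
     spin_structure (framesM S) boostM (frame_fieldM (atlas S) (framesM S)) (covM S) (actM S) \<and>
     spin_structure framesE boostE (frame_fieldE (atlas S)) (covE S) (actE S)"


section \<open>Spinor fields\<close>

definition base :: "('m, 'e, 'q, 'z) spin_surface_scheme \<Rightarrow> 'e \<times> 'q \<Rightarrow> 'm" where
  "base S rq = fst (covM S (snd rq))"

text \<open>The fibre product of the two spin structures.\<close>

definition Qt :: "('m, 'e, 'q, 'z) spin_surface_scheme \<Rightarrow> ('e \<times> 'q) set" where
  "Qt S = {(r, q). fst (covE S r) = fst (covM S q)}"

definition spin_frame ::
  "('m::topological_space, 'e::topological_space, 'q::topological_space) spin_surface \<Rightarrow>
     'm set \<Rightarrow> ('m \<Rightarrow> 'e \<times> 'q) \<Rightarrow> bool" where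
  "spin_frame S U s \<longleftrightarrow>
     spin_section (frame_fieldE (atlas S)) (covE S) U (\<lambda>x. fst (s x)) \<and>
     spin_section (frame_fieldM (atlas S) (framesM S)) (covM S) U (\<lambda>x. snd (s x))"

text \<open>A section of the associated bundle is an equivariant function on the principal bundle;
  \<open>\<phi> (s x)\<close> is the coordinate \<open>[\<phi>]\<close> at \<open>x\<close> in the spinorial frame \<open>s\<close>.
  Values outside \<open>Qt S\<close> are irrelevant.\<close>

type_synonym ('e, 'q) spinor = "'e \<times> 'q \<Rightarrow> hquat"

definition spinor_field ::
  "('m::topological_space, 'e::topological_space, 'q::topological_space) spin_surface \<Rightarrow>
     ('e, 'q) spinor \<Rightarrow> bool" where
  "spinor_field S \<phi> \<longleftrightarrow>
     (\<forall>x\<in>Qt S. \<phi> x \<in> H0) \<and>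
     (\<forall>(r, q)\<in>Qt S. \<forall>g\<in>spin11. \<forall>h\<in>spin11.
        spinE g * spinM h * \<phi> (actE S r g, actM S q h) = \<phi> (r, q)) \<and>
     (\<forall>U s. spin_frame S U s \<longrightarrow> hsmooth_on (atlas S) U (\<lambda>x. \<phi> (s x)))"

text \<open>Coordinates \<open>\<sigma>ix\<^sub>0 + x\<^sub>1I + ix\<^sub>2J + x\<^sub>3K\<close> of a vector of \<open>E \<oplus> TM\<close>.\<close>

definition coord ::
  "('m, 'e, 'q) spin_surface \<Rightarrow> evec \<times> 'm tvec \<Rightarrow> 'e \<times> 'q \<Rightarrow> hquat" where
  "coord S X rq = (case X of (w, v) \<Rightarrow> case covE S (fst rq) of (_, f0, f1) \<Rightarrow>
     case covM S (snd rq) of (p, f2, f3) \<Rightarrow>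
       q\<sigma> * qi * qreal (- eprod w f0) + qreal (eprod w f1) * qI +
       qi * qreal (- metric S p v f2) * qJ + qreal (metric S p v f3) * qK)"

definition clifford ::
  "('m, 'e, 'q) spin_surface \<Rightarrow> ('m \<Rightarrow> evec \<times> 'm tvec) \<Rightarrow> ('e, 'q) spinor \<Rightarrow> ('e, 'q) spinor" where
  "clifford S X \<phi> = (\<lambda>x. q\<sigma> * qi * coord S (X (base S x)) x * qhat (\<phi> x))"

definition e0 :: "'m \<Rightarrow> evec \<times> 'm tvec" where
  "e0 = (\<lambda>_. ((1, 0), \<lambda>_. 0))"

definition e1 :: "'m \<Rightarrow> evec \<times> 'm tvec" where
  "e1 = (\<lambda>_. ((0, 1), \<lambda>_. 0))"

definition tang :: "'m tvec \<Rightarrow> 'm \<Rightarrow> evec \<times> 'm tvec" where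
  "tang v = (\<lambda>_. ((0, 0), v))"

definition bullet :: "('e, 'q) spinor \<Rightarrow> hquat \<Rightarrow> ('e, 'q) spinor" where
  "bullet \<phi> q = (\<lambda>x. q\<sigma> * qi * \<phi> x * q)"

definition pairing :: "('e, 'q) spinor \<Rightarrow> ('e, 'q) spinor \<Rightarrow> ('e, 'q) spinor" where
  "pairing \<phi> \<psi> = (\<lambda>x. q\<sigma> * qi * qconj (\<psi> x) * \<phi> x)"

definition plus_part :: "('e, 'q) spinor \<Rightarrow> ('e, 'q) spinor" where
  "plus_part \<phi> = (\<lambda>x. qreal (1/2) * (1 + q\<sigma>) * \<phi> x)"

definition minus_part :: "('e, 'q) spinor \<Rightarrow> ('e, 'q) spinor" where
  "minus_part \<phi> = (\<lambda>x. qreal (1/2) * (1 - q\<sigma>) * \<phi> x)"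

lemmas hquat_defs =
  zero_hquat_def one_hquat_def plus_hquat_def uminus_hquat_def minus_hquat_def times_hquat_def
  zero_lorc_def one_lorc_def plus_lorc_def uminus_lorc_def minus_lorc_def times_lorc_def
  qscal_def qreal_def lreal_def q\<sigma>_def qi_def qI_def qJ_def qK_def qconj_def qhat_def lhat_def qH_def

lemma plus_minus_parts:
  "\<phi> x = plus_part \<phi> x + minus_part \<phi> x"
  "q\<sigma> * plus_part \<phi> x = plus_part \<phi> x"
  "q\<sigma> * minus_part \<phi> x = - minus_part \<phi> x"
  by (cases "\<phi> x" rule: hquat.exhaust;
      simp add: plus_part_def minus_part_def hquat_defs hquat.expand lorc.expand field_simps)+

definition tilde :: "('m, 'e, 'q) spin_surface \<Rightarrow> ('e, 'q) spinor \<Rightarrow> ('e, 'q) spinor" where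
  "tilde S \<phi> = (\<lambda>x. plus_part \<phi> x + clifford S e1 (bullet (plus_part \<phi>) qI) x)"

text \<open>Covariant derivative along \<open>X\<close> in the spinorial frame \<open>s\<close>. For spin connections,
  \<open>[\<nabla>\<^sub>X\<phi>] = X[\<phi>] + 1/2 \<Sum>\<^sub>j\<^sub><\<^sub>k \<epsilon>\<^sub>j \<epsilon>\<^sub>k \<langle>\<nabla>\<^sub>X f\<^sub>j, f\<^sub>k\<rangle> [f\<^sub>j \<cdot> f\<^sub>k \<cdot> \<phi>]\<close>
  for the frame \<open>(f\<^sub>0, f\<^sub>1, f\<^sub>2, f\<^sub>3)\<close> under \<open>s\<close>, where only \<open>(j,k) = (0,1)\<close> and \<open>(2,3)\<close> contribute,
  both with \<open>\<epsilon>\<^sub>j \<epsilon>\<^sub>k = - 1\<close>; \<open>[f\<^sub>0 \<cdot> f\<^sub>1 \<cdot> \<phi>] = \<sigma>iI[\<phi>]\<close> and \<open>[f\<^sub>2 \<cdot> f\<^sub>3 \<cdot> \<phi>] = iI[\<phi>]\<close>.\<close>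

definition omegaE ::
  "('m, 'e, 'q) spin_surface \<Rightarrow> ('m \<Rightarrow> 'e \<times> 'q) \<Rightarrow> ('m \<Rightarrow> 'm tvec) \<Rightarrow> 'm \<Rightarrow> real" where
  "omegaE S s X p =
     (let f = (\<lambda>x. snd (covE S (fst (s x)))) in
        eprod (X p (\<lambda>x. fst (fst (f x))), X p (\<lambda>x. snd (fst (f x)))) (snd (f p)))"

definition omegaM ::
  "('m, 'e, 'q) spin_surface \<Rightarrow> ('m \<Rightarrow> 'e \<times> 'q) \<Rightarrow> ('m \<Rightarrow> 'm tvec) \<Rightarrow> 'm \<Rightarrow> real" where
  "omegaM S s X p =
     (let f = (\<lambda>x. snd (covM S (snd (s x)))) in
        metric S p (nabla S X (\<lambda>x. fst (f x)) p) (snd (f p)))"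

definition cov_deriv ::
  "('m, 'e, 'q) spin_surface \<Rightarrow> ('m \<Rightarrow> 'e \<times> 'q) \<Rightarrow> ('m \<Rightarrow> 'm tvec) \<Rightarrow> ('e, 'q) spinor \<Rightarrow> 'm \<Rightarrow> hquat" where
  "cov_deriv S s X \<phi> p =
     dH (X p) (\<lambda>x. \<phi> (s x))
     - qreal (1/2) * (qreal (omegaE S s X p) * q\<sigma> * qi * qI + qreal (omegaM S s X p) * qi * qI) * \<phi> (s p)"

text \<open>\<open>has_dirac S \<phi> \<psi>\<close> means \<open>D\<phi> = \<psi>\<close>, expressed in every local spinorial frame; recall that
  \<open>f\<^sub>2, f\<^sub>3\<close> have coordinates \<open>iJ, K\<close> in the frame they belong to.\<close>

definition has_dirac ::
  "('m::topological_space, 'e::topological_space, 'q::topological_space) spin_surface \<Rightarrow>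
     ('e, 'q) spinor \<Rightarrow> ('e, 'q) spinor \<Rightarrow> bool" where
  "has_dirac S \<phi> \<psi> \<longleftrightarrow> (\<forall>U s. spin_frame S U s \<longrightarrow> (\<forall>p\<in>U.
     \<psi> (s p) =
       - (q\<sigma> * qi * (qi * qJ) * qhat (cov_deriv S s (\<lambda>x. fst (snd (covM S (snd (s x))))) \<phi> p))
       + q\<sigma> * qi * qK * qhat (cov_deriv S s (\<lambda>x. snd (snd (covM S (snd (s x))))) \<phi> p)))"


section \<open>Immersions\<close>

definition isometric_immersion ::
  "('m::topological_space, 'e, 'q) spin_surface \<Rightarrow> ('m \<Rightarrow> hquat) \<Rightarrow> hquat set \<Rightarrow> bool" where
  "isometric_immersion S F T \<longleftrightarrow>
     hsmooth_on (atlas S) UNIV F \<and> range F \<subseteq> T \<and>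
     (\<forall>p. inj_on (\<lambda>v. dH v F) (tangent_space (atlas S) p) \<and>
        (\<forall>u\<in>tangent_space (atlas S) p. \<forall>v\<in>tangent_space (atlas S) p.
           qH (dH u F) (dH v F) = lreal (metric S p u v)))"

text \<open>\<open>dF(v) = \<langle>\<langle>v \<cdot> \<phi>, \<phi>\<rangle>\<rangle>\<close>.\<close>

definition induced_by ::
  "('m::topological_space, 'e, 'q) spin_surface \<Rightarrow> ('e, 'q) spinor \<Rightarrow> ('m \<Rightarrow> hquat) \<Rightarrow> bool" where
  "induced_by S \<phi> F \<longleftrightarrow> hsmooth_on (atlas S) UNIV F \<and> range F \<subseteq> R22 \<and>
     (\<forall>x\<in>Qt S. \<forall>v\<in>tangent_space (atlas S) (base S x).
        dH v F = pairing (clifford S (tang v) \<phi>) \<phi> x)"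

text \<open>The map \<open>X \<in> E \<mapsto> \<langle>\<langle>X \<cdot> \<phi>, \<phi>\<rangle>\<rangle>\<close> applied to the section \<open>X\<close> gives \<open>N\<close>.\<close>

definition normal_image ::
  "('m, 'e, 'q) spin_surface \<Rightarrow> ('e, 'q) spinor \<Rightarrow> ('m \<Rightarrow> evec \<times> 'm tvec) \<Rightarrow> ('m \<Rightarrow> hquat) \<Rightarrow> bool" where
  "normal_image S \<phi> X N \<longleftrightarrow> (\<forall>x\<in>Qt S. N (base S x) = pairing (clifford S X \<phi>) \<phi> x)"

text \<open>Second fundamental form of an isometric immersion in the flat space \<open>R22\<close>
  (Gauss formula), and its mean curvature vector \<open>1/2 tr B\<close>.\<close>

definition second_ff ::
  "('m, 'e, 'q) spin_surface \<Rightarrow> ('m \<Rightarrow> hquat) \<Rightarrow> ('m \<Rightarrow> 'm tvec) \<Rightarrow> ('m \<Rightarrow> 'm tvec) \<Rightarrow> 'm \<Rightarrow> hquat" where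
  "second_ff S F X Y p = dH (X p) (\<lambda>x. dH (Y x) F) - dH (nabla S X Y p) F"

definition has_mean_curvature_vector ::
  "('m::topological_space, 'e, 'q) spin_surface \<Rightarrow> ('m \<Rightarrow> hquat) \<Rightarrow> ('m \<Rightarrow> hquat) \<Rightarrow> bool" where
  "has_mean_curvature_vector S F h \<longleftrightarrow>
     (\<forall>U e. frame_fieldM (atlas S) (framesM S) U e \<longrightarrow> (\<forall>p\<in>U.
        h p = qreal (1/2) *
          (- second_ff S F (\<lambda>x. fst (snd (e x))) (\<lambda>x. fst (snd (e x))) p
           + second_ff S F (\<lambda>x. snd (snd (e x))) (\<lambda>x. snd (snd (e x))) p)))"

text \<open>The mean curvature vector in \<open>H21\<close> is the component orthogonal to the position
  vector of the one in \<open>R22\<close>; recall that \<open>qH (F p) (F p) = - 1\<close>.\<close>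

definition minimal_in_H21 ::
  "('m::topological_space, 'e, 'q) spin_surface \<Rightarrow> ('m \<Rightarrow> hquat) \<Rightarrow> bool" where
  "minimal_in_H21 S F \<longleftrightarrow> isometric_immersion S F H21 \<and>
     (\<exists>h. has_mean_curvature_vector S F h \<and> (\<forall>p. h p + qscal (qH (h p) (F p)) * F p = 0))"

definition unit_timelike_normal_R12 ::
  "('m::topological_space, 'e, 'q) spin_surface \<Rightarrow> ('m \<Rightarrow> hquat) \<Rightarrow> ('m \<Rightarrow> hquat) \<Rightarrow> bool" where
  "unit_timelike_normal_R12 S F N \<longleftrightarrow>
     hsmooth_on (atlas S) UNIV N \<and> range N \<subseteq> R12 \<and>
     (\<forall>p. qH (N p) (N p) = - 1 \<and> (\<forall>v\<in>tangent_space (atlas S) p. qH (dH v F) (N p) = 0))"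

definition has_mean_curvature_R12 ::
  "('m::topological_space, 'e, 'q) spin_surface \<Rightarrow> ('m \<Rightarrow> hquat) \<Rightarrow> ('m \<Rightarrow> hquat) \<Rightarrow> ('m \<Rightarrow> real) \<Rightarrow> bool" where
  "has_mean_curvature_R12 S F N h \<longleftrightarrow>
     unit_timelike_normal_R12 S F N \<and> has_mean_curvature_vector S F (\<lambda>p. qreal (h p) * N p)"

end

theory Submission
  imports Defs
begin

text \<open>The field \<open>\<phi>\<^sup>+\<close> alone satisfies \<open>D\<phi>\<^sup>+ = e\<^sub>0 \<cdot> \<phi>\<^sup>+\<close>, since both \<open>D\<close> and Clifford
  multiplication by a vector exchange the two eigenspaces of \<open>\<sigma>\<close>. As \<open>e\<^sub>1\<close> is parallel and
  anticommutes with \<open>e\<^sub>0\<close> and with tangent vectors, and as right multiplication by \<open>I\<close>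
  anticommutes with Clifford multiplication, the second summand \<open>e\<^sub>1 \<cdot> (\<phi>\<^sup>+ \<bullet> I)\<close> satisfies
  the same equation. The two summands lie in complementary eigenspaces of \<open>\<sigma>\<close>, are therefore
  orthogonal, and have norms \<open>(1 + \<sigma>)/2\<close> and \<open>(1 - \<sigma>)/2\<close>, which add up to 1. Finally \<open>\<psi> \<mapsto> e\<^sub>1
  \<cdot> (\<psi> \<bullet> I)\<close> is an involution, so it fixes the sum of \<open>\<phi>\<^sup>+\<close> and the image of \<open>\<phi>\<^sup>+\<close>, and its
  fixed points are the solutions of \<open>e\<^sub>1 \<cdot> \<psi> = -\<psi> \<bullet> I\<close>. In coordinates the transformation is
  \<open>twist\<close>, and these arguments are \<open>twist_dirac\<close>, \<open>twist_cov_deriv\<close>, \<open>twist_unit\<close> and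
  \<open>twist_eigen\<close>.

  For any spinor field \<open>\<psi>\<close> with these three properties, in coordinates with respect to a spin
  frame, \<open>\<langle>\<langle>X \<cdot> \<psi>, \<psi>\<rangle>\<rangle>\<close> is \<open>-\<close> the product of the conjugate of \<open>[\<psi>]\<close>, of \<open>[X]\<close> and of the hat
  of \<open>[\<psi>]\<close>. For unit \<open>\<psi>\<close> this is an isometry from \<open>E \<oplus> TM\<close> onto the pseudo-Euclidean space,
  and it sends \<open>e\<^sub>1\<close> to \<open>I\<close>, because \<open>e\<^sub>1 \<cdot> \<psi> = -\<psi> \<bullet> I\<close>; so tangent vectors and \<open>e\<^sub>0\<close> are sent
  to the orthogonal complement of \<open>I\<close>. The Dirac equation says two things about the derivative
  of this map on tangent vectors: its antisymmetric part vanishes (\<open>dirac_closed\<close>), so that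
  the form \<open>\<xi>(X) = \<langle>\<langle>X \<cdot> \<psi>, \<psi>\<rangle>\<rangle>\<close> is closed, and half of its trace is the image of \<open>e\<^sub>0\<close>
  (\<open>dirac_trace\<close>), so that an integral \<open>G\<close> of \<open>\<xi>\<close> has mean curvature vector equal to the unit
  normal \<open>\<langle>\<langle>e\<^sub>0 \<cdot> \<psi>, \<psi>\<rangle>\<rangle>\<close>, that is, mean curvature 1.

  The integral exists by \<open>closed_form_exact\<close>. Locally it is given by the Poincare lemma
  (\<open>radial_primitive\<close>) in a chart. Globally the local integrals are continued along paths;
  since paths and homotopies are merely continuous, the continuation is done by hand, with
  functions on the interval and on the square that differ from each local integral by locally
  constant functions (\<open>potential_square\<close>, \<open>simply_connected_glue\<close>).\<close>

section \<open>Smooth functions on open sets\<close>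

lemma Ck_on_cong:
  assumes "open S" "\<And>x. x \<in> S \<Longrightarrow> f x = g x" "Ck_on k f S"
  shows "Ck_on k g S"
  using assms(2,3)
proof (induction k arbitrary: f g)
  case 0
  then show ?case by (simp cong: continuous_on_cong)
next
  case (Suc k)
  have d: "g differentiable (at x) \<and> frechet_derivative g (at x) = frechet_derivative f (at x)"
    if "x \<in> S" for x
  proof -
    have "(f has_derivative frechet_derivative f (at x)) (at x)"
      using Suc.prems(2) that by (simp add: frechet_derivative_works)
    then have "(g has_derivative frechet_derivative f (at x)) (at x)"
      using has_derivative_transform_within_open[OF _ assms(1) that] Suc.prems(1) by blast
    then show ?thesis
      using frechet_derivative_at differentiable_def by metis
  qed
  have "Ck_on k (\<lambda>x. frechet_derivative g (at x) v) S" for v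
    using Suc.IH[of "\<lambda>x. frechet_derivative f (at x) v" "\<lambda>x. frechet_derivative g (at x) v"]
      Suc.prems(2) d by simp
  then show ?case using d by simp
qed

lemma Ck_on_subset: "Ck_on k f S \<Longrightarrow> T \<subseteq> S \<Longrightarrow> Ck_on k f T"
  by (induction k arbitrary: f) (auto intro: continuous_on_subset)

lemma Ck_on_local:
  assumes "\<And>x. x \<in> S \<Longrightarrow> \<exists>T. open T \<and> x \<in> T \<and> Ck_on k f T"
  shows "Ck_on k f S"
  using assms
proof (induction k arbitrary: f)
  case 0
  then show ?case
    by (auto intro!: continuous_at_imp_continuous_on dest!: 0 simp: continuous_on_eq_continuous_at)
next
  case (Suc k)
  have "f differentiable (at x)" if "x \<in> S" for x
    using Suc.prems[OF that] by auto
  moreover have "Ck_on k (\<lambda>x. frechet_derivative f (at x) v) S" for v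
    by (rule Suc.IH) (use Suc.prems in fastforce)
  ultimately show ?case by simp
qed

lemma Ck_on_SucD: "Ck_on (Suc k) f S \<Longrightarrow> Ck_on k f S"
proof (induction k arbitrary: f)
  case 0
  then show ?case
    by (auto intro!: continuous_at_imp_continuous_on differentiable_imp_continuous_within)
next
  case (Suc k)
  then show ?case by (metis Ck_on.simps(2))
qed

lemma Ck_on_const: "Ck_on k (\<lambda>x. c) S"
  by (induction k arbitrary: c) (simp_all add: frechet_derivative_const)

lemma frechet_derivative_eqI: "(f has_derivative f') (at x) \<Longrightarrow> frechet_derivative f (at x) = f'"
  using frechet_derivative_at by metis

lemma Ck_on_add:
  assumes "open S" "Ck_on k f S" "Ck_on k g S"
  shows "Ck_on k (\<lambda>x. f x + g x) S"
  using assms(2,3)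
proof (induction k arbitrary: f g)
  case 0
  then show ?case by (simp add: continuous_on_add)
next
  case (Suc k)
  have "Ck_on k (\<lambda>x. frechet_derivative (\<lambda>x. f x + g x) (at x) v) S" for v
    by (rule Ck_on_cong[OF assms(1) _ Suc.IH, of "\<lambda>x. frechet_derivative f (at x) v" "\<lambda>x. frechet_derivative g (at x) v"])
       (use Suc.prems in \<open>auto intro!: frechet_derivative_eqI[symmetric, THEN fun_cong] has_derivative_add
          simp flip: frechet_derivative_works\<close>)
  then show ?case using Suc.prems by (auto intro: differentiable_add)
qed

lemma Ck_on_mult:
  fixes f g :: "'a::real_normed_vector \<Rightarrow> real"
  assumes "open S" "Ck_on k f S" "Ck_on k g S"
  shows "Ck_on k (\<lambda>x. f x * g x) S"
  using assms(2,3)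
proof (induction k arbitrary: f g)
  case 0
  then show ?case by (simp add: continuous_on_mult)
next
  case (Suc k)
  have d: "frechet_derivative (\<lambda>x. f x * g x) (at x) v =
      f x * frechet_derivative g (at x) v + frechet_derivative f (at x) v * g x" if "x \<in> S" for x v
  proof -
    have "((\<lambda>x. f x * g x) has_derivative
       (\<lambda>h. f x * frechet_derivative g (at x) h + frechet_derivative f (at x) h * g x)) (at x)"
      by (rule has_derivative_mult) (use Suc.prems that in \<open>auto simp: frechet_derivative_works\<close>)
    then show ?thesis by (simp add: frechet_derivative_eqI)
  qed
  have "Ck_on k (\<lambda>x. f x * frechet_derivative g (at x) v + frechet_derivative f (at x) v * g x) S" for v
    by (intro Ck_on_add assms(1) Suc.IH) (use Suc.prems Ck_on_SucD in auto)
  then have "Ck_on k (\<lambda>x. frechet_derivative (\<lambda>x. f x * g x) (at x) v) S" for v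
    by (rule Ck_on_cong[OF assms(1), rotated]) (simp add: d)
  then show ?case using Suc.prems by (auto intro: differentiable_mult)
qed

text \<open>The derivative of \<open>1/f\<close> is a product of \<open>1/f\<close> with itself and with the derivative of \<open>f\<close>, so
  the induction on the order closes on \<open>1/f\<close> without the chain rule.\<close>

lemma Ck_on_inverse:
  fixes f :: "'a::real_normed_vector \<Rightarrow> real"
  assumes "open S" "Ck_on k f S" "\<And>x. x \<in> S \<Longrightarrow> f x \<noteq> 0"
  shows "Ck_on k (\<lambda>x. inverse (f x)) S"
  using assms(2)
proof (induction k)
  case 0
  then show ?case using assms(3) by (simp add: continuous_on_inverse)
next
  case (Suc k)
  have hd: "((\<lambda>x. inverse (f x)) has_derivative
       (\<lambda>h. - (inverse (f x) * frechet_derivative f (at x) h * inverse (f x)))) (at x)" if "x \<in> S" for x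
    by (rule Deriv.has_derivative_inverse)
       (use Suc.prems that assms(3) in \<open>auto simp: frechet_derivative_works\<close>)
  have I: "Ck_on k (\<lambda>x. inverse (f x)) S" using Suc Ck_on_SucD by blast
  have I2: "Ck_on k (\<lambda>x. (- 1) * (inverse (f x) * frechet_derivative f (at x) v * inverse (f x))) S" for v
    by (intro Ck_on_mult assms(1) I Ck_on_const) (use Suc.prems in auto)
  have "Ck_on k (\<lambda>x. frechet_derivative (\<lambda>x. inverse (f x)) (at x) v) S" for v
    by (rule Ck_on_cong[OF assms(1) _ I2[of v]]) (simp add: frechet_derivative_eqI[OF hd])
  then show ?case using hd by (auto simp: differentiable_def)
qed

lemma Cinf_on_deriv: "Cinf_on f S \<Longrightarrow> Cinf_on (\<lambda>x. frechet_derivative f (at x) v) S"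
  unfolding Cinf_on_def by (metis Ck_on.simps(2))

lemma Cinf_on_differentiable: "Cinf_on f S \<Longrightarrow> x \<in> S \<Longrightarrow> f differentiable (at x)"
  unfolding Cinf_on_def by (metis Ck_on.simps(2))

lemma Cinf_on_continuous: "Cinf_on f S \<Longrightarrow> continuous_on S f"
  unfolding Cinf_on_def by (metis Ck_on.simps(1))

section \<open>Gluing local potentials over a simply connected space\<close>

text \<open>This is a continuous lift of \<open>\<gamma>\<close> to the etale space of the sheaf generated by the local
  potentials \<open>(U, f) \<in> L\<close>. It replaces the integral of the form along \<open>\<gamma>\<close>, as \<open>\<gamma>\<close> is only
  continuous.\<close>

definition potential_along ::
  "('a set \<times> ('a \<Rightarrow> real)) set \<Rightarrow> 't::topological_space set \<Rightarrow> ('t \<Rightarrow> 'a) \<Rightarrow> ('t \<Rightarrow> real) \<Rightarrow> bool" where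
  "potential_along L K \<gamma> h \<longleftrightarrow> (\<forall>t\<in>K. \<forall>(U, f)\<in>L. \<gamma> t \<in> U \<longrightarrow>
     (\<forall>\<^sub>F s in at t within K. h s - f (\<gamma> s) = h t - f (\<gamma> t)))"

lemma potential_alongD:
  "potential_along L K \<gamma> h \<Longrightarrow> t \<in> K \<Longrightarrow> (U, f) \<in> L \<Longrightarrow> \<gamma> t \<in> U \<Longrightarrow>
    \<forall>\<^sub>F s in at t within K. h s - f (\<gamma> s) = h t - f (\<gamma> t)"
  unfolding potential_along_def by blast

lemma potential_along_compose:
  fixes \<tau> :: "'s::topological_space \<Rightarrow> 't::topological_space"
  assumes "potential_along L K \<gamma> h" "continuous_on K' \<tau>" "\<tau> ` K' \<subseteq> K"
    "\<And>t. t \<in> K' \<Longrightarrow> \<gamma>' t = \<gamma> (\<tau> t)"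
  shows "potential_along L K' \<gamma>' (\<lambda>t. h (\<tau> t))"
  unfolding potential_along_def
proof (intro ballI, clarify)
  fix t U f assume t: "t \<in> K'" "(U, f) \<in> L" "\<gamma>' t \<in> U"
  have "\<forall>\<^sub>F s in at (\<tau> t) within K. h s - f (\<gamma> s) = h (\<tau> t) - f (\<gamma> (\<tau> t))"
    using potential_alongD[OF assms(1), of "\<tau> t" U f] t assms(3,4) by auto
  then obtain S where S: "open S" "\<tau> t \<in> S"
    "\<And>s. s \<in> S \<Longrightarrow> s \<in> K \<Longrightarrow> h s - f (\<gamma> s) = h (\<tau> t) - f (\<gamma> (\<tau> t))"
    unfolding eventually_at_topological by (metis)
  obtain T where T: "open T" "t \<in> T" "\<And>s. s \<in> T \<Longrightarrow> s \<in> K' \<Longrightarrow> \<tau> s \<in> S"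
    using assms(2) S(1,2) t(1) unfolding continuous_on_topological by metis
  show "\<forall>\<^sub>F s in at t within K'. h (\<tau> s) - f (\<gamma>' s) = h (\<tau> t) - f (\<gamma>' t)"
    unfolding eventually_at_topological
    by (rule exI[of _ T]) (use T S(3) assms(3,4) t(1) in auto)
qed

text \<open>On overlaps the local potentials differ by locally constant functions, as primitives of one
  closed form do.\<close>

definition compatible :: "('a::topological_space set \<times> ('a \<Rightarrow> real)) set \<Rightarrow> bool" where
  "compatible L \<longleftrightarrow> (\<forall>(U, f)\<in>L. open U) \<and> (\<Union>(U, f)\<in>L. U) = UNIV \<and>
     (\<forall>(U, f)\<in>L. \<forall>(V, g)\<in>L. \<forall>x\<in>U \<inter> V. \<forall>\<^sub>F y in nhds x. f y - g y = f x - g x)"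

lemma compatibleD:
  assumes "compatible L" "(U, f) \<in> L" "(V, g) \<in> L" "x \<in> U" "x \<in> V"
  shows "\<forall>\<^sub>F y in nhds x. f y - g y = f x - g x"
proof -
  have "\<forall>(U, f)\<in>L. \<forall>(V, g)\<in>L. \<forall>x\<in>U \<inter> V. \<forall>\<^sub>F y in nhds x. f y - g y = f x - g x"
    using assms(1) unfolding compatible_def by argo
  from bspec[OF this assms(2)] assms(3-5) show ?thesis by fastforce
qed

text \<open>Both functions differ from the same local potential by locally constant functions, so their
  difference is locally constant.\<close>

lemma potential_unique:
  assumes L: "compatible L" and "connected K" "potential_along L K \<gamma> h" "potential_along L K \<gamma> k" "a \<in> K" "b \<in> K"
  shows "h a - k a = h b - k b"
proof -
  have "\<forall>t\<in>K. \<forall>\<^sub>F s in at t within K. h t - k t = h s - k s"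
  proof
    fix t assume t: "t \<in> K"
    have "\<gamma> t \<in> (\<Union>(U, f)\<in>L. U)" using L unfolding compatible_def by simp
    then obtain U f where U: "(U, f) \<in> L" "\<gamma> t \<in> U" by auto
    show "\<forall>\<^sub>F s in at t within K. h t - k t = h s - k s"
      using potential_alongD[OF assms(3) t U] potential_alongD[OF assms(4) t U]
    proof eventually_elim
      case (elim s)
      then show ?case by simp
    qed
  qed
  then show ?thesis
    using connected_local_const[OF assms(2,5,6), of "\<lambda>s. h s - k s"] by blast
qed

lemma potential_along_shift: "potential_along L K \<gamma> h \<Longrightarrow> potential_along L K \<gamma> (\<lambda>s. h s + c)"
  unfolding potential_along_def by (simp add: add_diff_eq diff_add_eq)

text \<open>On the connected overlap the two functions differ by a constant, which is subtracted.
  Closedness of both sets is used at the points that lie in one of them only: near such a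
  point the other set is absent.\<close>

lemma potential_glue:
  fixes K1 K2 :: "'t::topological_space set"
  assumes L: "compatible L"
    and K: "closed K1" "closed K2" "connected (K1 \<inter> K2)" "K1 \<inter> K2 \<noteq> {}"
    and h: "potential_along L K1 \<gamma> h1" "potential_along L K2 \<gamma> h2"
  shows "\<exists>h. potential_along L (K1 \<union> K2) \<gamma> h"
proof -
  obtain a where a: "a \<in> K1 \<inter> K2" using K(4) by blast
  define k where "k s = h2 s + (h1 a - h2 a)" for s
  have k: "potential_along L K2 \<gamma> k"
    unfolding k_def by (rule potential_along_shift[OF h(2)])
  have sub: "potential_along L (K1 \<inter> K2) \<gamma> f" if "potential_along L K1 \<gamma> f \<or> potential_along L K2 \<gamma> f" for f
    using that potential_along_compose[of L _ \<gamma> f "K1 \<inter> K2" "\<lambda>t. t" \<gamma>] by (elim disjE) auto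
  have eq: "h1 s = k s" if "s \<in> K1 \<inter> K2" for s
    using potential_unique[OF L K(3) sub sub a that, of h1 k] h(1) k by (simp add: k_def)
  define h where "h s = (if s \<in> K1 then h1 s else k s)" for s
  have hk: "h s = k s" if "s \<in> K2" for s using eq that by (auto simp: h_def)
  have "potential_along L (K1 \<union> K2) \<gamma> h"
    unfolding potential_along_def
  proof (intro ballI, clarify)
    fix t U f assume t: "t \<in> K1 \<union> K2" "(U, f) \<in> L" "\<gamma> t \<in> U"
    have 1: "\<forall>\<^sub>F s in at t within K1. h s - f (\<gamma> s) = h t - f (\<gamma> t)"
    proof (cases "t \<in> K1")
      case True
      have "\<forall>\<^sub>F s in at t within K1. s \<in> K1" unfolding eventually_at_topological by auto
      with potential_alongD[OF h(1) True t(2,3)]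
      show ?thesis
        by eventually_elim (simp add: h_def True)
    next
      case False
      then show ?thesis unfolding eventually_at_topological using K(1) by (intro exI[of _ "- K1"]) auto
    qed
    have 2: "\<forall>\<^sub>F s in at t within K2. h s - f (\<gamma> s) = h t - f (\<gamma> t)"
    proof (cases "t \<in> K2")
      case True
      have "\<forall>\<^sub>F s in at t within K2. s \<in> K2" unfolding eventually_at_topological by auto
      with potential_alongD[OF k True t(2,3)]
      show ?thesis
        by eventually_elim (simp add: hk True)
    next
      case False
      then show ?thesis unfolding eventually_at_topological using K(2) by (intro exI[of _ "- K2"]) auto
    qed
    show "\<forall>\<^sub>F s in at t within K1 \<union> K2. h s - f (\<gamma> s) = h t - f (\<gamma> t)"
      unfolding at_within_union using 1 2 by (simp add: eventually_sup)
  qed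
  then show ?thesis by blast
qed

lemma potential_local:
  assumes L: "compatible L" and "continuous_on K \<gamma>" "(U, f) \<in> L" "\<gamma> ` K \<subseteq> U"
  shows "potential_along L K \<gamma> (\<lambda>t. f (\<gamma> t))"
  unfolding potential_along_def
proof (intro ballI, clarify)
  fix t V g assume t: "t \<in> K" "(V, g) \<in> L" "\<gamma> t \<in> V"
  then have "\<forall>\<^sub>F y in nhds (\<gamma> t). f y - g y = f (\<gamma> t) - g (\<gamma> t)"
    using compatibleD[OF L assms(3) t(2), of "\<gamma> t"] assms(4) by auto
  moreover have "(\<gamma> \<longlongrightarrow> \<gamma> t) (at t within K)"
    using assms(2) t(1) by (simp add: continuous_on)
  ultimately show "\<forall>\<^sub>F s in at t within K. f (\<gamma> s) - g (\<gamma> s) = f (\<gamma> t) - g (\<gamma> t)"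
    using eventually_compose_filterlim[of "\<lambda>y. f y - g y = f (\<gamma> t) - g (\<gamma> t)" "nhds (\<gamma> t)" \<gamma> "at t within K"]
    by blast
qed

text \<open>A subdivision into small rectangles, each mapped into the domain of one local potential. The
  bisection principle for intervals is applied twice: for a fixed height it produces a
  potential on a thin horizontal strip, and then the strips are stacked.\<close>

lemma potential_square:
  fixes \<gamma> :: "real \<times> real \<Rightarrow> 'a::topological_space"
  assumes L: "compatible L" and c: "continuous_on ({0..1} \<times> {0..1}) \<gamma>"
  shows "\<exists>h. potential_along L ({0..1} \<times> {0..1}) \<gamma> h"
proof -
  define P where "P a b c d \<longleftrightarrow> (0 \<le> a \<and> b \<le> 1 \<and> 0 \<le> c \<and> d \<le> 1 \<longrightarrow>
     (\<exists>h. potential_along L ({a..b} \<times> {c..d}) \<gamma> h))" for a b c d :: real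
  have loc0: "\<exists>e>0. \<forall>a b c d. a \<le> x \<and> x \<le> b \<and> c \<le> y \<and> y \<le> d \<and> b - a < e \<and> d - c < e \<longrightarrow> P a b c d"
    if xy: "0 \<le> x" "x \<le> 1" "0 \<le> y" "y \<le> 1" for x y
  proof -
    have "\<gamma> (x, y) \<in> (\<Union>(U, f)\<in>L. U)" using L unfolding compatible_def by simp
    then obtain U f where U: "(U, f) \<in> L" "\<gamma> (x, y) \<in> U" by auto
    then have "open U" using L unfolding compatible_def by auto
    then obtain T where T: "open T" "(x, y) \<in> T" "\<And>z. z \<in> T \<Longrightarrow> z \<in> {0..1} \<times> {0..1} \<Longrightarrow> \<gamma> z \<in> U"
      using continuous_on_topological[THEN iffD1, OF c, rule_format, of "(x, y)" U] xy U(2) by auto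
    obtain A B where AB: "open A" "open B" "x \<in> A" "y \<in> B" "A \<times> B \<subseteq> T"
      using open_prod_elim[OF T(1,2)] by (metis mem_Sigma_iff)
    obtain e1 e2 where e: "e1 > 0" "e2 > 0" "ball x e1 \<subseteq> A" "ball y e2 \<subseteq> B"
      using AB(1-4) by (meson open_contains_ball)
    show ?thesis
    proof (intro exI[of _ "min e1 e2"] conjI allI impI)
      fix a b c d
      assume abcd: "a \<le> x \<and> x \<le> b \<and> c \<le> y \<and> y \<le> d \<and> b - a < min e1 e2 \<and> d - c < min e1 e2"
      then have sub: "{a..b} \<subseteq> A" "{c..d} \<subseteq> B"
        using e(3,4) by (auto simp: ball_def dist_real_def subset_iff)
      show "P a b c d"
        unfolding P_def
      proof
        assume 1: "0 \<le> a \<and> b \<le> 1 \<and> 0 \<le> c \<and> d \<le> 1"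
        have "potential_along L ({a..b} \<times> {c..d}) \<gamma> (\<lambda>t. f (\<gamma> t))"
        proof (rule potential_local[OF L _ U(1)])
          show "continuous_on ({a..b} \<times> {c..d}) \<gamma>"
            by (rule continuous_on_subset[OF assms(2)]) (use 1 in auto)
          show "\<gamma> ` ({a..b} \<times> {c..d}) \<subseteq> U"
            using T(3) sub AB(5) 1 by fastforce
        qed
        then show "\<exists>h. potential_along L ({a..b} \<times> {c..d}) \<gamma> h" by blast
      qed
    qed (use e in auto)
  qed
  have strip: "\<exists>e>0. \<forall>c d. c \<le> y \<and> y \<le> d \<and> d - c < e \<longrightarrow> P 0 1 c d" if y: "0 \<le> y" "y \<le> 1" for y
  proof -
    have "\<exists>e>0. \<forall>c d. c \<le> y \<and> y \<le> d \<and> d - c < e \<longrightarrow> 0 \<le> a \<and> b \<le> 1 \<longrightarrow> P a b c d"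
      if ab: "a = 0" "b = 1" for a b
    proof -
      have "(a::real) \<le> b" using ab by simp
      then show ?thesis
      proof (induction rule: Bolzano)
        case (trans a b c)
        then obtain e1 e2 where e: "e1 > 0" "e2 > 0"
          "\<And>p d. p \<le> y \<and> y \<le> d \<and> d - p < e1 \<Longrightarrow> 0 \<le> a \<and> b \<le> 1 \<longrightarrow> P a b p d"
          "\<And>p d. p \<le> y \<and> y \<le> d \<and> d - p < e2 \<Longrightarrow> 0 \<le> b \<and> c \<le> 1 \<longrightarrow> P b c p d" by blast
        have "P a c p d" if pd: "p \<le> y" "y \<le> d" "d - p < min e1 e2" and ac: "0 \<le> a" "c \<le> 1" for p d
          unfolding P_def
        proof
          assume 1: "0 \<le> a \<and> c \<le> 1 \<and> 0 \<le> p \<and> d \<le> 1"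
          have "P a b p d" "P b c p d" using e(3,4)[of p d] pd ac trans(3,4) by auto
          then obtain h1 h2 where h: "potential_along L ({a..b} \<times> {p..d}) \<gamma> h1"
            "potential_along L ({b..c} \<times> {p..d}) \<gamma> h2"
            unfolding P_def using 1 trans(3,4) by auto
          have i: "({a..b} \<times> {p..d}) \<inter> ({b..c} \<times> {p..d}) = {b} \<times> {p..d}" using trans(3,4) by auto
          have u: "({a..b} \<times> {p..d}) \<union> ({b..c} \<times> {p..d}) = {a..c} \<times> {p..d}" using trans(3,4) by auto
          show "\<exists>h. potential_along L ({a..c} \<times> {p..d}) \<gamma> h"
            using potential_glue[OF L _ _ _ _ h] unfolding i u
            using pd by (auto simp: closed_Times connected_Times)
        qed
        then show ?case using e(1,2) by (intro exI[of _ "min e1 e2"]) auto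
      next
        case (local x)
        then have "0 \<le> x" "x \<le> 1" using ab by auto
        obtain e where "e > 0" "\<forall>a b c d. a \<le> x \<and> x \<le> b \<and> c \<le> y \<and> y \<le> d \<and> b - a < e \<and> d - c < e \<longrightarrow> P a b c d"
          using loc0[OF \<open>0 \<le> x\<close> \<open>x \<le> 1\<close> y] by blast
        then show ?case by (intro exI[of _ e]) auto
      qed
    qed
    from this[of 0 1] show ?thesis by simp
  qed
  have "0 \<le> c \<and> d \<le> 1 \<longrightarrow> P 0 1 c d" if cd: "c = 0" "d = 1" for c d
  proof -
    have "(c::real) \<le> d" using cd by simp
    then show ?thesis
    proof (induction rule: Bolzano)
      case (trans a b c)
      show ?case
      proof (intro impI)
        assume 1: "0 \<le> a \<and> c \<le> 1"
        then obtain h1 h2 where h: "potential_along L ({0..1} \<times> {a..b}) \<gamma> h1"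
          "potential_along L ({0..1} \<times> {b..c}) \<gamma> h2"
          using trans unfolding P_def by auto
        have i: "({0..1::real} \<times> {a..b}) \<inter> ({0..1} \<times> {b..c}) = {0..1} \<times> {b}" using trans(3,4) by auto
        have u: "({0..1::real} \<times> {a..b}) \<union> ({0..1} \<times> {b..c}) = {0..1} \<times> {a..c}" using trans(3,4) by auto
        show "P 0 1 a c"
          unfolding P_def
          using potential_glue[OF L _ _ _ _ h] unfolding i u
          by (auto simp: closed_Times connected_Times)
      qed
    next
      case (local x)
      then obtain e where "e > 0" "\<forall>c d. c \<le> x \<and> x \<le> d \<and> d - c < e \<longrightarrow> P 0 1 c d"
        using strip[of x] local cd by auto
      then show ?case by blast
    qed
  qed
  from this[of 0 1] show ?thesis by (simp add: P_def)
qed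

text \<open>This relation says that the form with the given local potentials has integral \<open>d\<close> along the
  path \<open>p\<close>.\<close>

definition increment :: "('a::topological_space set \<times> ('a \<Rightarrow> real)) set \<Rightarrow> (real \<Rightarrow> 'a) \<Rightarrow> real \<Rightarrow> bool" where
  "increment L p d \<longleftrightarrow> (\<exists>h. potential_along L {0..1} p h \<and> h 1 - h 0 = d)"

lemma increment_exists:
  assumes "compatible L" "path p"
  shows "\<exists>d. increment L p d"
proof -
  have "continuous_on ({0..1} \<times> {0..1}) (\<lambda>z. p (snd z))"
    using assms(2) unfolding path_def
    by (auto intro!: continuous_on_compose2[of "{0..1}" p] continuous_intros)
  from potential_square[OF assms(1) this]
  obtain h :: "real \<times> real \<Rightarrow> real"
    where h: "potential_along L ({0..1} \<times> {0..1}) (\<lambda>z. p (snd z)) h" by blast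
  have "potential_along L {0..1} p (\<lambda>t. h (0, t))"
    by (rule potential_along_compose[OF h]) (auto intro!: continuous_intros)
  then show ?thesis unfolding increment_def by blast
qed

lemma increment_unique:
  assumes "compatible L" "increment L p d" "increment L p e"
  shows "d = e"
proof -
  obtain h k where hk: "potential_along L {0..1} p h" "h 1 - h 0 = d"
    "potential_along L {0..1} p k" "k 1 - k 0 = e"
    using assms(2,3) unfolding increment_def by blast
  have "h 1 - k 1 = h 0 - k 0"
    by (rule potential_unique[OF assms(1) _ hk(1,3)]) auto
  then show ?thesis using hk by simp
qed

lemma increment_reparam:
  assumes "potential_along L {0..1} p h" "continuous_on {0..1} \<tau>" "\<tau> ` {0..1} \<subseteq> {0..1}"
    "\<And>t. t \<in> {0..1} \<Longrightarrow> q t = p (\<tau> t)"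
  shows "increment L q (h (\<tau> 1) - h (\<tau> 0))"
  unfolding increment_def
  by (intro exI[of _ "\<lambda>t. h (\<tau> t)"] conjI potential_along_compose[OF assms] refl)

lemma increment_reverse: "increment L p d \<Longrightarrow> increment L (reversepath p) (- d)"
proof -
  assume "increment L p d"
  then obtain h where h: "potential_along L {0..1} p h" "h 1 - h 0 = d"
    unfolding increment_def by blast
  have "increment L (reversepath p) (h (1 - 1) - h (1 - 0))"
    by (rule increment_reparam[OF h(1)]) (auto intro!: continuous_intros simp: reversepath_def)
  moreover have "h (1 - 1) - h (1 - 0) = - d" using h(2) by simp
  ultimately show ?thesis by metis
qed

lemma increment_join:
  assumes L: "compatible L" and pq: "path p" "path q" "pathfinish p = pathstart q"
    and d: "increment L p d" "increment L q e"
  shows "increment L (p +++ q) (d + e)"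
proof -
  obtain c where c: "increment L (p +++ q) c"
    using increment_exists[OF L path_join_imp[OF pq]] by blast
  then obtain h where h: "potential_along L {0..1} (p +++ q) h" "h 1 - h 0 = c"
    unfolding increment_def by blast
  have "increment L p (h (1 / 2) - h (0 / 2))"
    by (rule increment_reparam[OF h(1)]) (auto intro!: continuous_intros simp: joinpaths_def)
  moreover have "increment L q (h ((1 + 1) / 2) - h ((0 + 1) / 2))"
  proof (rule increment_reparam[OF h(1), of "\<lambda>t. (t + 1) / 2"])
    fix t :: real assume "t \<in> {0..1}"
    then show "q t = (p +++ q) ((t + 1) / 2)"
      using pq(3) by (cases "t = 0") (auto simp: joinpaths_def pathfinish_def pathstart_def add_divide_distrib)
  qed (auto intro!: continuous_intros)
  ultimately have "d = h (1 / 2) - h 0" "e = h 1 - h (1 / 2)"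
    using increment_unique[OF L d(1)] increment_unique[OF L d(2)] by force+
  then show ?thesis using c h(2) by simp
qed

lemma increment_local:
  assumes "compatible L" "path p" "(U, f) \<in> L" "path_image p \<subseteq> U"
  shows "increment L p (f (pathfinish p) - f (pathstart p))"
  unfolding increment_def
  by (rule exI[of _ "\<lambda>t. f (p t)"])
     (use potential_local[OF assms(1) _ assms(3), of "{0..1}" p] assms(2,4)
      in \<open>simp add: path_def path_image_def pathfinish_def pathstart_def\<close>)

text \<open>The homotopy runs through loops, so on its two vertical sides the same point of the space is
  met. A potential on the square therefore has the same increment along the two sides, and the
  increments along the horizontal lines do not vary with the height. On the last line, a
  constant loop, the increment equals its own negative.\<close>

lemma increment_null_homotopic:
  assumes L: "compatible L" and p: "homotopic_loops UNIV p (\<lambda>t. a)" "increment L p d"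
  shows "d = 0"
proof -
  obtain \<gamma> :: "real \<times> real \<Rightarrow> 'a" where \<gamma>: "continuous_on ({0..1} \<times> {0..1}) \<gamma>"
      "\<And>t. t \<in> {0..1} \<Longrightarrow> \<gamma> (0, t) = p t" "\<And>t. t \<in> {0..1} \<Longrightarrow> \<gamma> (1, t) = a"
      "\<And>s. s \<in> {0..1} \<Longrightarrow> \<gamma> (s, 1) = \<gamma> (s, 0)"
    using p(1) unfolding homotopic_loops by (fastforce simp: pathstart_def pathfinish_def)
  obtain h where h: "potential_along L ({0..1} \<times> {0..1}) \<gamma> h"
    using potential_square[OF L \<gamma>(1)] by blast
  have side: "potential_along L {0..1} (\<lambda>s. \<gamma> (s, 0)) (\<lambda>s. h (s, c))" if "c = 0 \<or> c = 1" for c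
    by (rule potential_along_compose[OF h]) (use that \<gamma>(4) in \<open>auto intro!: continuous_intros\<close>)
  have "h (0, 1) - h (0, 0) = h (1, 1) - h (1, 0)"
    by (rule potential_unique[OF L _ side side]) auto
  moreover have "increment L p (h (0, 1) - h (0, 0))"
    using increment_reparam[of L p "\<lambda>t. h (0, t)" "\<lambda>t. t" p]
      potential_along_compose[OF h, of "{0..1}" "\<lambda>t. (0, t)" p] \<gamma>(2)
    by (fastforce intro!: continuous_intros)
  moreover have "h (1, 1) - h (1, 0) = 0"
  proof -
    have "potential_along L {0..1} (\<lambda>t. a) (\<lambda>t. h (1, t))"
      by (rule potential_along_compose[OF h]) (auto intro!: continuous_intros simp: \<gamma>(3))
    then have 1: "increment L (\<lambda>t. a) (h (1, 1) - h (1, 0))"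
      unfolding increment_def by blast
    have "increment L (reversepath (\<lambda>t. a)) (- (h (1, 1) - h (1, 0)))"
      by (rule increment_reverse[OF 1])
    moreover have "reversepath (\<lambda>t. a) = (\<lambda>t. a)" by (simp add: reversepath_def)
    ultimately show ?thesis using increment_unique[OF L 1] by fastforce
  qed
  ultimately show ?thesis using increment_unique[OF L p(2)] by fastforce
qed

text \<open>The value of \<open>G\<close> at a point is the increment along a chosen path from a base point. Near \<open>x\<close>
  the chosen paths to \<open>x\<close> and to \<open>y\<close> are compared through a short path inside the domain of
  \<open>f\<close>: the three form a loop, whose increment is zero.\<close>

theorem simply_connected_glue:
  fixes L :: "('a::topological_space set \<times> ('a \<Rightarrow> real)) set"
  assumes L: "compatible L" and sc: "simply_connected (UNIV :: 'a set)"
    and lpc: "\<And>x U. open U \<Longrightarrow> (x::'a) \<in> U \<Longrightarrow> \<exists>W. open W \<and> x \<in> W \<and> W \<subseteq> U \<and> path_connected W"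
  shows "\<exists>G. \<forall>(U, f)\<in>L. \<forall>x\<in>U. \<forall>\<^sub>F y in nhds x. G y - f y = G x - f x"
proof -
  have "\<exists>p. path p \<and> pathstart p = x0 \<and> pathfinish p = x" for x0 x :: 'a
  proof -
    have "homotopic_loops UNIV (\<lambda>_. x0) (\<lambda>_. x)"
      using sc unfolding simply_connected_def
      by (simp add: path_def pathstart_def pathfinish_def)
    from homotopic_loops_imp_path_component_value[OF this, of 0]
    show ?thesis by (auto simp: path_component_def)
  qed
  then obtain p where p: "\<And>x. path (p x)" "\<And>x. pathstart (p x) = undefined" "\<And>x::'a. pathfinish (p x) = x"
    by metis
  obtain G where G: "\<And>x. increment L (p x) (G x)"
    using increment_exists[OF L p(1)] by metis
  have "\<forall>\<^sub>F y in nhds x. G y - f y = G x - f x" if U: "(U, f) \<in> L" "x \<in> U" for U f x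
  proof -
    have "open U" using L U(1) unfolding compatible_def by fast
    then obtain W where W: "open W" "x \<in> W" "W \<subseteq> U" "path_connected W" using lpc U(2) by blast
    have "G y - f y = G x - f x" if yW: "y \<in> W" for y
    proof -
      obtain q where q: "path q" "path_image q \<subseteq> W" "pathstart q = x" "pathfinish q = y"
        using W(4)[unfolded path_connected_def, rule_format, OF W(2) yW] by blast
      have 1: "increment L q (f y - f x)"
        using increment_local[OF L q(1) U(1)] q W(3) by auto
      have 2: "increment L (p x +++ q) (G x + (f y - f x))"
        by (rule increment_join[OF L p(1) q(1) _ G 1]) (simp add: p q)
      let ?l = "(p x +++ q) +++ reversepath (p y)"
      have 3: "increment L ?l (G x + (f y - f x) + - G y)"
        by (rule increment_join[OF L _ _ _ 2 increment_reverse[OF G]]) (simp_all add: p q)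
      have "homotopic_loops UNIV ?l (\<lambda>t. x)"
        by (rule sc[unfolded simply_connected_def, rule_format])
           (simp_all add: p q, simp_all add: path_def pathstart_def pathfinish_def)
      then show ?thesis using increment_null_homotopic[OF L _ 3] by fastforce
    qed
    then show ?thesis using W(1,2) unfolding eventually_nhds by blast
  qed
  then show ?thesis by blast
qed

section \<open>Smooth functions and tangent vectors on a surface\<close>

locale smooth_surface =
  fixes A :: "'m::topological_space chart set"
  assumes atlas: "smooth_atlas A"
begin

abbreviation "T \<equiv> tangent_space A"

lemma chart:
  assumes "(V, c) \<in> A"
  shows "open V" "open (c ` V)" "inj_on c V" "continuous_on V c" "continuous_on (c ` V) (inv_into V c)"
proof -
  from atlas assms have 1: "open V" "open (c ` V)" "\<exists>c'. homeomorphism V (c ` V) c c'"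
    unfolding smooth_atlas_def by blast+
  then obtain c' where c': "homeomorphism V (c ` V) c c'" by blast
  show "open V" "open (c ` V)" by fact+
  show inj: "inj_on c V" using c' by (metis homeomorphism_def inj_on_inverseI)
  show "continuous_on V c" using c' by (simp add: homeomorphism_def)
  have "continuous_on (c ` V) c'" using c' by (simp add: homeomorphism_def)
  moreover have "inv_into V c y = c' y" if "y \<in> c ` V" for y
    using c' that inj by (auto simp: homeomorphism_def)
  ultimately show "continuous_on (c ` V) (inv_into V c)"
    by (simp cong: continuous_on_cong)
qed

lemma chart_open_image:
  assumes "(V, c) \<in> A" "open U"
  shows "open (c ` (U \<inter> V))"
proof -
  have "c ` (U \<inter> V) = inv_into V c -` U \<inter> c ` V"
    using chart(3)[OF assms(1)] by (auto simp: inv_into_f_f intro!: image_eqI)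
  moreover have "open (inv_into V c -` U \<inter> c ` V)"
    using chart[OF assms(1)] assms(2) continuous_on_open_vimage by blast
  ultimately show ?thesis by simp
qed

lemma chart_open_vimage:
  assumes "(V, c) \<in> A" "open W"
  shows "open (c -` W \<inter> V)"
  using chart[OF assms(1)] assms(2) continuous_on_open_vimage by blast

lemma chart_cover: obtains V c where "(V, c) \<in> A" "p \<in> V"
proof -
  have "(\<Union>(U, c)\<in>A. U) = UNIV" using atlas unfolding smooth_atlas_def by argo
  then have "p \<in> (\<Union>(U, c)\<in>A. U)" by simp
  then show ?thesis using that by auto
qed

lemma smooth_on_open: "smooth_on A U f \<Longrightarrow> open U"
  by (simp add: smooth_on_def)

lemma smooth_on_Cinf: "smooth_on A U f \<Longrightarrow> (V, c) \<in> A \<Longrightarrow> Cinf_on (f \<circ> inv_into V c) (c ` (U \<inter> V))"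
  unfolding smooth_on_def by blast

lemma smooth_onI:
  assumes "open U" "\<And>V c k. (V, c) \<in> A \<Longrightarrow> Ck_on k (f \<circ> inv_into V c) (c ` (U \<inter> V))"
  shows "smooth_on A U f"
  unfolding smooth_on_def Cinf_on_def
proof (intro conjI ballI assms(1), clarify)
  fix V c assume "(V, c) \<in> A"
  then show "open (c ` (U \<inter> V)) \<and> (\<forall>k. Ck_on k (f \<circ> inv_into V c) (c ` (U \<inter> V)))"
    using assms chart_open_image by simp
qed

lemma smooth_on_Ck:
  "smooth_on A U f \<Longrightarrow> (V, c) \<in> A \<Longrightarrow> Ck_on k (f \<circ> inv_into V c) (c ` (U \<inter> V))"
  using smooth_on_Cinf[of U f V c] unfolding Cinf_on_def by simp

lemma smooth_on_const: "open U \<Longrightarrow> smooth_on A U (\<lambda>x. a)"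
  by (rule smooth_onI) (simp_all add: o_def Ck_on_const)

lemma smooth_on_add:
  assumes "smooth_on A U f" "smooth_on A U g" shows "smooth_on A U (\<lambda>x. f x + g x)"
proof (rule smooth_onI)
  fix V c k assume V: "(V, c) \<in> A"
  show "Ck_on k ((\<lambda>x. f x + g x) \<circ> inv_into V c) (c ` (U \<inter> V))"
    using Ck_on_add[OF chart_open_image[OF V] smooth_on_Ck[OF assms(1) V] smooth_on_Ck[OF assms(2) V]]
      smooth_on_open[OF assms(1)] by (simp add: o_def)
qed (rule smooth_on_open[OF assms(1)])

lemma smooth_on_mult:
  assumes "smooth_on A U f" "smooth_on A U g" shows "smooth_on A U (\<lambda>x. f x * g x)"
proof (rule smooth_onI)
  fix V c k assume V: "(V, c) \<in> A"
  show "Ck_on k ((\<lambda>x. f x * g x) \<circ> inv_into V c) (c ` (U \<inter> V))"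
    using Ck_on_mult[OF chart_open_image[OF V] smooth_on_Ck[OF assms(1) V] smooth_on_Ck[OF assms(2) V]]
      smooth_on_open[OF assms(1)] by (simp add: o_def)
qed (rule smooth_on_open[OF assms(1)])

lemma smooth_on_inverse:
  assumes "smooth_on A U f" "\<And>x. x \<in> U \<Longrightarrow> f x \<noteq> 0" shows "smooth_on A U (\<lambda>x. inverse (f x))"
proof (rule smooth_onI)
  fix V c k assume V: "(V, c) \<in> A"
  have "(f \<circ> inv_into V c) y \<noteq> 0" if "y \<in> c ` (U \<inter> V)" for y
    using that assms(2) chart(3)[OF V] by auto
  then show "Ck_on k ((\<lambda>x. inverse (f x)) \<circ> inv_into V c) (c ` (U \<inter> V))"
    using Ck_on_inverse[OF chart_open_image[OF V] smooth_on_Ck[OF assms(1) V]]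
      smooth_on_open[OF assms(1)] by (simp add: o_def)
qed (rule smooth_on_open[OF assms(1)])

lemma smooth_on_uminus: "smooth_on A U f \<Longrightarrow> smooth_on A U (\<lambda>x. - f x)"
  using smooth_on_mult[OF smooth_on_const[of U "- 1"], of f] smooth_on_open[of U f] by simp

lemma smooth_on_diff: "smooth_on A U f \<Longrightarrow> smooth_on A U g \<Longrightarrow> smooth_on A U (\<lambda>x. f x - g x)"
  using smooth_on_add[of U f "\<lambda>x. - g x"] smooth_on_uminus[of U g] by simp

lemma smooth_on_divide:
  "smooth_on A U f \<Longrightarrow> smooth_on A U g \<Longrightarrow> (\<And>x. x \<in> U \<Longrightarrow> g x \<noteq> 0) \<Longrightarrow> smooth_on A U (\<lambda>x. f x / g x)"
  using smooth_on_mult[of U f "\<lambda>x. inverse (g x)"] smooth_on_inverse[of U g] by (simp add: divide_inverse)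

lemma smooth_on_cong:
  assumes "smooth_on A U f" "\<And>x. x \<in> U \<Longrightarrow> f x = g x" shows "smooth_on A U g"
proof (rule smooth_onI)
  fix V c k assume V: "(V, c) \<in> A"
  show "Ck_on k (g \<circ> inv_into V c) (c ` (U \<inter> V))"
    by (rule Ck_on_cong[OF _ _ smooth_on_Ck[OF assms(1) V]])
       (use chart_open_image[OF V] smooth_on_open[OF assms(1)] chart(3)[OF V] assms(2) in auto)
qed (rule smooth_on_open[OF assms(1)])

lemma smooth_on_subset: "smooth_on A U f \<Longrightarrow> open V \<Longrightarrow> V \<subseteq> U \<Longrightarrow> smooth_on A V f"
  by (rule smooth_onI) (assumption, rule Ck_on_subset[OF smooth_on_Ck], auto)

lemma smooth_on_local:
  assumes "\<And>p. p \<in> U \<Longrightarrow> \<exists>W. p \<in> W \<and> smooth_on A W f" "open U"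
  shows "smooth_on A U f"
proof (rule smooth_onI)
  fix V c k assume V: "(V, c) \<in> A"
  show "Ck_on k (f \<circ> inv_into V c) (c ` (U \<inter> V))"
  proof (rule Ck_on_local)
    fix y assume "y \<in> c ` (U \<inter> V)"
    then obtain p where p: "p \<in> U" "p \<in> V" "y = c p" by blast
    obtain W where W: "p \<in> W" "smooth_on A W f" using assms(1)[OF p(1)] by blast
    show "\<exists>T. open T \<and> y \<in> T \<and> Ck_on k (f \<circ> inv_into V c) T"
      using chart_open_image[OF V smooth_on_open[OF W(2)]] smooth_on_Ck[OF W(2) V] p W(1) by blast
  qed
qed fact

lemma smooth_on_continuous:
  assumes "smooth_on A U f" shows "continuous_on U f"
proof -
  have "continuous_on (U \<inter> V) f" if V: "(V, c) \<in> A" for V c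
  proof -
    have "continuous_on (U \<inter> V) (\<lambda>x. (f \<circ> inv_into V c) (c x))"
      by (rule continuous_on_compose2[OF Cinf_on_continuous[OF smooth_on_Cinf[OF assms V]]])
         (use chart(4)[OF V] in \<open>auto intro: continuous_on_subset\<close>)
    then show ?thesis
      by (rule continuous_on_eq) (use chart(3)[OF V] in auto)
  qed
  then have "continuous_on (\<Union>Vc\<in>A. U \<inter> fst Vc) f"
    by (intro continuous_on_open_UN) (use chart(1) smooth_on_open[OF assms] in auto)
  moreover have "(\<Union>Vc\<in>A. U \<inter> fst Vc) = U"
  proof (intro equalityI subsetI)
    fix x assume "x \<in> U"
    obtain V c where "(V, c) \<in> A" "x \<in> V" by (rule chart_cover)
    then show "x \<in> (\<Union>Vc\<in>A. U \<inter> fst Vc)" using \<open>x \<in> U\<close> by force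
  qed auto
  ultimately show ?thesis by simp
qed

lemma smooth_on_coordinate:
  assumes "(V, d) \<in> A" shows "smooth_on A V (\<lambda>x. d x $ i)"
proof (rule smooth_onI)
  fix U c k assume U: "(U, c) \<in> A"
  have comp: "Ck_on k f S \<Longrightarrow> Ck_on k (\<lambda>y. f y $ i) S" if "open S" for k S and f :: "real^2 \<Rightarrow> real^2"
  proof (induction k arbitrary: f)
    case 0
    then show ?case by (auto intro: continuous_intros)
  next
    case (Suc k)
    have hd: "((\<lambda>y. f y $ i) has_derivative (\<lambda>v. frechet_derivative f (at x) v $ i)) (at x)" if "x \<in> S" for x
      by (rule bounded_linear.has_derivative[OF bounded_linear_vec_nth])
         (use Suc.prems that in \<open>simp add: frechet_derivative_works\<close>)
    have I: "Ck_on k (\<lambda>x. frechet_derivative f (at x) v $ i) S" for v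
      using Suc by simp
    have "Ck_on k (\<lambda>x. frechet_derivative (\<lambda>y. f y $ i) (at x) v) S" for v
      by (rule Ck_on_cong[OF that _ I[of v]]) (simp add: frechet_derivative_eqI[OF hd])
    then show ?case using hd by (auto simp: differentiable_def)
  qed
  have "Cinf_on (d \<circ> inv_into U c) (c ` (U \<inter> V))"
    using atlas U assms unfolding smooth_atlas_def by blast
  then have "Ck_on k (\<lambda>y. (d \<circ> inv_into U c) y $ i) (c ` (U \<inter> V))"
    using comp[of "c ` (U \<inter> V)" k "d \<circ> inv_into U c"] unfolding Cinf_on_def by blast
  then show "Ck_on k ((\<lambda>x. d x $ i) \<circ> inv_into U c) (c ` (V \<inter> U))"
    by (simp add: o_def Int_commute)
qed (rule chart(1)[OF assms])

lemma smooth_atI: "smooth_on A U f \<Longrightarrow> p \<in> U \<Longrightarrow> smooth_at A p f"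
  unfolding smooth_at_def by blast

lemma smooth_at_const: "smooth_at A p (\<lambda>x. a)"
  using smooth_atI[OF smooth_on_const[OF open_UNIV]] by blast

lemma smooth_at_indicator:
  assumes "open W" "p \<in> W" shows "smooth_at A p (\<lambda>x. if x \<in> W then 1 else 0)"
  by (rule smooth_atI[OF smooth_on_cong[OF smooth_on_const[OF assms(1), of 1]] assms(2)]) simp

lemma smooth_at_cong:
  assumes "open W" "p \<in> W" "\<And>x. x \<in> W \<Longrightarrow> f x = g x" "smooth_at A p f" shows "smooth_at A p g"
proof -
  obtain U where U: "p \<in> U" "smooth_on A U f" using assms(4) unfolding smooth_at_def by blast
  have "smooth_on A (U \<inter> W) f"
    by (rule smooth_on_subset[OF U(2)]) (use smooth_on_open[OF U(2)] assms(1) in auto)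
  then have "smooth_on A (U \<inter> W) g" by (rule smooth_on_cong) (use assms(3) in auto)
  then show ?thesis using smooth_atI U(1) assms(2) by blast
qed

context
  fixes p and v :: "'m tvec"
  assumes v: "v \<in> T p"
begin

lemma tv_lin: "smooth_at A p f \<Longrightarrow> smooth_at A p h \<Longrightarrow> v (\<lambda>x. a * f x + b * h x) = a * v f + b * v h"
  using v unfolding tangent_space_def by blast

lemma tv_mult: "smooth_at A p f \<Longrightarrow> smooth_at A p h \<Longrightarrow> v (\<lambda>x. f x * h x) = v f * h p + f p * v h"
  using v unfolding tangent_space_def by blast

lemma tv_nonsmooth: "\<not> smooth_at A p f \<Longrightarrow> v f = 0"
  using v unfolding tangent_space_def by blast

lemma tv_add: "smooth_at A p f \<Longrightarrow> smooth_at A p h \<Longrightarrow> v (\<lambda>x. f x + h x) = v f + v h"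
  using tv_lin[of f h 1 1] by simp

lemma tv_diff: "smooth_at A p f \<Longrightarrow> smooth_at A p h \<Longrightarrow> v (\<lambda>x. f x - h x) = v f - v h"
  using tv_lin[of f h 1 "- 1"] by simp

lemma tv_const: "v (\<lambda>x. a) = 0"
proof -
  have "v (\<lambda>x. 1 * 1) = v (\<lambda>x. 1) * 1 + 1 * v (\<lambda>x. 1)"
    by (rule tv_mult[OF smooth_at_const smooth_at_const])
  then have "v (\<lambda>x. 1) = 0" by simp
  then show ?thesis using tv_lin[OF smooth_at_const[of p 1] smooth_at_const[of p 1], of a 0] by simp
qed

lemma tv_uminus: "smooth_at A p f \<Longrightarrow> v (\<lambda>x. - f x) = - v f"
  using tv_diff[OF smooth_at_const[of p 0], of f] tv_const by simp

text \<open>The indicator function of \<open>W\<close> is smooth at \<open>p\<close> and plays the role of a bump function: its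
  product with \<open>f - g\<close> is zero everywhere. The case of functions that are not smooth at \<open>p\<close> is
  covered by the convention that tangent vectors vanish on them.\<close>

lemma tv_local:
  assumes "open W" "p \<in> W" "\<And>x. x \<in> W \<Longrightarrow> f x = g x"
  shows "v f = v g"
proof (cases "smooth_at A p f")
  case True
  have g: "smooth_at A p g" by (rule smooth_at_cong[OF assms True])
  let ?b = "\<lambda>x. if x \<in> W then 1 else (0::real)"
  have b: "smooth_at A p ?b" by (rule smooth_at_indicator[OF assms(1,2)])
  have d: "smooth_at A p (\<lambda>x. f x - g x)"
    by (rule smooth_at_cong[OF assms(1,2) _ smooth_at_const[of p 0]]) (simp add: assms(3))
  have "(\<lambda>x. (f x - g x) * ?b x) = (\<lambda>x. 0)" using assms(3) by auto
  then have "v (\<lambda>x. 0) = v (\<lambda>x. f x - g x) * 1 + (f p - g p) * v ?b"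
    using tv_mult[OF d b] assms(2) by simp
  then show ?thesis using tv_const tv_diff[OF True g] assms(2,3) by simp
next
  case False
  then have "\<not> smooth_at A p g" using smooth_at_cong[OF assms(1,2), of g f] assms(3) by auto
  then show ?thesis using False tv_nonsmooth by simp
qed

end

lemma lincomb_tangent:
  assumes "u \<in> T p" "v \<in> T p"
  shows "lincomb a u b v \<in> T p"
  unfolding tangent_space_def mem_Collect_eq lincomb_def
proof (intro conjI allI impI)
  fix f assume "\<not> smooth_at A p f"
  then show "a * u f + b * v f = 0" using tv_nonsmooth[OF assms(1)] tv_nonsmooth[OF assms(2)] by simp
next
  fix f h c d assume "smooth_at A p f \<and> smooth_at A p h"
  then show "a * u (\<lambda>x. c * f x + d * h x) + b * v (\<lambda>x. c * f x + d * h x) =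
       c * (a * u f + b * v f) + d * (a * u h + b * v h)"
    using tv_lin[OF assms(1)] tv_lin[OF assms(2)] by (simp add: algebra_simps)
next
  fix f h assume "smooth_at A p f \<and> smooth_at A p h"
  then show "a * u (\<lambda>x. f x * h x) + b * v (\<lambda>x. f x * h x) =
       (a * u f + b * v f) * h p + f p * (a * u h + b * v h)"
    using tv_mult[OF assms(1)] tv_mult[OF assms(2)] by (simp add: algebra_simps)
qed

definition coord_deriv :: "'m set \<Rightarrow> ('m \<Rightarrow> real^2) \<Rightarrow> 'm \<Rightarrow> real^2 \<Rightarrow> 'm tvec" where
  "coord_deriv V d p w =
     (\<lambda>f. if smooth_at A p f then frechet_derivative (f \<circ> inv_into V d) (at (d p)) w else 0)"

lemma smooth_at_chart_derivative:
  assumes "(V, d) \<in> A" "p \<in> V" "smooth_at A p f"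
  shows "((f \<circ> inv_into V d) has_derivative frechet_derivative (f \<circ> inv_into V d) (at (d p))) (at (d p))"
proof -
  obtain U where U: "p \<in> U" "smooth_on A U f" using assms(3) unfolding smooth_at_def by blast
  show ?thesis
    using Cinf_on_differentiable[OF smooth_on_Cinf[OF U(2) assms(1)], of "d p"] U(1) assms(2)
    by (auto simp: frechet_derivative_works)
qed

lemma smooth_at_add: "smooth_at A p f \<Longrightarrow> smooth_at A p g \<Longrightarrow> smooth_at A p (\<lambda>x. f x + g x)"
  and smooth_at_mult: "smooth_at A p f \<Longrightarrow> smooth_at A p g \<Longrightarrow> smooth_at A p (\<lambda>x. f x * g x)"
proof -
  assume "smooth_at A p f" "smooth_at A p g"
  then obtain U W where U: "p \<in> U" "smooth_on A U f" "p \<in> W" "smooth_on A W g"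
    unfolding smooth_at_def by blast
  then have 1: "smooth_on A (U \<inter> W) f" "smooth_on A (U \<inter> W) g"
    using smooth_on_subset[of _ _ "U \<inter> W"] open_Int[OF smooth_on_open smooth_on_open] by blast+
  show "smooth_at A p (\<lambda>x. f x + g x)" "smooth_at A p (\<lambda>x. f x * g x)"
    using smooth_on_add[OF 1] smooth_on_mult[OF 1] U smooth_atI by blast+
qed

lemma coord_deriv_tangent:
  assumes V: "(V, d) \<in> A" "p \<in> V" shows "coord_deriv V d p w \<in> T p"
  unfolding tangent_space_def mem_Collect_eq coord_deriv_def
proof (intro conjI allI impI)
  fix f h a b assume fh: "smooth_at A p f \<and> smooth_at A p h"
  let ?D = "\<lambda>f. frechet_derivative (f \<circ> inv_into V d) (at (d p))"
  have hd: "((f \<circ> inv_into V d) has_derivative ?D f) (at (d p))" "((h \<circ> inv_into V d) has_derivative ?D h) (at (d p))"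
    using smooth_at_chart_derivative[OF V] fh by blast+
  have inv: "inv_into V d (d p) = p" using chart(3)[OF V(1)] V(2) by simp
  have s: "smooth_at A p (\<lambda>x. a * f x + b * h x)" "smooth_at A p (\<lambda>x. f x * h x)"
    using fh smooth_at_add smooth_at_mult smooth_at_const by blast+
  have "(((\<lambda>x. a * f x + b * h x) \<circ> inv_into V d) has_derivative (\<lambda>v. a * ?D f v + b * ?D h v)) (at (d p))"
    unfolding o_def using hd unfolding o_def by (auto intro!: derivative_eq_intros)
  then show "(if smooth_at A p (\<lambda>x. a * f x + b * h x)
            then ?D (\<lambda>x. a * f x + b * h x) w else 0) =
           a * (if smooth_at A p f then ?D f w else 0) + b * (if smooth_at A p h then ?D h w else 0)"
    using s fh by (simp add: frechet_derivative_eqI)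
  have "(((\<lambda>x. f x * h x) \<circ> inv_into V d) has_derivative (\<lambda>v. f p * ?D h v + ?D f v * h p)) (at (d p))"
    using has_derivative_mult[OF hd] by (simp add: o_def inv)
  then show "(if smooth_at A p (\<lambda>x. f x * h x) then ?D (\<lambda>x. f x * h x) w else 0) =
           (if smooth_at A p f then ?D f w else 0) * h p + f p * (if smooth_at A p h then ?D h w else 0)"
    using s fh by (simp add: frechet_derivative_eqI)
qed auto

lemma coord_deriv_coordinate:
  assumes V: "(V, d) \<in> A" "p \<in> V" shows "coord_deriv V d p w (\<lambda>x. d x $ i) = w $ i"
proof -
  have "((\<lambda>y. y $ i) has_derivative (\<lambda>w. w $ i)) (at (d p))"
    by (rule bounded_linear.has_derivative[OF bounded_linear_vec_nth]) (rule has_derivative_ident)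
  then have "(((\<lambda>x. d x $ i) \<circ> inv_into V d) has_derivative (\<lambda>w. w $ i)) (at (d p))"
    by (rule has_derivative_transform_within_open[OF _ chart(2)[OF V(1)]])
       (use V(2) in \<open>auto simp: f_inv_into_f\<close>)
  then show ?thesis
    unfolding coord_deriv_def
    using smooth_atI[OF smooth_on_coordinate[OF V(1)] V(2)] by (simp add: frechet_derivative_eqI)
qed

text \<open>The two coordinate derivations are independent, as they are dual to the coordinate
  functions, and the tangent space is spanned by two vectors; hence they form a basis, and the
  chart expression of an arbitrary derivation follows by linear algebra.\<close>

lemma tangent_coordinates:
  assumes V: "(V, d) \<in> A" "p \<in> V"
    and b: "u \<in> T p" "v \<in> T p" "T p = {lincomb a u b v | a b. True}"
  shows "u (\<lambda>x. d x $ 1) * v (\<lambda>x. d x $ 2) - u (\<lambda>x. d x $ 2) * v (\<lambda>x. d x $ 1) \<noteq> 0" (is ?det)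
    and "t \<in> T p \<Longrightarrow> smooth_at A p f \<Longrightarrow>
      t f = t (\<lambda>x. d x $ 1) * frechet_derivative (f \<circ> inv_into V d) (at (d p)) (axis 1 1)
          + t (\<lambda>x. d x $ 2) * frechet_derivative (f \<circ> inv_into V d) (at (d p)) (axis 2 1)"
proof -
  let ?D = "\<lambda>i::2. coord_deriv V d p (axis i 1)"
  let ?c = "\<lambda>(i::2) x. d x $ i"
  obtain a1 b1 where 1: "?D 1 = lincomb a1 u b1 v" using coord_deriv_tangent[OF V] b(3) by blast
  obtain a2 b2 where 2: "?D 2 = lincomb a2 u b2 v" using coord_deriv_tangent[OF V] b(3) by blast
  have e: "a1 * u (?c 1) + b1 * v (?c 1) = 1" "a1 * u (?c 2) + b1 * v (?c 2) = 0"
    "a2 * u (?c 1) + b2 * v (?c 1) = 0" "a2 * u (?c 2) + b2 * v (?c 2) = 1"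
    using coord_deriv_coordinate[OF V, of "axis 1 1" 1] coord_deriv_coordinate[OF V, of "axis 1 1" 2]
      coord_deriv_coordinate[OF V, of "axis 2 1" 1] coord_deriv_coordinate[OF V, of "axis 2 1" 2]
    unfolding 1 2 lincomb_def by (simp_all add: axis_def)
  have "(a1 * b2 - a2 * b1) * (u (?c 1) * v (?c 2) - u (?c 2) * v (?c 1)) = 1"
    using e by algebra
  then show ?det by auto
  have e': "a1 * u (?c 1) + a2 * u (?c 2) = 1" "b1 * u (?c 1) + b2 * u (?c 2) = 0"
    "a1 * v (?c 1) + a2 * v (?c 2) = 0" "b1 * v (?c 1) + b2 * v (?c 2) = 1"
    using e by algebra+
  assume t: "t \<in> T p" and f: "smooth_at A p f"
  obtain x y where xy: "t = lincomb x u y v" using t b(3) by blast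
  have "t f = t (?c 1) * ?D 1 f + t (?c 2) * ?D 2 f"
    unfolding 1 2 xy lincomb_def using e' by algebra
  then show "t f = t (\<lambda>x. d x $ 1) * frechet_derivative (f \<circ> inv_into V d) (at (d p)) (axis 1 1)
          + t (\<lambda>x. d x $ 2) * frechet_derivative (f \<circ> inv_into V d) (at (d p)) (axis 2 1)"
    using f by (simp add: coord_deriv_def)
qed

lemma path_connected_basis:
  assumes "open U" "(x::'m) \<in> U"
  shows "\<exists>W. open W \<and> x \<in> W \<and> W \<subseteq> U \<and> path_connected W"
proof -
  obtain V c where V: "(V, c) \<in> A" "x \<in> V" by (rule chart_cover)
  obtain e where e: "e > 0" "ball (c x) e \<subseteq> c ` (U \<inter> V)"
    using chart_open_image[OF V(1) assms(1)] V(2) assms(2) by (meson IntI imageI openE)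
  let ?W = "inv_into V c ` ball (c x) e"
  have inv: "inv_into V c y \<in> U \<inter> V" "c (inv_into V c y) = y" if "y \<in> ball (c x) e" for y
    using subsetD[OF e(2) that] chart(3)[OF V(1)] by auto
  have inv': "inv_into V c (c z) = z" if "z \<in> V" for z using that chart(3)[OF V(1)] by simp
  have W: "?W = c -` ball (c x) e \<inter> V"
  proof (intro equalityI subsetI)
    fix z assume "z \<in> c -` ball (c x) e \<inter> V"
    then have "z = inv_into V c (c z)" "c z \<in> ball (c x) e" using inv' by auto
    then show "z \<in> ?W" by (rule image_eqI)
  next
    fix z assume "z \<in> ?W"
    then obtain y where y: "y \<in> ball (c x) e" "z = inv_into V c y" by (rule imageE)
    then show "z \<in> c -` ball (c x) e \<inter> V" using inv[OF y(1)] by simp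
  qed
  have "continuous_on (ball (c x) e) (inv_into V c)"
    by (rule continuous_on_subset[OF chart(5)[OF V(1)]]) (use e(2) in auto)
  then have "path_connected ?W"
    by (rule path_connected_continuous_image) (simp add: convex_imp_path_connected)
  moreover have "open ?W" unfolding W by (rule chart_open_vimage[OF V(1)]) simp
  moreover have "x \<in> ?W" unfolding W using V(2) e(1) by simp
  moreover have "?W \<subseteq> U" using inv(1) by blast
  ultimately show ?thesis by blast
qed

end

section \<open>Closed forms on a simply connected surface\<close>

text \<open>The Poincare lemma for the form \<open>v \<mapsto> a x \<bullet> v\<close> on a ball, with primitive \<open>\<integral> a(y + t(x - y)) \<bullet>
  (x - y) dt\<close> over \<open>[0,1]\<close>. Symmetry of \<open>D\<close> (closedness) turns the \<open>x\<close>-derivative of the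
  integrand into the \<open>t\<close>-derivative of \<open>t a(y + t(x - y))\<close>, which integrates to \<open>a x\<close>.\<close>

lemma radial_primitive:
  fixes a :: "'a::euclidean_space \<Rightarrow> 'a" and D :: "'a \<Rightarrow> 'a \<Rightarrow>\<^sub>L 'a"
  assumes D: "\<And>x. x \<in> ball y r \<Longrightarrow> (a has_derivative blinfun_apply (D x)) (at x)"
    and cont: "continuous_on (ball y r) D"
    and sym: "\<And>x v w. x \<in> ball y r \<Longrightarrow> D x v \<bullet> w = D x w \<bullet> v"
  shows "\<exists>P. \<forall>x\<in>ball y r. (P has_derivative (\<lambda>v. a x \<bullet> v)) (at x)"
proof -
  let ?c = "\<lambda>x (t::real). y + t *\<^sub>R (x - y)"
  \<comment> \<open>the derivative of the integrand, with the summand containing \<open>D\<close> rewritten by symmetry\<close>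
  define fx where "fx x t = blinfun_inner_left (a (?c x t)) + t *\<^sub>R blinfun_inner_left (D (?c x t) (x - y))" for x t
  have in_ball: "?c x t \<in> ball y r" if "x \<in> ball y r" "t \<in> cbox 0 1" for x t
  proof -
    have "t * norm (x - y) \<le> norm (x - y)" using that(2) by (simp add: mult_left_le_one_le)
    then show ?thesis using that by (simp add: dist_norm norm_minus_commute)
  qed
  have a_cont: "continuous_on (ball y r) a"
    using D by (meson continuous_at_imp_continuous_on has_derivative_continuous)
  have deriv: "((\<lambda>x. a (?c x t) \<bullet> (x - y)) has_derivative blinfun_apply (fx x t)) (at x within ball y r)"
    if x: "x \<in> ball y r" and t: "t \<in> cbox 0 1" for x t
  proof -
    have "((\<lambda>x. a (?c x t)) has_derivative (\<lambda>h. D (?c x t) (t *\<^sub>R h))) (at x)"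
      by (rule has_derivative_compose[where f = "\<lambda>x. ?c x t" and g = a, OF _ D[OF in_ball[OF x t]]])
         (auto intro!: derivative_eq_intros)
    then have "((\<lambda>x. a (?c x t) \<bullet> (x - y)) has_derivative
        (\<lambda>h. a (?c x t) \<bullet> h + D (?c x t) (t *\<^sub>R h) \<bullet> (x - y))) (at x)"
      by (auto intro!: derivative_eq_intros)
    moreover have "D (?c x t) (t *\<^sub>R h) \<bullet> (x - y) = t * (h \<bullet> D (?c x t) (x - y))" for h
      using sym[OF in_ball[OF x t], of h "x - y"] by (simp add: blinfun.scaleR_right inner_commute)
    ultimately have "((\<lambda>x. a (?c x t) \<bullet> (x - y)) has_derivative blinfun_apply (fx x t)) (at x)"
      by (simp add: fx_def plus_blinfun.rep_eq scaleR_blinfun.rep_eq inner_commute)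
    then show ?thesis by (rule has_derivative_at_withinI)
  qed
  have fx_cont: "continuous_on (ball y r \<times> cbox 0 1) (\<lambda>(x, t). fx x t)"
  proof -
    have 1: "continuous_on (ball y r \<times> cbox 0 1) (\<lambda>z. ?c (fst z) (snd z))"
      by (intro continuous_intros)
    have 2: "(\<lambda>z. ?c (fst z) (snd z)) ` (ball y r \<times> cbox 0 1) \<subseteq> ball y r"
      using in_ball by fastforce
    have "continuous_on (ball y r \<times> cbox 0 1) (\<lambda>z. fx (fst z) (snd z))"
      unfolding fx_def
      by (intro continuous_intros bounded_linear.continuous_on[OF bounded_linear_blinfun_inner_left]
          continuous_on_compose2[OF a_cont 1] continuous_on_compose2[OF cont 1] 2)
    then show ?thesis by (simp add: case_prod_unfold)
  qed
  have fx_int: "integral (cbox 0 1) (fx x) = blinfun_inner_left (a x)" if x: "x \<in> ball y r" for x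
  proof -
    have "((\<lambda>t. t *\<^sub>R blinfun_inner_left (a (?c x t))) has_vector_derivative fx x t) (at t within {0..1})"
      if "t \<in> {0..1}" for t
    proof -
      have t: "t \<in> cbox 0 1" using that by simp
      have "((\<lambda>t. a (?c x t)) has_derivative (\<lambda>h. D (?c x t) (h *\<^sub>R (x - y)))) (at t)"
        by (rule has_derivative_compose[where f = "\<lambda>t. ?c x t" and g = a, OF _ D[OF in_ball[OF x t]]])
           (auto intro!: derivative_eq_intros)
      then have "((\<lambda>t. blinfun_inner_left (a (?c x t))) has_derivative
          (\<lambda>h. blinfun_inner_left (D (?c x t) (h *\<^sub>R (x - y))))) (at t)"
        by (rule bounded_linear.has_derivative[OF bounded_linear_blinfun_inner_left])
      then have "((\<lambda>t. t *\<^sub>R blinfun_inner_left (a (?c x t))) has_derivative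
          (\<lambda>h. t *\<^sub>R blinfun_inner_left (D (?c x t) (h *\<^sub>R (x - y))) + h *\<^sub>R blinfun_inner_left (a (?c x t)))) (at t)"
        by (rule has_derivative_scaleR[OF has_derivative_ident])
      moreover have "t *\<^sub>R blinfun_inner_left (D (?c x t) (h *\<^sub>R (x - y))) + h *\<^sub>R blinfun_inner_left (a (?c x t)) = h *\<^sub>R fx x t" for h
        unfolding fx_def
        by (rule blinfun_eqI)
           (simp add: plus_blinfun.rep_eq scaleR_blinfun.rep_eq blinfun.scaleR_right distrib_left mult.left_commute)
      ultimately show ?thesis
        by (simp add: has_vector_derivative_def has_derivative_at_withinI)
    qed
    then have "(fx x has_integral 1 *\<^sub>R blinfun_inner_left (a (?c x 1)) - 0 *\<^sub>R blinfun_inner_left (a (?c x 0))) {0..1}"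
      by (intro fundamental_theorem_of_calculus) simp_all
    then show ?thesis by (simp add: integral_unique)
  qed
  have "((\<lambda>x. integral (cbox 0 1) (\<lambda>t. a (?c x t) \<bullet> (x - y))) has_derivative (\<lambda>v. a x \<bullet> v)) (at x)"
    if x: "x \<in> ball y r" for x
  proof -
    have "(\<lambda>t. a (?c x t) \<bullet> (x - y)) integrable_on cbox 0 1" if "x \<in> ball y r" for x
      by (intro integrable_continuous continuous_intros continuous_on_compose2[OF a_cont])
         (use in_ball that in auto)
    from leibniz_rule[OF deriv this fx_cont x convex_ball]
    have "((\<lambda>x. integral (cbox 0 1) (\<lambda>t. a (?c x t) \<bullet> (x - y))) has_derivative
       blinfun_apply (integral (cbox 0 1) (fx x))) (at x within ball y r)" by blast
    then show ?thesis
      using x unfolding fx_int[OF x] by (simp add: at_within_open[OF _ open_ball] inner_commute)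
  qed
  then show ?thesis by blast
qed

lemma plane_vector: "v = (v $ 1) *\<^sub>R axis 1 1 + (v $ 2) *\<^sub>R axis 2 (1::real)" for v :: "real^2"
  by (simp add: vec_eq_iff forall_2 axis_def)

lemma plane_derivative:
  fixes f :: "real^2 \<Rightarrow> real"
  assumes "(f has_derivative f') F"
  shows "f' v = f' (axis 1 1) * v $ 1 + f' (axis 2 1) * v $ 2"
proof -
  interpret bounded_linear f' using assms by (rule has_derivative_bounded_linear)
  have "f' v = f' ((v $ 1) *\<^sub>R axis 1 1 + (v $ 2) *\<^sub>R axis 2 1)"
    by (rule arg_cong[OF plane_vector])
  then show ?thesis by (simp only: add scaleR real_scaleR_def mult.commute)
qed

lemma plane_primitive:
  fixes h1 h2 :: "real^2 \<Rightarrow> real"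
  assumes h: "Cinf_on h1 S" "Cinf_on h2 S" "ball y r \<subseteq> S"
    and closed: "\<And>x. x \<in> ball y r \<Longrightarrow>
      frechet_derivative h2 (at x) (axis 1 1) = frechet_derivative h1 (at x) (axis 2 1)"
  shows "\<exists>P. \<forall>x\<in>ball y r. (P has_derivative (\<lambda>v. h1 x * v $ 1 + h2 x * v $ 2)) (at x)"
proof -
  let ?a = "\<lambda>x. h1 x *\<^sub>R axis 1 1 + h2 x *\<^sub>R axis 2 1 :: real^2"
  let ?d = "\<lambda>x v. frechet_derivative h1 (at x) v *\<^sub>R axis 1 1 + frechet_derivative h2 (at x) v *\<^sub>R axis 2 1 :: real^2"
  have hd: "(h1 has_derivative frechet_derivative h1 (at x)) (at x)"
    "(h2 has_derivative frechet_derivative h2 (at x)) (at x)" if "x \<in> ball y r" for x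
    using Cinf_on_differentiable[OF h(1)] Cinf_on_differentiable[OF h(2)] h(3) that
    by (auto simp: frechet_derivative_works)
  have ad: "(?a has_derivative ?d x) (at x)" if "x \<in> ball y r" for x
    using hd[OF that] by (auto intro!: derivative_eq_intros)
  define D where "D x = Blinfun (?d x)" for x
  have D: "blinfun_apply (D x) = ?d x" if "x \<in> ball y r" for x
    unfolding D_def using has_derivative_bounded_linear[OF ad[OF that]] by (rule bounded_linear_Blinfun_apply)
  have "\<exists>P. \<forall>x\<in>ball y r. (P has_derivative (\<lambda>v. ?a x \<bullet> v)) (at x)"
  proof (rule radial_primitive)
    show "(?a has_derivative blinfun_apply (D x)) (at x)" if "x \<in> ball y r" for x
      using ad[OF that] D[OF that] by simp
    show "continuous_on (ball y r) D"
    proof (rule continuous_on_blinfun_componentwise)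
      fix i :: "real^2"
      have "continuous_on (ball y r) (\<lambda>x. ?d x i)"
        using continuous_on_subset[OF Cinf_on_continuous[OF Cinf_on_deriv[OF h(1)]] h(3)]
          continuous_on_subset[OF Cinf_on_continuous[OF Cinf_on_deriv[OF h(2)]] h(3)]
        by (intro continuous_intros)
      then show "continuous_on (ball y r) (\<lambda>x. D x i)"
        by (rule continuous_on_eq) (simp add: D)
    qed
    show "D x v \<bullet> w = D x w \<bullet> v" if "x \<in> ball y r" for x v w
      unfolding D[OF that]
      by (subst (1 2) plane_derivative[OF hd(1)[OF that]], subst (1 2) plane_derivative[OF hd(2)[OF that]])
         (simp add: inner_vec_def sum_2 axis_def closed[OF that, unfolded axis_def] algebra_simps)
  qed
  then show ?thesis by (simp add: inner_vec_def sum_2 axis_def)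
qed

context smooth_surface
begin

text \<open>Closedness expressed in a frame \<open>u, v\<close> of vector fields whose bracket is \<open>\<alpha>u + \<beta>v\<close>: the last
  equation is \<open>d\<omega>(u, v) = 0\<close>.\<close>

definition closed_in_frame ::
  "('m \<Rightarrow> 'm tvec \<Rightarrow> real) \<Rightarrow> 'm set \<Rightarrow> ('m \<Rightarrow> 'm tvec) \<Rightarrow> ('m \<Rightarrow> 'm tvec) \<Rightarrow> ('m \<Rightarrow> real) \<Rightarrow> ('m \<Rightarrow> real) \<Rightarrow> bool" where
  "closed_in_frame \<omega> U u v \<alpha> \<beta> \<longleftrightarrow> smooth_vf A U u \<and> smooth_vf A U v \<and>
     smooth_on A U (\<lambda>q. \<omega> q (u q)) \<and> smooth_on A U (\<lambda>q. \<omega> q (v q)) \<and>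
     (\<forall>q\<in>U. T q = {lincomb a (u q) b (v q) | a b. True} \<and>
        lie_bracket A u v q = lincomb (\<alpha> q) (u q) (\<beta> q) (v q) \<and>
        u q (\<lambda>x. \<omega> x (v x)) - v q (\<lambda>x. \<omega> x (u x)) = \<alpha> q * \<omega> q (u q) + \<beta> q * \<omega> q (v q))"

definition closed_form :: "('m \<Rightarrow> 'm tvec \<Rightarrow> real) \<Rightarrow> bool" where
  "closed_form \<omega> \<longleftrightarrow>
     (\<forall>p a b. \<forall>u\<in>T p. \<forall>v\<in>T p.
        \<omega> p (lincomb a u b v) = a * \<omega> p u + b * \<omega> p v) \<and>
     (\<forall>p. \<exists>U u v \<alpha> \<beta>. p \<in> U \<and> closed_in_frame \<omega> U u v \<alpha> \<beta>)"

text \<open>With \<open>A\<^sub>i, B\<^sub>i\<close> the chart components of \<open>u, v\<close>, the components \<open>a\<^sub>1, a\<^sub>2\<close> of the form in the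
  chart are obtained by inverting the matrix of the \<open>A\<^sub>i, B\<^sub>i\<close>, whose determinant is
  \<open>\<Delta>\<close>; in particular they are smooth. The equation \<open>d\<omega>(u, v) = 0\<close> becomes \<open>\<Delta>
  (\<partial>\<^sub>1a\<^sub>2 - \<partial>\<^sub>2a\<^sub>1) = 0\<close>, and the Poincare lemma gives a primitive \<open>P\<close> in the chart. It is
  smooth in every other chart since its derivatives there are polynomial in smooth functions.\<close>

lemma closed_form_local_primitive:
  assumes "closed_form \<omega>"
  shows "\<exists>W f. p \<in> W \<and> smooth_on A W f \<and> (\<forall>q\<in>W. \<forall>t\<in>T q. t f = \<omega> q t)"
proof -
  have lin: "\<omega> p (lincomb a u b v) = a * \<omega> p u + b * \<omega> p v"
    if "u \<in> T p" "v \<in> T p" for p a b u v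
    using assms that unfolding closed_form_def by blast
  obtain U u v \<alpha> \<beta> where p: "p \<in> U" and c: "closed_in_frame \<omega> U u v \<alpha> \<beta>"
    using assms unfolding closed_form_def by blast
  note U = p c[unfolded closed_in_frame_def, THEN conjunct1]
    c[unfolded closed_in_frame_def, THEN conjunct2, THEN conjunct1]
    c[unfolded closed_in_frame_def, THEN conjunct2, THEN conjunct2, THEN conjunct1]
    c[unfolded closed_in_frame_def, THEN conjunct2, THEN conjunct2, THEN conjunct2, THEN conjunct1]
  note all = c[unfolded closed_in_frame_def, THEN conjunct2, THEN conjunct2, THEN conjunct2, THEN conjunct2]
  note span = all[rule_format, THEN conjunct1]
    and bracket = all[rule_format, THEN conjunct2, THEN conjunct1]
    and closed = all[rule_format, THEN conjunct2, THEN conjunct2]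
  obtain V d where V: "(V, d) \<in> A" "p \<in> V" by (rule chart_cover)
  define W where "W = U \<inter> V"
  have W: "open W" "p \<in> W" "W \<subseteq> U" "W \<subseteq> V"
    using smooth_on_open[OF U(4)] chart(1)[OF V(1)] U(1) V(2) by (auto simp: W_def)
  have T: "u q \<in> T q" "v q \<in> T q" if "q \<in> W" for q
    using U(2,3) W(3) that unfolding smooth_vf_def by blast+
  let ?d = "\<lambda>(i::2) x. d x $ i"
  have d: "smooth_on A W (?d i)" for i
    by (rule smooth_on_subset[OF smooth_on_coordinate[OF V(1)] W(1,4)])
  define w2 w3 A1 A2 B1 B2 \<Delta> where
    "w2 q = \<omega> q (u q)" and "w3 q = \<omega> q (v q)" and
    "A1 q = u q (?d 1)" and "A2 q = u q (?d 2)" and "B1 q = v q (?d 1)" and "B2 q = v q (?d 2)" and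
    "\<Delta> q = A1 q * B2 q - A2 q * B1 q" for q
  note defs = w2_def w3_def A1_def A2_def B1_def B2_def
  have sm: "smooth_on A W w2" "smooth_on A W w3" "smooth_on A W A1" "smooth_on A W A2"
    "smooth_on A W B1" "smooth_on A W B2"
    using smooth_on_subset[OF U(4) W(1,3)] smooth_on_subset[OF U(5) W(1,3)] U(2,3) W(3) d
    unfolding smooth_vf_def defs[abs_def] by blast+
  have \<Delta>: "\<Delta> q \<noteq> 0" if "q \<in> W" for q
    using tangent_coordinates(1)[OF V(1) _ T[OF that] span] W(3,4) that
    unfolding \<Delta>_def defs by (auto simp: mult.commute)
  define a1 a2 where "a1 q = (B2 q * w2 q - A2 q * w3 q) / \<Delta> q"
    and "a2 q = (A1 q * w3 q - B1 q * w2 q) / \<Delta> q" for q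
  have sa: "smooth_on A W a1" "smooth_on A W a2"
  proof -
    have "smooth_on A W \<Delta>" unfolding \<Delta>_def[abs_def] by (intro smooth_on_diff smooth_on_mult sm)
    note sm' = sm this
    show "smooth_on A W a1" unfolding a1_def[abs_def]
      by (intro smooth_on_divide smooth_on_diff smooth_on_mult sm' \<Delta>)
    show "smooth_on A W a2" unfolding a2_def[abs_def]
      by (intro smooth_on_divide smooth_on_diff smooth_on_mult sm' \<Delta>)
  qed
  have w: "w2 q = A1 q * a1 q + A2 q * a2 q" "w3 q = B1 q * a1 q + B2 q * a2 q" if "q \<in> W" for q
  proof -
    have m: "\<Delta> q * a1 q = B2 q * w2 q - A2 q * w3 q" "\<Delta> q * a2 q = A1 q * w3 q - B1 q * w2 q"
      unfolding a1_def a2_def using \<Delta>[OF that] by simp_all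
    have "\<Delta> q * (A1 q * a1 q + A2 q * a2 q) = A1 q * (\<Delta> q * a1 q) + A2 q * (\<Delta> q * a2 q)"
      by (simp add: algebra_simps)
    also have "\<dots> = \<Delta> q * w2 q" unfolding m by (simp add: \<Delta>_def algebra_simps)
    finally show "w2 q = A1 q * a1 q + A2 q * a2 q" using \<Delta>[OF that] by simp
    have "\<Delta> q * (B1 q * a1 q + B2 q * a2 q) = B1 q * (\<Delta> q * a1 q) + B2 q * (\<Delta> q * a2 q)"
      by (simp add: algebra_simps)
    also have "\<dots> = \<Delta> q * w3 q" unfolding m by (simp add: \<Delta>_def algebra_simps)
    finally show "w3 q = B1 q * a1 q + B2 q * a2 q" using \<Delta>[OF that] by simp
  qed
  have at: "smooth_at A q f" if "smooth_on A W f" "q \<in> W" for f q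
    using smooth_atI that by blast
  let ?D = "\<lambda>f q j. frechet_derivative (f \<circ> inv_into V d) (at (d q)) (axis j 1)"
  have tc: "t f = t (?d 1) * ?D f q 1 + t (?d 2) * ?D f q 2"
    if "q \<in> W" "t \<in> T q" "smooth_at A q f" for q t f
    using tangent_coordinates(2)[OF V(1) _ T[OF that(1)] span that(2,3)] W(3,4) that(1) by blast
  \<comment> \<open>the terms without derivatives of \<open>a\<^sub>1, a\<^sub>2\<close> cancel against the bracket\<close>
  have curl: "?D a2 q 1 = ?D a1 q 2" if q: "q \<in> W" for q
  proof -
    note s = at[OF _ q]
    have prod: "t (\<lambda>x. f x * g x + h x * k x) = t f * g q + f q * t g + (t h * k q + h q * t k)"
      if "t \<in> T q" "smooth_on A W f" "smooth_on A W g" "smooth_on A W h" "smooth_on A W k" for t f g h k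
      using tv_add[OF that(1) smooth_at_mult[OF s[OF that(2)] s[OF that(3)]] smooth_at_mult[OF s[OF that(4)] s[OF that(5)]]]
        tv_mult[OF that(1) s[OF that(2)] s[OF that(3)]] tv_mult[OF that(1) s[OF that(4)] s[OF that(5)]] by simp
    have 1: "u q w3 = u q B1 * a1 q + B1 q * u q a1 + (u q B2 * a2 q + B2 q * u q a2)"
      using tv_local[OF T(1)[OF q] W(1) q w(2)] prod[OF T(1)[OF q] sm(5) sa(1) sm(6) sa(2)] by simp
    have 2: "v q w2 = v q A1 * a1 q + A1 q * v q a1 + (v q A2 * a2 q + A2 q * v q a2)"
      using tv_local[OF T(2)[OF q] W(1) q w(1)] prod[OF T(2)[OF q] sm(3) sa(1) sm(4) sa(2)] by simp
    have br: "u q (\<lambda>x. v x (?d i)) - v q (\<lambda>x. u x (?d i)) = \<alpha> q * u q (?d i) + \<beta> q * v q (?d i)" for i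
      using fun_cong[OF bracket, of q "?d i"] q W(3) s[OF d[of i]] by (auto simp: lie_bracket_def lincomb_def)
    have 3: "u q B1 - v q A1 = \<alpha> q * A1 q + \<beta> q * B1 q" "u q B2 - v q A2 = \<alpha> q * A2 q + \<beta> q * B2 q"
      using br[of 1] br[of 2] unfolding defs[abs_def] by simp_all
    have 4: "u q w3 - v q w2 = \<alpha> q * w2 q + \<beta> q * w3 q"
      using closed[of q] q W(3) unfolding w2_def[abs_def] w3_def[abs_def] by blast
    have 5: "u q a1 = A1 q * ?D a1 q 1 + A2 q * ?D a1 q 2" "u q a2 = A1 q * ?D a2 q 1 + A2 q * ?D a2 q 2"
      "v q a1 = B1 q * ?D a1 q 1 + B2 q * ?D a1 q 2" "v q a2 = B1 q * ?D a2 q 1 + B2 q * ?D a2 q 2"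
      using tc[OF q T(1)[OF q]] tc[OF q T(2)[OF q]] s[OF sa(1)] s[OF sa(2)] unfolding defs by blast+
    have e: "u q B1 * a1 q - v q A1 * a1 q = (\<alpha> q * A1 q + \<beta> q * B1 q) * a1 q"
      "u q B2 * a2 q - v q A2 * a2 q = (\<alpha> q * A2 q + \<beta> q * B2 q) * a2 q"
      by (simp_all flip: 3 left_diff_distrib)
    have "B1 q * u q a1 + B2 q * u q a2 - A1 q * v q a1 - A2 q * v q a2 =
       (u q w3 - v q w2) - (u q B1 * a1 q - v q A1 * a1 q) - (u q B2 * a2 q - v q A2 * a2 q)"
      using 1 2 by simp
    also have "\<dots> = 0"
      unfolding 4 e w[OF q] by (simp add: algebra_simps)
    finally have "\<Delta> q * (?D a2 q 1 - ?D a1 q 2) = 0"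
      unfolding 5 \<Delta>_def by (simp add: algebra_simps)
    then show ?thesis using \<Delta>[OF q] by simp
  qed
  have inv: "inv_into V d (d q) = q" if "q \<in> V" for q using that chart(3)[OF V(1)] by simp
  obtain r where r: "r > 0" "ball (d p) r \<subseteq> d ` W"
    using chart_open_image[OF V(1) W(1)] W(2) V(2) W(4) by (metis Int_absorb2 imageI openE)
  have WV: "W \<inter> V = W" using W(4) by blast
  have "\<exists>P. \<forall>x\<in>ball (d p) r. (P has_derivative
     (\<lambda>w. (a1 \<circ> inv_into V d) x * w $ 1 + (a2 \<circ> inv_into V d) x * w $ 2)) (at x)"
  proof (rule plane_primitive[OF smooth_on_Cinf[OF sa(1) V(1)] smooth_on_Cinf[OF sa(2) V(1)]])
    show "ball (d p) r \<subseteq> d ` (W \<inter> V)" using r(2) WV by simp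
    fix x assume "x \<in> ball (d p) r"
    then obtain q where "q \<in> W" "x = d q" using r(2) by blast
    then show "frechet_derivative (a2 \<circ> inv_into V d) (at x) (axis 1 1) =
        frechet_derivative (a1 \<circ> inv_into V d) (at x) (axis 2 1)" using curl by simp
  qed
  then obtain P where P: "\<And>x. x \<in> ball (d p) r \<Longrightarrow> (P has_derivative
     (\<lambda>w. (a1 \<circ> inv_into V d) x * w $ 1 + (a2 \<circ> inv_into V d) x * w $ 2)) (at x)" by blast
  define W' where "W' = W \<inter> (d -` ball (d p) r \<inter> V)"
  have W': "open W'" "W' \<subseteq> W" "p \<in> W'"
    using W chart_open_vimage[OF V(1) open_ball] r(1) by (auto simp: W'_def)
  have Pq: "(P has_derivative (\<lambda>w. a1 q * w $ 1 + a2 q * w $ 2)) (at (d q))" if "q \<in> W'" for q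
    using P[of "d q"] that inv[of q] by (auto simp: W'_def)
  have smooth: "smooth_on A W' (\<lambda>x. P (d x))"
  proof (rule smooth_onI[OF W'(1)])
    fix V' c k assume c: "(V', c) \<in> A"
    let ?S = "c ` (W' \<inter> V')" and ?i = "inv_into V' c"
    have S: "open ?S" by (rule chart_open_image[OF c W'(1)])
    have ci: "?i y \<in> W'" if "y \<in> ?S" for y using that chart(3)[OF c] by auto
    have Sd: "?S \<subseteq> c ` (V' \<inter> V)" using W'(2) W(4) by blast
    have tr: "((d \<circ> ?i) has_derivative frechet_derivative (d \<circ> ?i) (at y)) (at y)" if "y \<in> ?S" for y
    proof -
      have "Cinf_on (d \<circ> ?i) (c ` (V' \<inter> V))" using atlas c V(1) unfolding smooth_atlas_def by blast
      then show ?thesis using Cinf_on_differentiable Sd that frechet_derivative_works by blast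
    qed
    have tri: "frechet_derivative (d \<circ> ?i) (at y) w $ j = frechet_derivative (?d j \<circ> ?i) (at y) w" if "y \<in> ?S" for y w j
      using frechet_derivative_eqI[OF bounded_linear.has_derivative[OF bounded_linear_vec_nth tr[OF that]], of j]
      by (simp add: o_def)
    have hd: "(((\<lambda>x. P (d x)) \<circ> ?i) has_derivative
       (\<lambda>w. a1 (?i y) * frechet_derivative (?d 1 \<circ> ?i) (at y) w + a2 (?i y) * frechet_derivative (?d 2 \<circ> ?i) (at y) w)) (at y)"
      if "y \<in> ?S" for y
    proof -
      have "(P has_derivative (\<lambda>w. a1 (?i y) * w $ 1 + a2 (?i y) * w $ 2)) (at ((d \<circ> ?i) y))"
        using Pq[OF ci[OF that]] by simp
      from diff_chain_at[OF tr[OF that] this] show ?thesis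
        using tri[OF that] by (simp add: o_def)
    qed
    have "Ck_on k (\<lambda>y. a1 (?i y) * frechet_derivative (?d 1 \<circ> ?i) (at y) w + a2 (?i y) * frechet_derivative (?d 2 \<circ> ?i) (at y) w) ?S" for w
      using smooth_on_Ck[OF smooth_on_subset[OF sa(1) W'(1,2)] c] smooth_on_Ck[OF smooth_on_subset[OF sa(2) W'(1,2)] c]
        smooth_on_Ck[OF smooth_on_subset[OF d W'(1,2)] c, of "Suc k"]
      by (intro Ck_on_add Ck_on_mult S) (simp_all add: o_def)
    then have "Ck_on k (\<lambda>y. frechet_derivative ((\<lambda>x. P (d x)) \<circ> ?i) (at y) w) ?S" for w
      by (rule Ck_on_cong[OF S, rotated]) (simp add: frechet_derivative_eqI[OF hd])
    then have "Ck_on (Suc k) ((\<lambda>x. P (d x)) \<circ> ?i) ?S"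
      using hd by (auto simp: differentiable_def)
    \<comment> \<open>order \<open>k\<close> of the derivative gives order \<open>k + 1\<close>, which in particular covers order 0\<close>
    then show "Ck_on k ((\<lambda>x. P (d x)) \<circ> ?i) ?S" by (rule Ck_on_SucD)
  qed
  have "t (\<lambda>x. P (d x)) = \<omega> q t" if q: "q \<in> W'" and t: "t \<in> T q" for q t
  proof -
    have qW: "q \<in> W" "q \<in> V" "q \<in> U" using q W' W by auto
    have "(((\<lambda>x. P (d x)) \<circ> inv_into V d) has_derivative (\<lambda>w. a1 q * w $ 1 + a2 q * w $ 2)) (at (d q))"
      by (rule has_derivative_transform_within_open[OF Pq[OF q] chart(2)[OF V(1)]])
         (use qW(2) in \<open>auto simp: f_inv_into_f\<close>)
    then have "t (\<lambda>x. P (d x)) = t (?d 1) * a1 q + t (?d 2) * a2 q"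
      using tc[OF qW(1) t smooth_atI[OF smooth q]] by (simp add: frechet_derivative_eqI axis_def)
    moreover obtain x y where xy: "t = lincomb x (u q) y (v q)" using t span[OF qW(3)] by blast
    have "\<omega> q t = x * w2 q + y * w3 q"
      unfolding xy w2_def w3_def by (rule lin[OF T[OF qW(1)]])
    moreover have "t (?d 1) = x * A1 q + y * B1 q" "t (?d 2) = x * A2 q + y * B2 q"
      unfolding xy lincomb_def defs by simp_all
    ultimately show ?thesis by (simp add: w[OF qW(1)] algebra_simps)
  qed
  then show ?thesis using W'(3) smooth by blast
qed

lemma equal_derivatives_locally_constant:
  assumes f: "smooth_on A U f" "smooth_on A V g" "x \<in> U" "x \<in> V"
    and eq: "\<And>q t. q \<in> U \<inter> V \<Longrightarrow> t \<in> T q \<Longrightarrow> t f = t g"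
  shows "\<forall>\<^sub>F y in nhds x. f y - g y = f x - g x"
proof -
  obtain C c where C: "(C, c) \<in> A" "x \<in> C" by (rule chart_cover)
  have o: "open (U \<inter> V)" using f(1,2) smooth_on_open by blast
  let ?h = "\<lambda>x. f x - g x"
  have h: "smooth_on A (U \<inter> V) ?h"
    using smooth_on_diff smooth_on_subset[OF f(1) o] smooth_on_subset[OF f(2) o] by blast
  obtain r where r: "r > 0" "ball (c x) r \<subseteq> c ` (U \<inter> V \<inter> C)"
    using chart_open_image[OF C(1) o] f(3,4) C(2) by (meson IntI imageI openE)
  have "(?h \<circ> inv_into C c) y = (?h \<circ> inv_into C c) (c x)" if y: "y \<in> ball (c x) r" for y
  proof (rule has_derivative_zero_unique[OF convex_ball _ y])
    fix z assume "z \<in> ball (c x) r"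
    then obtain q where q: "q \<in> U \<inter> V" "q \<in> C" "z = c q" using r(2) by blast
    have s: "smooth_at A q f" "smooth_at A q g" "smooth_at A q ?h"
      using f(1,2) h q smooth_atI by blast+
    have "frechet_derivative (?h \<circ> inv_into C c) (at z) w = 0" for w
    proof -
      have t: "coord_deriv C c q w \<in> T q" by (rule coord_deriv_tangent[OF C(1) q(2)])
      have "coord_deriv C c q w ?h = 0"
        using tv_diff[OF t s(1,2)] eq[OF q(1) t] by simp
      then show ?thesis using s(3) q(3) by (simp add: coord_deriv_def)
    qed
    then have "frechet_derivative (?h \<circ> inv_into C c) (at z) = (\<lambda>w. 0)" by (rule ext)
    then have "((?h \<circ> inv_into C c) has_derivative (\<lambda>w. 0)) (at z)"
      using smooth_at_chart_derivative[OF C(1) q(2) s(3)] q(3) by simp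
    then show "((?h \<circ> inv_into C c) has_derivative (\<lambda>w. 0)) (at z within ball (c x) r)"
      by (rule has_derivative_at_withinI)
  qed (use r(1) in simp)
  then have const: "?h z = ?h x" if "z \<in> c -` ball (c x) r \<inter> C" for z
    using that C(2) chart(3)[OF C(1)] by fastforce
  show ?thesis
    unfolding eventually_nhds
  proof (intro exI conjI ballI)
    show "open (c -` ball (c x) r \<inter> C)" by (rule chart_open_vimage[OF C(1) open_ball])
    show "x \<in> c -` ball (c x) r \<inter> C" using C(2) r(1) by simp
  qed (rule const)
qed

text \<open>Two primitives of the same form differ by a locally constant function, so all local
  primitives together form compatible gluing data.\<close>

theorem closed_form_exact:
  assumes sc: "simply_connected (UNIV :: 'm set)" and \<omega>: "closed_form \<omega>"
  shows "\<exists>G. smooth_on A UNIV G \<and> (\<forall>p. \<forall>t\<in>T p. t G = \<omega> p t)"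
proof -
  define L where "L = {(W, f). smooth_on A W f \<and> (\<forall>q\<in>W. \<forall>t\<in>T q. t f = \<omega> q t)}"
  have L: "compatible L"
    unfolding compatible_def
  proof (intro conjI ballI, goal_cases)
    case (1 x)
    then show ?case by (auto simp: L_def smooth_on_open)
  next
    case 2
    have "p \<in> (\<Union>(U, f)\<in>L. U)" for p
      using closed_form_local_primitive[OF \<omega>, of p] by (auto simp: L_def)
    then show ?case by blast
  next
    case (3 x)
    then show ?case by (auto simp: L_def intro!: equal_derivatives_locally_constant)
  qed
  obtain G where G: "\<And>U f x. (U, f) \<in> L \<Longrightarrow> x \<in> U \<Longrightarrow> \<forall>\<^sub>F y in nhds x. G y - f y = G x - f x"
    using simply_connected_glue[OF L sc path_connected_basis] by fast
  have loc: "\<exists>W. p \<in> W \<and> smooth_on A W G \<and> (\<forall>t\<in>T p. t G = \<omega> p t)" for p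
  proof -
    obtain U f where U: "p \<in> U" "smooth_on A U f" "\<And>q t. q \<in> U \<Longrightarrow> t \<in> T q \<Longrightarrow> t f = \<omega> q t"
      using closed_form_local_primitive[OF \<omega>, of p] by blast
    then have "(U, f) \<in> L" by (simp add: L_def)
    from G[OF this U(1)] obtain W where W: "open W" "p \<in> W" "\<And>y. y \<in> W \<Longrightarrow> G y - f y = G p - f p"
      unfolding eventually_nhds by blast
    have GW: "(G p - f p) + f y = G y" if "y \<in> W" for y using W(3)[OF that] by simp
    have "smooth_on A (U \<inter> W) (\<lambda>y. (G p - f p) + f y)"
      using smooth_on_subset[OF U(2), of "U \<inter> W"] W(1) smooth_on_open[OF U(2)]
      by (intro smooth_on_add smooth_on_const) auto
    then have "smooth_on A (U \<inter> W) G" by (rule smooth_on_cong) (simp add: GW)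
    moreover have "t G = \<omega> p t" if t: "t \<in> T p" for t
      using tv_local[OF t W(1,2), of "\<lambda>y. (G p - f p) + f y" G] GW
        tv_add[OF t smooth_at_const smooth_atI[OF U(2,1)]] tv_const[OF t] U(3)[OF U(1) t] by simp
    ultimately show ?thesis using U(1) W(2) by blast
  qed
  then show ?thesis using smooth_on_local[of UNIV G] by blast
qed

end

section \<open>Quaternions over the complexified Lorentz numbers\<close>

lemma qscal_central: "x * qscal a = qscal a * x"
  by (simp add: times_hquat_def qscal_def mult.commute)

lemma qscal_1: "qscal 1 = 1"
  by (simp add: qscal_def one_hquat_def)

lemma qconj_mult: "qconj (x * y) = qconj y * qconj x"
  by (simp add: times_hquat_def qconj_def algebra_simps)
lemma qconj_add: "qconj (x + y) = qconj x + qconj y"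
  by (simp add: plus_hquat_def qconj_def)
lemma qconj_diff: "qconj (x - y) = qconj x - qconj y"
  by (simp add: minus_hquat_def qconj_def)
lemma qconj_uminus: "qconj (- x) = - qconj x"
  by (simp add: uminus_hquat_def qconj_def)
lemma qconj_qconj: "qconj (qconj x) = x" by (simp add: qconj_def)

lemma lhat_hom: "lhat (a * b) = lhat a * lhat b" "lhat (a + b) = lhat a + lhat b"
  "lhat (a - b) = lhat a - lhat b" "lhat (- a) = - lhat a" "lhat (lhat a) = a"
  by (simp_all add: lhat_def times_lorc_def plus_lorc_def minus_lorc_def uminus_lorc_def)
lemma qhat_mult: "qhat (x * y) = qhat x * qhat y"
  by (simp add: times_hquat_def qhat_def lhat_hom)
lemma qhat_add: "qhat (x + y) = qhat x + qhat y"
  by (simp add: plus_hquat_def qhat_def lhat_hom)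
lemma qhat_diff: "qhat (x - y) = qhat x - qhat y"
  by (simp add: minus_hquat_def qhat_def lhat_hom)
lemma qhat_uminus: "qhat (- x) = - qhat x"
  by (simp add: uminus_hquat_def qhat_def lhat_hom)
lemma qhat_qhat: "qhat (qhat x) = x" by (simp add: qhat_def lhat_hom)
lemma qhat_qscal: "qhat (qscal a) = qscal (lhat a)"
  by (simp add: qhat_def qscal_def lhat_def zero_lorc_def)
lemma qhat_qconj: "qhat (qconj x) = qconj (qhat x)" by (simp add: qhat_def qconj_def lhat_hom)

lemmas q_hom = qconj_mult qconj_add qconj_diff qconj_uminus qconj_qconj qhat_mult qhat_add qhat_diff qhat_uminus
  qhat_qhat qhat_qconj

lemma mult_qconj: "x * qconj x = qscal (qH x x)" "qconj x * x = qscal (qH x x)"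
  by (simp_all add: times_hquat_def qconj_def qscal_def qH_def zero_lorc_def[symmetric] mult.commute)

lemma qH_mult_left: "qH (a * x) (a * y) = qH a a * qH x y"
  by (simp add: times_hquat_def qH_def algebra_simps)
lemma qH_mult_right: "qH (x * a) (y * a) = qH x y * qH a a"
  by (simp add: times_hquat_def qH_def algebra_simps)
lemma qH_qconj: "qH (qconj x) (qconj y) = qH x y" by (simp add: qH_def qconj_def)
lemma qH_qhat: "qH (qhat x) (qhat y) = lhat (qH x y)" by (simp add: qH_def qhat_def lhat_hom)
lemma qH_uminus: "qH (- x) (- y) = qH x y" by (simp add: qH_def uminus_hquat_def)

lemma q_eqI: "q0 x = q0 y \<Longrightarrow> q1 x = q1 y \<Longrightarrow> q2 x = q2 y \<Longrightarrow> q3 x = q3 y \<Longrightarrow> x = y"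
  by (rule hquat.expand) simp

lemma qreal_hom: "qreal (a + b) = qreal a + qreal b" "qreal (a * b) = qreal a * qreal b"
  "qreal (- a) = - qreal a" "qreal (a - b) = qreal a - qreal b" "qreal 0 = 0" "qreal 1 = 1"
  by (simp_all add: hquat_defs)

lemma q_central: "x * qi = qi * x" "x * q\<sigma> = q\<sigma> * x" "x * qreal a = qreal a * x"
  by (simp_all add: qi_def q\<sigma>_def qreal_def qscal_central)

lemma q_units:
  "qi * qi = - 1" "q\<sigma> * q\<sigma> = 1" "qI * qI = - 1" "qJ * qJ = - 1" "qK * qK = - 1"
  "qI * qJ = qK" "qJ * qI = - qK" "qJ * qK = qI" "qK * qJ = - qI" "qK * qI = qJ" "qI * qK = - qJ"
  by (simp_all add: hquat_defs)

lemma q_units_conj: "qconj qi = qi" "qconj q\<sigma> = q\<sigma>" "qconj qI = - qI" "qconj qJ = - qJ" "qconj qK = - qK"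
  "qconj (qreal a) = qreal a" "qconj 1 = 1"
  by (simp_all add: hquat_defs)

lemma q_units_hat: "qhat qi = qi" "qhat q\<sigma> = - q\<sigma>" "qhat qI = qI" "qhat qJ = qJ" "qhat qK = qK"
  "qhat (qreal a) = qreal a" "qhat 1 = 1"
  by (simp_all add: hquat_defs)

text \<open>The coordinates of a vector of \<open>E \<oplus> TM\<close>, and at the same time the elements of the space
  \<open>R22\<close>. The elements \<open>iJ = vecq 0 0 1 0\<close> and \<open>K = vecq 0 0 0 1\<close> stand for the tangent frame
  vectors \<open>e\<^sub>2, e\<^sub>3\<close>, while \<open>vecq c d 0 0\<close> and \<open>vecq d c 0 0\<close> with \<open>c\<^sup>2 - d\<^sup>2 = 1\<close> stand for
  \<open>e\<^sub>0\<close> and \<open>e\<^sub>1\<close> in a frame that is boosted against \<open>(e\<^sub>0, e\<^sub>1)\<close>.\<close>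

definition vecq :: "real \<Rightarrow> real \<Rightarrow> real \<Rightarrow> real \<Rightarrow> hquat" where
  "vecq x0 x1 x2 x3 = q\<sigma> * qi * qreal x0 + qreal x1 * qI + qi * qreal x2 * qJ + qreal x3 * qK"

lemma vecq_star: "qhat (qconj (vecq a b c d)) = - vecq a b c d"
  unfolding vecq_def by (simp add: hquat_defs)

lemma qH_vecq: "qH (vecq a b c d) (vecq a' b' c' d') = lreal (- a * a' + b * b' - c * c' + d * d')"
  unfolding vecq_def by (simp add: hquat_defs algebra_simps complex_eq_iff)

lemma vecq_lin: "vecq a b c d + vecq a' b' c' d' = vecq (a + a') (b + b') (c + c') (d + d')"
  "qreal r * vecq a b c d = vecq (r * a) (r * b) (r * c) (r * d)"
  unfolding vecq_def by (simp_all add: hquat_defs algebra_simps)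

definition lcnj :: "lorc \<Rightarrow> lorc" where "lcnj a = Lor (cnj (sc a)) (cnj (sg a))"

lemma lcnj_hom: "lcnj (a * b) = lcnj a * lcnj b" "lcnj (a + b) = lcnj a + lcnj b"
  "lcnj (a - b) = lcnj a - lcnj b" "lcnj (- a) = - lcnj a" "lcnj (lhat a) = lhat (lcnj a)"
  by (simp_all add: lcnj_def times_lorc_def plus_lorc_def minus_lorc_def uminus_lorc_def lhat_def)

text \<open>Complex conjugation of all coefficients followed by conjugation with \<open>J\<close>. This is a ring
  automorphism, and \<open>H0\<close> is its fixed ring, which makes membership in \<open>H0\<close> an equation that
  can be computed with.\<close>

definition qtheta :: "hquat \<Rightarrow> hquat" where
  "qtheta x = HQ (lcnj (q0 x)) (- lcnj (q1 x)) (lcnj (q2 x)) (- lcnj (q3 x))"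

lemma qtheta_hom: "qtheta (x * y) = qtheta x * qtheta y" "qtheta (x + y) = qtheta x + qtheta y"
  "qtheta (- x) = - qtheta x" "qtheta (qconj x) = qconj (qtheta x)" "qtheta (qhat x) = qhat (qtheta x)"
  by (simp_all add: qtheta_def times_hquat_def plus_hquat_def uminus_hquat_def qconj_def qhat_def lcnj_hom lhat_hom
      algebra_simps)

lemma qtheta_units: "qtheta qI = - qI" "qtheta q\<sigma> = q\<sigma>" "qtheta (qreal a) = qreal a" "qtheta 1 = 1"
  "qtheta (vecq a b c d) = - vecq a b c d"
  unfolding vecq_def by (simp_all add: qtheta_def lcnj_def hquat_defs)

lemma H0_iff: "x \<in> H0 \<longleftrightarrow> qtheta x = x"
proof
  assume "x \<in> H0"
  then show "qtheta x = x"
    unfolding H0_def lorentz_numbers_def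
    by (auto simp: qtheta_def lcnj_def hquat_defs Reals_cnj_iff lorc.expand intro!: q_eqI)
next
  assume 1: "qtheta x = x"
  define p where "p a = Lor (- \<i> * sc a) (- \<i> * sg a)" for a
  have "x = qscal (q0 x) + qi * qscal (p (q1 x)) * qI + qscal (q2 x) * qJ + qi * qscal (p (q3 x)) * qK"
    by (rule q_eqI; rule lorc.expand) (simp_all add: hquat_defs p_def)
  moreover have "{q0 x, p (q1 x), q2 x, p (q3 x)} \<subseteq> lorentz_numbers"
  proof -
    have "lcnj (q0 x) = q0 x" "lcnj (q1 x) = - q1 x" "lcnj (q2 x) = q2 x" "lcnj (q3 x) = - q3 x"
      using arg_cong[OF 1, of q0] arg_cong[OF 1, of q1] arg_cong[OF 1, of q2] arg_cong[OF 1, of q3]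
      by (auto simp: qtheta_def) (metis minus_minus)+
    then show ?thesis
      by (cases "q0 x"; cases "q1 x"; cases "q2 x"; cases "q3 x")
         (auto simp: lorentz_numbers_def p_def lcnj_def uminus_lorc_def complex_is_Real_iff complex_eq_iff)
  qed
  ultimately show "x \<in> H0" unfolding H0_def by blast
qed

text \<open>The first equation makes the coefficients of \<open>1\<close> and \<open>J\<close> imaginary and those of \<open>I\<close> and \<open>K\<close>
  real; the second one makes the coefficient of \<open>1\<close> a multiple of \<open>\<sigma>\<close> and removes \<open>\<sigma>\<close> from the
  other three.\<close>

lemma R22I:
  assumes "qtheta x = - x" "qhat (qconj x) = - x"
  shows "x = vecq (Im (sg (q0 x))) (Re (sc (q1 x))) (Im (sc (q2 x))) (Re (sc (q3 x)))"
proof -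
  have t: "lcnj (q0 x) = - q0 x" "lcnj (q1 x) = q1 x" "lcnj (q2 x) = - q2 x" "lcnj (q3 x) = q3 x"
    using arg_cong[OF assms(1), of q0] arg_cong[OF assms(1), of q1] arg_cong[OF assms(1), of q2] arg_cong[OF assms(1), of q3]
    by (auto simp: qtheta_def uminus_hquat_def)
  have h: "lhat (q0 x) = - q0 x" "lhat (q1 x) = q1 x" "lhat (q2 x) = q2 x" "lhat (q3 x) = q3 x"
    using arg_cong[OF assms(2), of q0] arg_cong[OF assms(2), of q1] arg_cong[OF assms(2), of q2] arg_cong[OF assms(2), of q3]
    by (auto simp: qhat_def qconj_def uminus_hquat_def lhat_hom)
  show ?thesis
    unfolding vecq_def
    using t h by (cases "q0 x"; cases "q1 x"; cases "q2 x"; cases "q3 x")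
      (auto intro!: q_eqI simp: hquat_defs lcnj_def complex_eq_iff)
qed

lemma vecq_R22: "vecq a b c d \<in> R22"
  unfolding R22_def vecq_def by blast

lemma qH_vecq_qI: "qH (vecq a b c d) qI = lreal b"
  unfolding vecq_def by (simp add: hquat_defs)

section \<open>Spinor coordinates at a point\<close>

text \<open>The factor \<open>\<sigma>i\<close>, which occurs in Clifford multiplication, in the right action and in the
  pairing, is central with square \<open>-1\<close>.\<close>

lemma tau_cancel: "q\<sigma> * qi * x * (q\<sigma> * qi * y) = - (x * y)"
proof -
  have "q\<sigma> * qi * x * (q\<sigma> * qi * y) = (q\<sigma> * qi) * (x * (q\<sigma> * qi)) * y" by (simp add: mult.assoc)
  also have "x * (q\<sigma> * qi) = (q\<sigma> * qi) * x" by (metis mult.assoc q_central(1,2))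
  also have "(q\<sigma> * qi) * ((q\<sigma> * qi) * x) * y = ((q\<sigma> * qi) * (q\<sigma> * qi)) * (x * y)" by (simp add: mult.assoc)
  also have "(q\<sigma> * qi) * (q\<sigma> * qi) = - 1" by (simp add: hquat_defs)
  finally show ?thesis by simp
qed

lemma tau_inj: "q\<sigma> * qi * x = q\<sigma> * qi * y \<longleftrightarrow> x = y"
  by (metis tau_cancel mult_1 mult_1_right neg_equal_iff_equal mult.assoc)

abbreviation plusq :: hquat where "plusq \<equiv> qreal (1/2) * (1 + q\<sigma>)"

lemma plusq_central: "x * plusq = plusq * x"
  by (simp add: hquat_defs algebra_simps)

lemma plusq_hat_central: "x * qhat plusq = qhat plusq * x"
  by (simp add: hquat_defs algebra_simps)

text \<open>The value of the transformed spinor, when \<open>X\<close> and \<open>y\<close> are the coordinates of \<open>e\<^sub>1\<close> and of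
  the spinor; \<open>plusq\<close> is the idempotent that projects to \<open>\<phi>\<^sup>+\<close>, and its hat projects to \<open>\<phi>\<^sup>-\<close>.\<close>

definition twist :: "hquat \<Rightarrow> hquat \<Rightarrow> hquat" where
  "twist X y = plusq * y + X * qhat (plusq * y) * qI"

text \<open>The two summands are multiples of complementary idempotents of the coefficient ring and
  hence orthogonal; their norms are these idempotents, since \<open>X\<close>, \<open>I\<close> and \<open>y\<close> are unit.\<close>

lemma twist_unit:
  assumes "qH y y = 1" "qH X X = 1"
  shows "qH (twist X y) (twist X y) = 1"
proof -
  define p :: lorc where "p = lreal (1/2) * (1 + Lor 0 1)"
  have p: "plusq = qscal p" by (simp add: p_def hquat_defs)
  have lin: "qH (a + b) (a + b) = qH a a + 2 * qH a b + qH b b" for a b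
    by (simp add: qH_def plus_hquat_def algebra_simps)
  have sc: "qH (qscal a * x) (qscal b * z) = a * b * qH x z" for a b x z
    by (simp add: qH_def qscal_def times_hquat_def algebra_simps)
  have pp: "p * p = p" "p * lhat p = 0" "lhat p * lhat p = lhat p" "p + lhat p = 1"
    by (simp_all add: p_def hquat_defs)
  have "X * qhat (plusq * y) * qI = qscal (lhat p) * (X * qhat y * qI)"
    unfolding p qhat_mult qhat_qscal by (simp add: mult.assoc qscal_central[of X] flip: mult.assoc)
  then have "twist X y = qscal p * y + qscal (lhat p) * (X * qhat y * qI)"
    unfolding twist_def p by simp
  moreover have "qH (X * qhat y * qI) (X * qhat y * qI) = 1"
    unfolding qH_mult_right qH_mult_left qH_qhat assms by (simp add: hquat_defs)
  ultimately show ?thesis by (simp add: lin sc pp assms)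
qed

lemma vecq_hat_inverse:
  assumes "c * c - s * s = 1"
  shows "vecq s c 0 0 * qhat (vecq s c 0 0) = - 1"
  using assms unfolding vecq_def by (simp add: hquat_defs complex_eq_iff)

text \<open>In coordinates, \<open>z \<mapsto> X * qhat z * qI\<close> is the involution \<open>\<psi> \<mapsto> e\<^sub>1 \<cdot> (\<psi> \<bullet> I)\<close>, which fixes the
  sum of any element and its image.\<close>

lemma twist_eigen:
  assumes "X * qhat X = - 1"
  shows "X * qhat (twist X y) = - (twist X y * qI)"
proof -
  have "X * qhat (twist X y) = X * qhat (plusq * y) + (X * qhat X) * (plusq * y) * qI"
    unfolding twist_def qhat_add qhat_mult[of _ qI] qhat_mult[of X] qhat_qhat q_units_hat
    by (simp add: distrib_left mult.assoc)
  moreover have "twist X y * qI = plusq * y * qI - X * qhat (plusq * y)"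
    unfolding twist_def distrib_right mult.assoc[of _ qI qI] q_units by simp
  ultimately show ?thesis by (simp add: assms)
qed

text \<open>Here \<open>P, Q\<close> are the covariant derivatives along \<open>e\<^sub>2, e\<^sub>3\<close>, and the equation is the Dirac
  equation after division by \<open>\<sigma>i\<close>. The hypotheses on \<open>X1\<close> say that \<open>e\<^sub>1\<close> anticommutes with
  \<open>e\<^sub>0\<close>, \<open>e\<^sub>2\<close>, \<open>e\<^sub>3\<close> under Clifford multiplication, so that passing \<open>X1\<close> to the left changes
  the sign on both sides.\<close>

lemma twist_dirac:
  assumes D: "X0 * qhat y = qK * qhat Q - qi * qJ * qhat P"
    and X: "X0 * qhat X1 = - (X1 * qhat X0)"
      "qi * qJ * qhat X1 = - (X1 * (qi * qJ))" "qK * qhat X1 = - (X1 * qK)"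
  shows "X0 * qhat (twist X1 y) = qK * qhat (twist X1 Q) - qi * qJ * qhat (twist X1 P)"
proof -
  have th: "qhat (twist X1 z) = qhat plusq * qhat z + qhat X1 * (plusq * z) * qI" for z
    unfolding twist_def by (simp add: q_hom q_units_hat qhat_qhat)
  have D': "qhat X0 * y = qK * Q - qi * qJ * P"
    using arg_cong[OF D, of qhat] by (simp add: q_hom q_units_hat)
  have "qK * qhat (twist X1 Q) - qi * qJ * qhat (twist X1 P) =
      (qK * (qhat plusq * qhat Q) - qi * qJ * (qhat plusq * qhat P)) +
      ((qK * qhat X1) * (plusq * Q) - (qi * qJ * qhat X1) * (plusq * P)) * qI"
    unfolding th by (simp add: algebra_simps)
  also have "qK * (qhat plusq * qhat Q) - qi * qJ * (qhat plusq * qhat P) = qhat plusq * (X0 * qhat y)"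
    unfolding D right_diff_distrib by (metis mult.assoc plusq_hat_central)
  also have "(qK * qhat X1) * (plusq * Q) - (qi * qJ * qhat X1) * (plusq * P) = - (X1 * (plusq * (qhat X0 * y)))"
    unfolding X(2,3) D' right_diff_distrib
    by (simp add: right_diff_distrib) (metis mult.assoc plusq_central)
  also have "qhat plusq * (X0 * qhat y) = X0 * (qhat plusq * qhat y)"
    by (metis mult.assoc plusq_hat_central)
  also have "- (X1 * (plusq * (qhat X0 * y))) = - (X1 * qhat X0) * (plusq * y)"
    by simp (metis mult.assoc plusq_central)
  also have "\<dots> = X0 * qhat X1 * (plusq * y)" unfolding X(1) by simp
  finally show ?thesis unfolding th by (simp add: algebra_simps)
qed

text \<open>The connection form of the spinor bundle, acting by left multiplication, with \<open>a\<close> and \<open>b\<close>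
  the connection coefficients of \<open>E\<close> and of the tangent bundle.\<close>

definition spin_term :: "real \<Rightarrow> real \<Rightarrow> hquat" where
  "spin_term a b = qreal (1/2) * (qreal a * q\<sigma> * qi * qI + qreal b * qi * qI)"

text \<open>The hypothesis says that the vector with coordinates \<open>X\<close> is parallel: its derivative \<open>dX\<close> in
  the moving frame is the one caused by the rotation of the frame. Then the transformation
  commutes with covariant differentiation.\<close>

lemma twist_cov_deriv:
  assumes "dX = spin_term a b * X - X * qhat (spin_term a b)"
  shows "plusq * dy + (dX * qhat (plusq * y) + X * qhat (plusq * dy)) * qI - spin_term a b * twist X y
    = twist X (dy - spin_term a b * y)"
proof -
  have "plusq * (spin_term a b * y) = spin_term a b * (plusq * y)"
    by (metis mult.assoc plusq_central)
  then have 1: "plusq * (dy - spin_term a b * y) = plusq * dy - spin_term a b * (plusq * y)"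
    by (simp add: right_diff_distrib)
  show ?thesis
    unfolding assms twist_def 1 qhat_diff qhat_mult[of "spin_term a b"]
    by (simp add: algebra_simps)
qed

lemma spin_term_normal:
  "spin_term a b * vecq s c 0 0 - vecq s c 0 0 * qhat (spin_term a b) = - qreal a * vecq c s 0 0"
  unfolding spin_term_def vecq_def by (simp add: hquat_defs complex_eq_iff)

lemma normal_exchange:
  "vecq c s 0 0 * qhat (vecq s c 0 0) = - (vecq s c 0 0 * qhat (vecq c s 0 0))"
  "qi * qJ * qhat (vecq s c 0 0) = - (vecq s c 0 0 * (qi * qJ))"
  "qK * qhat (vecq s c 0 0) = - (vecq s c 0 0 * qK)"
  unfolding vecq_def by (simp_all add: hquat_defs complex_eq_iff)

text \<open>With \<open>P\<close> the covariant derivative of the spinor, the connection term in its derivative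
  contributes exactly the rotation of the tangent frame: \<open>K\<close> and \<open>iJ\<close> are exchanged with the
  coefficient \<open>b\<close> of the tangent bundle, and the coefficient \<open>a\<close> of \<open>E\<close> cancels since \<open>I\<close>
  anticommutes with \<open>J\<close> and \<open>K\<close>.\<close>

lemma frame_deriv:
  fixes a b :: real
  defines "\<Omega> \<equiv> spin_term a b"
  shows "qconj (P + \<Omega> * y) * qK * qhat y + qconj y * qK * qhat (P + \<Omega> * y) =
      qconj P * qK * qhat y + qconj y * qK * qhat P + qreal b * (qconj y * (qi * qJ) * qhat y)" (is ?K)
    "qconj (P + \<Omega> * y) * (qi * qJ) * qhat y + qconj y * (qi * qJ) * qhat (P + \<Omega> * y) =
      qconj P * (qi * qJ) * qhat y + qconj y * (qi * qJ) * qhat P + qreal b * (qconj y * qK * qhat y)" (is ?J)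
proof -
  have gen: "qconj (P + \<Omega> * y) * Z * qhat y + qconj y * Z * qhat (P + \<Omega> * y) =
      qconj P * Z * qhat y + qconj y * Z * qhat P + qconj y * (qconj \<Omega> * Z + Z * qhat \<Omega>) * qhat y" for Z
    by (simp add: q_hom algebra_simps)
  have 1: "qconj \<Omega> * qK + qK * qhat \<Omega> = qreal b * (qi * qJ)"
    "qconj \<Omega> * (qi * qJ) + (qi * qJ) * qhat \<Omega> = qreal b * qK"
    unfolding \<Omega>_def spin_term_def by (simp_all add: hquat_defs complex_eq_iff)
  have 2: "qconj y * (qreal b * z) * w = qreal b * (qconj y * z * w)" for z w
    by (metis mult.assoc q_central(3))
  show ?K ?J
    unfolding gen 1 2 by simp_all
qed

text \<open>Multiplied by \<open>iI\<close>, the Dirac equation expresses \<open>K P' - iJ Q'\<close>, with \<open>P', Q'\<close> the hats of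
  \<open>P, Q\<close>, through the spinor itself. The difference of the two sides is this element
  multiplied by the conjugate spinor, minus the image of that product under the composition of
  hat and conjugation; since \<open>X0\<close> commutes with \<open>I\<close>, it vanishes.\<close>

lemma dirac_closed:
  assumes D: "X0 * qhat y = qK * qhat Q - qi * qJ * qhat P"
    and X: "qhat (qconj X0) = - X0" "X0 * qI = qI * X0"
  shows "qconj P * qK * qhat y + qconj y * qK * qhat P =
    qconj Q * (qi * qJ) * qhat y + qconj y * (qi * qJ) * qhat Q"
proof -
  let ?E = "qK * qhat P - qi * qJ * qhat Q"
  have u: "qi * qI * qK = - (qi * qJ)" "qi * qI * qi * qJ = - qK" by (simp_all add: hquat_defs)
  have E: "?E = qi * qI * (X0 * qhat y)"
    unfolding D right_diff_distrib mult.assoc[symmetric] u by simp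
  have s: "qhat (qconj ?E) = qconj Q * (qi * qJ) - qconj P * qK"
    by (simp add: q_hom q_units_conj q_units_hat) (metis (no_types, opaque_lifting) q_central(1) mult.assoc)
  have s': "qhat (qconj ?E) = qconj y * (X0 * qi * qI)"
    unfolding E by (simp add: q_hom q_units_conj q_units_hat X flip: qhat_qconj) (metis (no_types, opaque_lifting) q_central(1) mult.assoc)
  have "qconj P * qK * qhat y + qconj y * qK * qhat P - (qconj Q * (qi * qJ) * qhat y + qconj y * (qi * qJ) * qhat Q)
     = qconj y * ?E - qhat (qconj ?E) * qhat y"
    unfolding s by (simp add: algebra_simps)
  also have "\<dots> = 0"
    unfolding s' unfolding E using X(2) by (simp add: mult.assoc) (metis mult.assoc q_central(1))
  finally show ?thesis by simp
qed

text \<open>As in the previous lemma, but with the Dirac equation as it stands: the two terms now add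
  up, because the composition of hat and conjugation changes the sign of the vector \<open>X0\<close>.\<close>

lemma dirac_trace:
  assumes D: "X0 * qhat y = qK * qhat Q - qi * qJ * qhat P"
    and X: "qhat (qconj X0) = - X0"
  shows "(qconj P * (qi * qJ) * qhat y + qconj y * (qi * qJ) * qhat P) -
    (qconj Q * qK * qhat y + qconj y * qK * qhat Q) = - qreal 2 * (qconj y * X0 * qhat y)"
proof -
  let ?E = "qK * qhat Q - qi * qJ * qhat P"
  have s: "qhat (qconj ?E) = qconj P * (qi * qJ) - qconj Q * qK"
    by (simp add: q_hom q_units_conj q_units_hat) (metis (no_types, opaque_lifting) q_central(1) mult.assoc)
  have s': "qhat (qconj ?E) = - (qconj y * X0)"
    unfolding D[symmetric] by (simp add: q_hom X flip: qhat_qconj)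
  have "(qconj P * (qi * qJ) * qhat y + qconj y * (qi * qJ) * qhat P) -
    (qconj Q * qK * qhat y + qconj y * qK * qhat Q) = qhat (qconj ?E) * qhat y - qconj y * ?E"
    unfolding s by (simp add: algebra_simps)
  also have "\<dots> = - (qconj y * X0 * qhat y) - qconj y * X0 * qhat y"
    unfolding s' unfolding D[symmetric] by (simp add: mult.assoc)
  also have "\<dots> = - qreal 2 * (qconj y * X0 * qhat y)"
  proof -
    have "qreal 2 = 1 + 1" by (simp add: hquat_defs)
    then show ?thesis by (simp add: mult_2)
  qed
  finally show ?thesis .
qed

lemma cosh_square:
  fixes a x :: real
  shows "cosh a * cosh a = 1 + sinh a * sinh a" "cosh a * (cosh a * x) = x + sinh a * (sinh a * x)"
proof -
  show "cosh a * cosh a = 1 + sinh a * sinh a"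
    using hyperbolic_pythagoras[of a] by (simp add: power2_eq_square)
  from arg_cong[OF this, of "\<lambda>z. z * x"] show "cosh a * (cosh a * x) = x + sinh a * (sinh a * x)"
    by (simp add: algebra_simps)
qed

text \<open>The double covering of the Lorentz group: the spin element of rapidity \<open>a\<close> acts on vectors
  as the boost of rapidity \<open>2a\<close> in the normal plane.\<close>

lemma spinE_vecq:
  assumes "g \<in> spin11"
  shows "qconj (spinE g) * vecq x0 x1 x2 x3 * qhat (spinE g) =
    vecq (cosh (2 * snd g) * x0 + sinh (2 * snd g) * x1) (sinh (2 * snd g) * x0 + cosh (2 * snd g) * x1) x2 x3"
    (is ?vec)
    and "qconj (spinE g) * spinE g = 1" "spinE g * qconj (spinE g) = 1"
proof -
  obtain e a where g: "g = (e, a)" "e = 1 \<or> e = - 1" using assms unfolding spin11_def by auto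
  define C S where "C = cosh a" and "S = sinh a"
  have CS: "C * C = 1 + S * S" "C * (C * x) = x + S * (S * x)" for x
    unfolding C_def S_def by (rule cosh_square)+
  have d: "cosh (2 * a) = C * C + S * S" "sinh (2 * a) = 2 * S * C"
    by (simp_all add: C_def S_def cosh_double sinh_double power2_eq_square)
  show ?vec
    unfolding g snd_conv spinE.simps d C_def[symmetric] S_def[symmetric] vecq_def
    using g(2) by (elim disjE; simp add: hquat_defs complex_eq_iff; simp add: algebra_simps CS)
  show "qconj (spinE g) * spinE g = 1" "spinE g * qconj (spinE g) = 1"
    unfolding g spinE.simps C_def[symmetric] S_def[symmetric]
    using g(2) by (elim disjE; simp add: hquat_defs complex_eq_iff; simp add: algebra_simps CS)+
qed

lemma spinM_vecq:
  assumes "g \<in> spin11"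
  shows "qconj (spinM g) * vecq x0 x1 x2 x3 * qhat (spinM g) =
    vecq x0 x1 (cosh (2 * snd g) * x2 + sinh (2 * snd g) * x3) (sinh (2 * snd g) * x2 + cosh (2 * snd g) * x3)"
    (is ?vec)
    and "qconj (spinM g) * spinM g = 1" "spinM g * qconj (spinM g) = 1"
proof -
  obtain e a where g: "g = (e, a)" "e = 1 \<or> e = - 1" using assms unfolding spin11_def by auto
  define C S where "C = cosh a" and "S = sinh a"
  have CS: "C * C = 1 + S * S" "C * (C * x) = x + S * (S * x)" for x
    unfolding C_def S_def by (rule cosh_square)+
  have d: "cosh (2 * a) = C * C + S * S" "sinh (2 * a) = 2 * S * C"
    by (simp_all add: C_def S_def cosh_double sinh_double power2_eq_square)
  show ?vec
    unfolding g snd_conv spinM.simps d C_def[symmetric] S_def[symmetric] vecq_def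
    using g(2) by (elim disjE; simp add: hquat_defs complex_eq_iff; simp add: algebra_simps CS)
  show "qconj (spinM g) * spinM g = 1" "spinM g * qconj (spinM g) = 1"
    unfolding g spinM.simps C_def[symmetric] S_def[symmetric]
    using g(2) by (elim disjE; simp add: hquat_defs complex_eq_iff; simp add: algebra_simps CS)+
qed

section \<open>Differentiation of quaternion-valued functions\<close>

context smooth_surface
begin

definition csmooth_on :: "'m set \<Rightarrow> ('m \<Rightarrow> complex) \<Rightarrow> bool" where
  "csmooth_on U f \<longleftrightarrow> smooth_on A U (\<lambda>x. Re (f x)) \<and> smooth_on A U (\<lambda>x. Im (f x))"

definition lsmooth_on :: "'m set \<Rightarrow> ('m \<Rightarrow> lorc) \<Rightarrow> bool" where
  "lsmooth_on U f \<longleftrightarrow> csmooth_on U (\<lambda>x. sc (f x)) \<and> csmooth_on U (\<lambda>x. sg (f x))"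

lemma hsmooth_on_iff: "hsmooth_on A U F \<longleftrightarrow> lsmooth_on U (\<lambda>x. q0 (F x)) \<and> lsmooth_on U (\<lambda>x. q1 (F x)) \<and>
    lsmooth_on U (\<lambda>x. q2 (F x)) \<and> lsmooth_on U (\<lambda>x. q3 (F x))"
  unfolding hsmooth_on_def lsmooth_on_def csmooth_on_def by simp

lemma csmooth_on_add: "csmooth_on U f \<Longrightarrow> csmooth_on U g \<Longrightarrow> csmooth_on U (\<lambda>x. f x + g x)"
  and csmooth_on_diff: "csmooth_on U f \<Longrightarrow> csmooth_on U g \<Longrightarrow> csmooth_on U (\<lambda>x. f x - g x)"
  and csmooth_on_mult: "csmooth_on U f \<Longrightarrow> csmooth_on U g \<Longrightarrow> csmooth_on U (\<lambda>x. f x * g x)"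
  and csmooth_on_uminus: "csmooth_on U f \<Longrightarrow> csmooth_on U (\<lambda>x. - f x)"
  and csmooth_on_const: "open U \<Longrightarrow> csmooth_on U (\<lambda>x. c)"
  unfolding csmooth_on_def
  by (auto intro: smooth_on_add smooth_on_diff smooth_on_mult smooth_on_uminus smooth_on_const)

lemma lsmooth_on_add: "lsmooth_on U f \<Longrightarrow> lsmooth_on U g \<Longrightarrow> lsmooth_on U (\<lambda>x. f x + g x)"
  and lsmooth_on_diff: "lsmooth_on U f \<Longrightarrow> lsmooth_on U g \<Longrightarrow> lsmooth_on U (\<lambda>x. f x - g x)"
  and lsmooth_on_mult: "lsmooth_on U f \<Longrightarrow> lsmooth_on U g \<Longrightarrow> lsmooth_on U (\<lambda>x. f x * g x)"
  and lsmooth_on_uminus: "lsmooth_on U f \<Longrightarrow> lsmooth_on U (\<lambda>x. - f x)"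
  and lsmooth_on_hat: "lsmooth_on U f \<Longrightarrow> lsmooth_on U (\<lambda>x. lhat (f x))"
  and lsmooth_on_const: "open U \<Longrightarrow> lsmooth_on U (\<lambda>x. c)"
  unfolding lsmooth_on_def plus_lorc_def minus_lorc_def times_lorc_def uminus_lorc_def lhat_def lorc.sel
  by (intro conjI csmooth_on_add csmooth_on_diff csmooth_on_mult csmooth_on_uminus csmooth_on_const; simp)+

lemma hsmooth_on_add: "hsmooth_on A U F \<Longrightarrow> hsmooth_on A U G \<Longrightarrow> hsmooth_on A U (\<lambda>x. F x + G x)"
  and hsmooth_on_mult: "hsmooth_on A U F \<Longrightarrow> hsmooth_on A U G \<Longrightarrow> hsmooth_on A U (\<lambda>x. F x * G x)"
  and hsmooth_on_uminus: "hsmooth_on A U F \<Longrightarrow> hsmooth_on A U (\<lambda>x. - F x)"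
  and hsmooth_on_hat: "hsmooth_on A U F \<Longrightarrow> hsmooth_on A U (\<lambda>x. qhat (F x))"
  and hsmooth_on_conj: "hsmooth_on A U F \<Longrightarrow> hsmooth_on A U (\<lambda>x. qconj (F x))"
  and hsmooth_on_const: "open U \<Longrightarrow> hsmooth_on A U (\<lambda>x. c)"
  unfolding hsmooth_on_iff plus_hquat_def times_hquat_def uminus_hquat_def qhat_def qconj_def hquat.sel
  by (intro conjI lsmooth_on_add lsmooth_on_diff lsmooth_on_mult lsmooth_on_uminus lsmooth_on_hat lsmooth_on_const; simp)+

lemma hsmooth_on_qreal: "smooth_on A U f \<Longrightarrow> hsmooth_on A U (\<lambda>x. qreal (f x))"
  unfolding hsmooth_on_iff lsmooth_on_def csmooth_on_def qreal_def qscal_def lreal_def zero_lorc_def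
  by (simp add: smooth_on_const smooth_on_open)

lemmas hsmooth_intros = hsmooth_on_add hsmooth_on_mult hsmooth_on_uminus hsmooth_on_hat hsmooth_on_conj
  hsmooth_on_const hsmooth_on_qreal

lemma hsmooth_on_cong: "hsmooth_on A U F \<Longrightarrow> (\<And>x. x \<in> U \<Longrightarrow> F x = G x) \<Longrightarrow> hsmooth_on A U G"
  unfolding hsmooth_on_def by (metis (no_types, lifting) smooth_on_cong)

lemma hsmooth_on_local:
  "(\<And>p. p \<in> U \<Longrightarrow> \<exists>W. p \<in> W \<and> hsmooth_on A W F) \<Longrightarrow> open U \<Longrightarrow> hsmooth_on A U F"
  unfolding hsmooth_on_def
  by (intro ballI smooth_on_local) (metis, assumption)

context
  fixes p U and v :: "'m tvec"
  assumes v: "v \<in> T p" and p: "p \<in> U"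
begin

lemma dC_add: "csmooth_on U f \<Longrightarrow> csmooth_on U g \<Longrightarrow> dC v (\<lambda>x. f x + g x) = dC v f + dC v g"
  and dC_diff: "csmooth_on U f \<Longrightarrow> csmooth_on U g \<Longrightarrow> dC v (\<lambda>x. f x - g x) = dC v f - dC v g"
  and dC_uminus: "csmooth_on U f \<Longrightarrow> dC v (\<lambda>x. - f x) = - dC v f"
  unfolding csmooth_on_def dC_def
  by (simp_all add: tv_add[OF v] tv_diff[OF v] tv_uminus[OF v] smooth_atI[OF _ p] complex_eq_iff)

lemma dC_mult: "csmooth_on U f \<Longrightarrow> csmooth_on U g \<Longrightarrow> dC v (\<lambda>x. f x * g x) = dC v f * g p + f p * dC v g"
proof -
  assume f: "csmooth_on U f" and g: "csmooth_on U g"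
  have s: "smooth_at A p (\<lambda>x. Re (f x))" "smooth_at A p (\<lambda>x. Im (f x))"
    "smooth_at A p (\<lambda>x. Re (g x))" "smooth_at A p (\<lambda>x. Im (g x))"
    using f g unfolding csmooth_on_def by (auto intro: smooth_atI[OF _ p])
  show ?thesis
    unfolding dC_def
    by (simp add: complex_eq_iff tv_add[OF v] tv_diff[OF v] tv_mult[OF v] smooth_at_mult s algebra_simps)
qed

lemma dL_add: "lsmooth_on U f \<Longrightarrow> lsmooth_on U g \<Longrightarrow> dL v (\<lambda>x. f x + g x) = dL v f + dL v g"
  and dL_diff: "lsmooth_on U f \<Longrightarrow> lsmooth_on U g \<Longrightarrow> dL v (\<lambda>x. f x - g x) = dL v f - dL v g"
  and dL_uminus: "lsmooth_on U f \<Longrightarrow> dL v (\<lambda>x. - f x) = - dL v f"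
  and dL_hat: "lsmooth_on U f \<Longrightarrow> dL v (\<lambda>x. lhat (f x)) = lhat (dL v f)"
  and dL_mult: "lsmooth_on U f \<Longrightarrow> lsmooth_on U g \<Longrightarrow> dL v (\<lambda>x. f x * g x) = dL v f * g p + f p * dL v g"
  unfolding lsmooth_on_def dL_def plus_lorc_def minus_lorc_def uminus_lorc_def lhat_def times_lorc_def lorc.sel
  by (simp_all add: dC_add dC_diff dC_uminus dC_mult csmooth_on_mult)

lemma dH_add: "hsmooth_on A U F \<Longrightarrow> hsmooth_on A U G \<Longrightarrow> dH v (\<lambda>x. F x + G x) = dH v F + dH v G"
  and dH_uminus: "hsmooth_on A U F \<Longrightarrow> dH v (\<lambda>x. - F x) = - dH v F"
  and dH_hat: "hsmooth_on A U F \<Longrightarrow> dH v (\<lambda>x. qhat (F x)) = qhat (dH v F)"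
  and dH_conj: "hsmooth_on A U F \<Longrightarrow> dH v (\<lambda>x. qconj (F x)) = qconj (dH v F)"
  unfolding hsmooth_on_iff dH_def plus_hquat_def uminus_hquat_def qhat_def qconj_def hquat.sel
  by (simp_all add: dL_add dL_diff dL_uminus dL_hat)

lemma dH_mult: "hsmooth_on A U F \<Longrightarrow> hsmooth_on A U G \<Longrightarrow> dH v (\<lambda>x. F x * G x) = dH v F * G p + F p * dH v G"
  unfolding hsmooth_on_iff dH_def plus_hquat_def times_hquat_def hquat.sel
  by (simp add: dL_add dL_diff dL_mult lsmooth_on_mult lsmooth_on_add lsmooth_on_diff)

end

lemma dH_const: "v \<in> T p \<Longrightarrow> dH v (\<lambda>x. c) = 0"
  by (simp add: dH_def dL_def dC_def tv_const zero_hquat_def zero_lorc_def complex_eq_iff)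

lemma dH_local:
  assumes "v \<in> T p" "open W" "p \<in> W" "\<And>x. x \<in> W \<Longrightarrow> F x = G x"
  shows "dH v F = dH v G"
  unfolding dH_def dL_def dC_def
  using assms(4) by (auto intro!: tv_local[OF assms(1-3)] simp: complex_eq_iff)

lemma dH_lincomb: "dH (lincomb a u b v) F = qreal a * dH u F + qreal b * dH v F"
  by (simp add: dH_def dL_def dC_def lincomb_def hquat_defs complex_eq_iff)

end

section \<open>Spin structures and frames\<close>

lemma spin_structure_section:
  assumes "spin_structure Q boost ff cov act"
  shows "\<exists>U s t. p \<in> U \<and> spin_section ff cov U s \<and>
        homeomorphism (U \<times> spin11) {q. fst (cov q) \<in> U} (\<lambda>(x, g). act (s x) g) t"
  using assms unfolding spin_structure_def by blast

lemma spin_structure_fibre: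
  assumes S: "spin_structure Q boost ff cov act"
    and b: "\<And>a e. fst (boost a e) = fst e" and ff: "\<And>U e x. ff U e \<Longrightarrow> x \<in> U \<Longrightarrow> fst (e x) = x"
  shows "\<exists>q0. fst (cov q0) = p \<and> (\<forall>q. fst (cov q) = p \<longrightarrow> (\<exists>g\<in>spin11. q = act q0 g))"
proof -
  have S2: "\<forall>q. \<forall>g\<in>spin11. cov (act q g) = boost (2 * snd g) (cov q)"
    using S unfolding spin_structure_def by blast
  from spin_structure_section[OF S, of p] obtain U s t where U: "p \<in> U" "spin_section ff cov U s"
    "homeomorphism (U \<times> spin11) {q. fst (cov q) \<in> U} (\<lambda>(x, g). act (s x) g) t"
    by (elim exE conjE)
  have s: "fst (cov (s x)) = x" if "x \<in> U" for x
    using U(2) ff that unfolding spin_section_def by blast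
  have "\<exists>g\<in>spin11. q = act (s p) g" if q: "fst (cov q) = p" for q
  proof -
    have "q \<in> (\<lambda>(x, g). act (s x) g) ` (U \<times> spin11)"
      using U(1,3) q by (simp add: homeomorphism_def)
    then obtain x g where x: "x \<in> U" "g \<in> spin11" "q = act (s x) g" by auto
    have "fst (cov q) = x" using S2 x b s by simp
    then show ?thesis using x q by auto
  qed
  then show ?thesis using s[OF U(1)] by blast
qed

lemma boost_fst: "fst (boostM a e) = fst e" "fst (boostE a e') = fst e'"
  by (cases e; simp) (cases e'; simp)

locale lorentzian_surface =
  fixes S :: "('m::{t2_space, second_countable_topology}, 'e::topological_space, 'q::topological_space) spin_surface"
  assumes S: "lorentzian_spin_surface S"

sublocale lorentzian_surface \<subseteq> smooth_surface "atlas S"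
  using S unfolding lorentzian_spin_surface_def by unfold_locales simp

context lorentzian_surface
begin

abbreviation "A \<equiv> atlas S"
abbreviation "g \<equiv> metric S"

lemma metric: "lorentzian_metric A g" and lc: "levi_civita A g (nabla S)"
  and oriented: "space_time_oriented A g (framesM S)"
  and structM: "spin_structure (framesM S) boostM (frame_fieldM A (framesM S)) (covM S) (actM S)"
  and structE: "spin_structure framesE boostE (frame_fieldE A) (covE S) (actE S)"
  using S unfolding lorentzian_spin_surface_def by blast+

lemma g_sym: "u \<in> T p \<Longrightarrow> v \<in> T p \<Longrightarrow> g p u v = g p v u"
  and g_lin: "u \<in> T p \<Longrightarrow> v \<in> T p \<Longrightarrow> w \<in> T p \<Longrightarrow> g p (lincomb a u b v) w = a * g p u w + b * g p v w"
  and g_smooth: "smooth_vf A U X \<Longrightarrow> smooth_vf A U Y \<Longrightarrow> smooth_on A U (\<lambda>p. g p (X p) (Y p))"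
  using metric unfolding lorentzian_metric_def by blast+

lemma g_lin_right: "u \<in> T p \<Longrightarrow> v \<in> T p \<Longrightarrow> w \<in> T p \<Longrightarrow> g p w (lincomb a u b v) = a * g p w u + b * g p w v"
  using g_lin g_sym lincomb_tangent by metis

lemma zero_tangent: "u \<in> T p \<Longrightarrow> (\<lambda>_. 0) \<in> T p"
  using lincomb_tangent[of u p u 0 0] by (simp add: lincomb_def)

lemma g_zero: "u \<in> T p \<Longrightarrow> g p (\<lambda>_. 0) u = 0"
  using g_lin[of u p u u 0 0] by (simp add: lincomb_def)

lemma on_basisD:
  assumes "on_basis A g p u v"
  shows "u \<in> T p" "v \<in> T p" "g p u u = - 1" "g p v v = 1" "g p u v = 0" "g p v u = 0"
    "T p = {lincomb a u b v | a b. True}"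
  using assms g_sym unfolding on_basis_def by auto

lemma on_basis_expand:
  assumes "on_basis A g p u v" "t \<in> T p"
  shows "t = lincomb (- g p t u) u (g p t v) v"
proof -
  note b = on_basisD(1-6)[OF assms(1)]
  obtain x y where t: "t = lincomb x u y v" using assms(2) on_basisD(7)[OF assms(1)] by blast
  show ?thesis unfolding t by (simp add: g_lin b)
qed

lemma framesM_basis: "(p, u, v) \<in> framesM S \<Longrightarrow> on_basis A g p u v"
  using oriented unfolding space_time_oriented_def by blast

lemma covE_act: "h \<in> spin11 \<Longrightarrow> covE S (actE S r h) = boostE (2 * snd h) (covE S r)"
  using structE unfolding spin_structure_def by blast

lemma covM_act: "h \<in> spin11 \<Longrightarrow> covM S (actM S q h) = boostM (2 * snd h) (covM S q)"
  using structM unfolding spin_structure_def by blast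

lemma covE_frame: obtains c d where "covE S r = (fst (covE S r), (c, - d), (- d, c))" "c * c - d * d = 1"
proof -
  have "covE S r \<in> framesE" using structE unfolding spin_structure_def by blast
  then obtain a p where "covE S r = boostE a (p, (1, 0), (0, 1))" unfolding framesE_def by blast
  then have "covE S r = (fst (covE S r), (cosh a, - sinh a), (- sinh a, cosh a))" by simp
  moreover have "cosh a * cosh a - sinh a * sinh a = 1"
    using hyperbolic_pythagoras[of a] by (simp add: power2_eq_square)
  ultimately show ?thesis using that by blast
qed

lemma covM_frame: obtains u v where "covM S q = (fst (covM S q), u, v)" "on_basis A g (fst (covM S q)) u v"
proof -
  have "covM S q \<in> framesM S" using structM unfolding spin_structure_def by blast
  then show ?thesis using that framesM_basis by (metis prod.collapse)
qed

lemma coord_vecq: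
  assumes "covE S r = (p', (c, - d), (- d, c))" "covM S q = (p, u, v)"
  shows "coord S (w, t) (r, q) = vecq (c * fst w + d * snd w) (d * fst w + c * snd w) (- g p t u) (g p t v)"
  using assms by (simp add: coord_def eprod_def vecq_def algebra_simps)

text \<open>A change of the spin frame multiplies spinor coordinates by \<open>G = spinE h * spinM k\<close> and
  transforms vector coordinates accordingly; this makes the pairing below independent of the
  frame.\<close>

lemma coord_act:
  assumes "h \<in> spin11" "k \<in> spin11" "t \<in> T (fst (covM S q))"
  shows "qconj (spinE h * spinM k) * coord S (w, t) (r, q) * qhat (spinE h * spinM k)
    = coord S (w, t) (actE S r h, actM S q k)"
proof -
  obtain c d where cd: "covE S r = (fst (covE S r), (c, - d), (- d, c))" by (rule covE_frame)
  obtain u v where uv: "covM S q = (fst (covM S q), u, v)" "on_basis A g (fst (covM S q)) u v" by (rule covM_frame)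
  let ?p = "fst (covM S q)" and ?C = "cosh (2 * snd h)" and ?S = "sinh (2 * snd h)"
    and ?C' = "cosh (2 * snd k)" and ?S' = "sinh (2 * snd k)"
  note b = on_basisD(1-6)[OF uv(2)]
  have "covE S (actE S r h) = (fst (covE S r), (?C * c + ?S * d, - (?S * c + ?C * d)), (- (?S * c + ?C * d), ?C * c + ?S * d))"
    unfolding covE_act[OF assms(1)] by (subst cd) (simp add: algebra_simps)
  moreover have "covM S (actM S q k) = (?p, lincomb ?C' u (- ?S') v, lincomb ?C' v (- ?S') u)"
    unfolding covM_act[OF assms(2)] by (subst uv(1)) simp
  ultimately have "coord S (w, t) (actE S r h, actM S q k) =
     vecq ((?C * c + ?S * d) * fst w + (?S * c + ?C * d) * snd w) ((?S * c + ?C * d) * fst w + (?C * c + ?S * d) * snd w)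
       (- g ?p t (lincomb ?C' u (- ?S') v)) (g ?p t (lincomb ?C' v (- ?S') u))"
    by (rule coord_vecq)
  moreover have "qconj (spinE h * spinM k) * coord S (w, t) (r, q) * qhat (spinE h * spinM k)
     = qconj (spinM k) * (qconj (spinE h) * coord S (w, t) (r, q) * qhat (spinE h)) * qhat (spinM k)"
    by (simp add: q_hom mult.assoc)
  ultimately show ?thesis
    unfolding coord_vecq[OF cd uv(1)] spinE_vecq(1)[OF assms(1)] spinM_vecq(1)[OF assms(2)]
      g_lin_right[OF b(1,2) assms(3)] g_lin_right[OF b(2,1) assms(3)]
    by (simp add: algebra_simps)
qed

lemma spin_pair_inverse:
  assumes "h \<in> spin11" "k \<in> spin11"
  shows "qconj (spinE h * spinM k) * (spinE h * spinM k) = 1" "(spinE h * spinM k) * qconj (spinE h * spinM k) = 1"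
proof -
  have "qconj (spinE h * spinM k) * (spinE h * spinM k) = qconj (spinM k) * (qconj (spinE h) * spinE h) * spinM k"
    by (simp add: q_hom mult.assoc)
  then show "qconj (spinE h * spinM k) * (spinE h * spinM k) = 1"
    using spinE_vecq(2)[OF assms(1)] spinM_vecq(2)[OF assms(2)] by simp
  have "(spinE h * spinM k) * qconj (spinE h * spinM k) = spinE h * (spinM k * qconj (spinM k)) * qconj (spinE h)"
    by (simp add: q_hom mult.assoc)
  then show "(spinE h * spinM k) * qconj (spinE h * spinM k) = 1"
    using spinE_vecq(3)[OF assms(1)] spinM_vecq(3)[OF assms(2)] by simp
qed

lemma act_Qt:
  assumes "(r, q) \<in> Qt S" "h \<in> spin11" "k \<in> spin11"
  shows "(actE S r h, actM S q k) \<in> Qt S" "base S (actE S r h, actM S q k) = base S (r, q)"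
  using assms by (auto simp: Qt_def base_def covE_act covM_act boost_fst)

text \<open>The spin group acts transitively on the spin frames at a point, by local triviality.\<close>

lemma Qt_fibre:
  "\<exists>x0\<in>Qt S. base S x0 = p \<and> (\<forall>x\<in>Qt S. base S x = p \<longrightarrow>
     (\<exists>h\<in>spin11. \<exists>k\<in>spin11. x = (actE S (fst x0) h, actM S (snd x0) k)))"
proof -
  obtain r where r: "fst (covE S r) = p" "\<And>q. fst (covE S q) = p \<Longrightarrow> \<exists>h\<in>spin11. q = actE S r h"
    using spin_structure_fibre[OF structE boost_fst(2), of p] unfolding frame_fieldE_def by blast
  obtain q where q: "fst (covM S q) = p" "\<And>q'. fst (covM S q') = p \<Longrightarrow> \<exists>h\<in>spin11. q' = actM S q h"
    using spin_structure_fibre[OF structM boost_fst(1), of p] unfolding frame_fieldM_def by blast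
  show ?thesis
  proof (intro bexI[of _ "(r, q)"] conjI ballI impI)
    show "(r, q) \<in> Qt S" "base S (r, q) = p" using r q by (auto simp: Qt_def base_def)
    fix x assume "x \<in> Qt S" "base S x = p"
    then have "fst (covE S (fst x)) = p" "fst (covM S (snd x)) = p"
      by (auto simp: Qt_def base_def)
    then show "\<exists>h\<in>spin11. \<exists>k\<in>spin11. x = (actE S (fst (r, q)) h, actM S (snd (r, q)) k)"
      using r(2) q(2) by (metis fst_conv snd_conv prod.collapse)
  qed
qed

lemma spinor_act:
  assumes "spinor_field S \<psi>" "(r, q) \<in> Qt S" "h \<in> spin11" "k \<in> spin11"
  shows "\<psi> (r, q) = spinE h * spinM k * \<psi> (actE S r h, actM S q k)"
  using assms unfolding spinor_field_def by fastforce

lemma pairing_clifford: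
  "pairing (clifford S X \<psi>) \<psi> x = - (qconj (\<psi> x) * coord S (X (base S x)) x * qhat (\<psi> x))"
  unfolding pairing_def clifford_def using tau_cancel[of "qconj (\<psi> x)" "coord S (X (base S x)) x * qhat (\<psi> x)"]
  by (simp add: mult.assoc)

lemma pairing_well_defined:
  assumes \<psi>: "spinor_field S \<psi>" and x: "x \<in> Qt S" "y \<in> Qt S" "base S x = base S y"
    and t: "snd (X (base S x)) \<in> T (base S x)"
  shows "pairing (clifford S X \<psi>) \<psi> x = pairing (clifford S X \<psi>) \<psi> y"
proof -
  obtain x0 where x0: "x0 \<in> Qt S" "base S x0 = base S x"
    "\<And>z. z \<in> Qt S \<Longrightarrow> base S z = base S x \<Longrightarrow> \<exists>h\<in>spin11. \<exists>k\<in>spin11. z = (actE S (fst x0) h, actM S (snd x0) k)"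
    using Qt_fibre[of "base S x"] by blast
  have "pairing (clifford S X \<psi>) \<psi> x0 = pairing (clifford S X \<psi>) \<psi> z" if z: "z \<in> Qt S" "base S z = base S x" for z
  proof -
    obtain h k where hk: "h \<in> spin11" "k \<in> spin11" "z = (actE S (fst x0) h, actM S (snd x0) k)"
      using x0(3)[OF z] by blast
    let ?G = "spinE h * spinM k"
    have \<psi>0: "\<psi> x0 = ?G * \<psi> z"
      using spinor_act[OF \<psi>, of "fst x0" "snd x0" h k] x0(1) hk by simp
    have c: "qconj ?G * coord S (X (base S x)) x0 * qhat ?G = coord S (X (base S x)) z"
      using coord_act[OF hk(1,2), of "snd (X (base S x))" "snd x0" "fst (X (base S x))" "fst x0"] t x0(2) hk(3)
      by (simp add: base_def)
    have "qconj (\<psi> x0) * coord S (X (base S x)) x0 * qhat (\<psi> x0) =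
       qconj (\<psi> z) * (qconj ?G * coord S (X (base S x)) x0 * qhat ?G) * qhat (\<psi> z)"
      unfolding \<psi>0 by (simp add: q_hom mult.assoc)
    then show ?thesis unfolding pairing_clifford x0(2) z(2) c by simp
  qed
  then show ?thesis using x by metis
qed

lemma smooth_vf_subset: "smooth_vf A U X \<Longrightarrow> open V \<Longrightarrow> V \<subseteq> U \<Longrightarrow> smooth_vf A V X"
  unfolding smooth_vf_def by (meson subset_iff order_trans)

lemma smooth_vf_cong:
  assumes "smooth_vf A U X" "\<And>x. x \<in> U \<Longrightarrow> X x = Y x" shows "smooth_vf A U Y"
  unfolding smooth_vf_def
proof (intro conjI allI impI ballI)
  show "open U" using assms unfolding smooth_vf_def by blast
  fix p assume "p \<in> U" then show "Y p \<in> T p" using assms unfolding smooth_vf_def by metis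
next
  fix V f assume V: "V \<subseteq> U \<and> smooth_on A V f"
  then have "smooth_on A V (\<lambda>p. X p f)" using assms unfolding smooth_vf_def by blast
  then show "smooth_on A V (\<lambda>p. Y p f)" by (rule smooth_on_cong) (use V assms(2) in auto)
qed

lemma smooth_vfD: "smooth_vf A U X \<Longrightarrow> p \<in> U \<Longrightarrow> X p \<in> T p"
  "smooth_vf A U X \<Longrightarrow> smooth_on A U f \<Longrightarrow> smooth_on A U (\<lambda>p. X p f)" "smooth_vf A U X \<Longrightarrow> open U"
  unfolding smooth_vf_def by blast+

lemma frame_fieldM_subset: "frame_fieldM A Q U e \<Longrightarrow> open V \<Longrightarrow> V \<subseteq> U \<Longrightarrow> frame_fieldM A Q V e"
  unfolding frame_fieldM_def by (meson smooth_vf_subset subset_iff)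

lemma frame_fieldE_subset: "frame_fieldE A U e \<Longrightarrow> open V \<Longrightarrow> V \<subseteq> U \<Longrightarrow> frame_fieldE A V e"
  unfolding frame_fieldE_def by (meson smooth_on_subset subset_iff)

lemma frame_fieldM_cong:
  assumes "frame_fieldM A Q U e" "\<And>x. x \<in> U \<Longrightarrow> e x = e' x" shows "frame_fieldM A Q U e'"
  using assms smooth_vf_cong[of U "\<lambda>x. fst (snd (e x))" "\<lambda>x. fst (snd (e' x))"]
    smooth_vf_cong[of U "\<lambda>x. snd (snd (e x))" "\<lambda>x. snd (snd (e' x))"]
  unfolding frame_fieldM_def by simp

lemma frame_fieldM_mem: "frame_fieldM A Q U e \<Longrightarrow> x \<in> U \<Longrightarrow> e x \<in> Q \<and> fst (e x) = x"
  unfolding frame_fieldM_def by (elim conjE) (rule bspec)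

text \<open>A given frame is a boost of the one under a local section of the spin structure. The
  rapidity is the inverse hyperbolic sine of a metric coefficient, hence continuous, and half
  of it acts on the section.\<close>

lemma spin_frame_lift:
  assumes e: "frame_fieldM A (framesM S) U e" and p: "p \<in> U"
  shows "\<exists>W s. p \<in> W \<and> W \<subseteq> U \<and> spin_frame S W s \<and> (\<forall>x\<in>W. covM S (snd (s x)) = e x)"
proof -
  obtain V r where V: "p \<in> V" "spin_section (frame_fieldE A) (covE S) V r"
    using spin_structure_section[OF structE, of p] by blast
  obtain V' q t where V': "p \<in> V'" "spin_section (frame_fieldM A (framesM S)) (covM S) V' q"
    "homeomorphism (V' \<times> spin11) {y. fst (covM S y) \<in> V'} (\<lambda>(x, h). actM S (q x) h) t"
    using spin_structure_section[OF structM, of p] by (elim exE conjE)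
  define W where "W = U \<inter> (V \<inter> V')"
  have W: "open W" "W \<subseteq> U" "W \<subseteq> V" "W \<subseteq> V'" "p \<in> W"
    using e V V' p unfolding W_def frame_fieldM_def smooth_vf_def spin_section_def by auto
  let ?v = "\<lambda>x. snd (snd (covM S (q x)))"
  define a where "a x = - arsinh (g x (fst (snd (e x))) (?v x))" for x
  have qM: "frame_fieldM A (framesM S) V' (\<lambda>x. covM S (q x))" using V'(2) unfolding spin_section_def by blast
  have "smooth_on A W (\<lambda>x. g x (fst (snd (e x))) (?v x))"
  proof (rule g_smooth)
    have "smooth_vf A U (\<lambda>x. fst (snd (e x)))" using e unfolding frame_fieldM_def by blast
    then show "smooth_vf A W (\<lambda>x. fst (snd (e x)))" using W(1,2) by (rule smooth_vf_subset)
    have "smooth_vf A V' ?v" using qM unfolding frame_fieldM_def by blast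
    then show "smooth_vf A W ?v" using W(1,4) by (rule smooth_vf_subset)
  qed
  from smooth_on_continuous[OF this] have ac: "continuous_on W a"
    unfolding a_def by (intro continuous_on_minus continuous_on_compose2[OF continuous_on_arsinh]) auto
  have ea: "e x = boostM (a x) (covM S (q x))" if x: "x \<in> W" for x
  proof -
    have mem: "e x \<in> framesM S" "covM S (q x) \<in> framesM S" "fst (e x) = x" "fst (covM S (q x)) = x"
      using frame_fieldM_mem[OF e subsetD[OF W(2) x]] frame_fieldM_mem[OF qM subsetD[OF W(4) x]] by simp_all
    have "{e' \<in> framesM S. fst e' = fst (covM S (q x))} = range (\<lambda>a. boostM a (covM S (q x)))"
      using oriented mem(2) unfolding space_time_oriented_def by blast
    moreover have "e x \<in> {e' \<in> framesM S. fst e' = fst (covM S (q x))}" using mem by simp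
    ultimately obtain b where b: "e x = boostM b (covM S (q x))" by blast
    obtain u v where uv: "covM S (q x) = (x, u, v)" using mem(4) by (metis prod.collapse)
    then have bs: "on_basis A g x u v" using framesM_basis mem(2) by simp
    have "g x (fst (snd (e x))) (?v x) = - sinh b"
      unfolding b uv using on_basisD(1-6)[OF bs] by (simp add: g_lin)
    then show ?thesis using b by (simp add: a_def arsinh_sinh_real)
  qed
  define s where "s x = (r x, actM S (q x) (1, a x / 2))" for x
  have cov: "covM S (snd (s x)) = e x" if "x \<in> W" for x
    using ea[OF that] covM_act[of "(1, a x / 2)" "q x"] by (simp add: s_def spin11_def)
  have "spin_section (frame_fieldE A) (covE S) W (\<lambda>x. fst (s x))"
    using V(2) W(1,3) continuous_on_subset[of V r W] frame_fieldE_subset[of V _ W]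
    unfolding spin_section_def s_def by auto
  moreover have "spin_section (frame_fieldM A (framesM S)) (covM S) W (\<lambda>x. snd (s x))"
    unfolding spin_section_def
  proof (intro conjI W(1))
    have "continuous_on W (\<lambda>x. (\<lambda>(x, h). actM S (q x) h) (x, (1, a x / 2)))"
    proof (rule continuous_on_compose2[where f = "\<lambda>x. (x, (1, a x / 2))" and s = W and t = "V' \<times> spin11"])
      show "continuous_on (V' \<times> spin11) (\<lambda>(x, h). actM S (q x) h)"
        using V'(3) by (simp add: homeomorphism_def)
      show "continuous_on W (\<lambda>x. (x, (1, a x / 2)))" by (intro continuous_intros ac) simp
      show "(\<lambda>x. (x, (1, a x / 2))) ` W \<subseteq> V' \<times> spin11" using W(4) by (auto simp: spin11_def)
    qed
    then show "continuous_on W (\<lambda>x. snd (s x))" by (simp add: s_def)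
    show "frame_fieldM A (framesM S) W (\<lambda>x. covM S (snd (s x)))"
      by (rule frame_fieldM_cong[OF frame_fieldM_subset[OF e W(1,2)]]) (simp add: cov)
  qed
  ultimately show ?thesis using W(2,5) cov unfolding spin_frame_def by blast
qed

lemma spin_frame_exists: "\<exists>W s. p \<in> W \<and> spin_frame S W s"
proof -
  obtain U e where e: "frame_fieldM A (framesM S) U e" "p \<in> U"
    using oriented unfolding space_time_oriented_def by blast
  from spin_frame_lift[OF this] obtain W s where "p \<in> W" "spin_frame S W s" by (elim exE conjE)
  then show ?thesis by (intro exI conjI)
qed

lemma levi_civitaD:
  assumes "smooth_vf A U X" "smooth_vf A U Y" "smooth_vf A U Z" "p \<in> U"
  shows "smooth_vf A U (nabla S X Y)"
    "X p (\<lambda>q. g q (Y q) (Z q)) = g p (nabla S X Y p) (Z p) + g p (Y p) (nabla S X Z p)"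
    "lincomb 1 (nabla S X Y p) (- 1) (nabla S Y X p) = lie_bracket A X Y p"
proof -
  have o: "smooth_on A U (\<lambda>q. 0)" using smooth_on_const smooth_vfD(3)[OF assms(1)] .
  show "smooth_vf A U (nabla S X Y)"
    "X p (\<lambda>q. g q (Y q) (Z q)) = g p (nabla S X Y p) (Z p) + g p (Y p) (nabla S X Z p)"
    "lincomb 1 (nabla S X Y p) (- 1) (nabla S Y X p) = lie_bracket A X Y p"
    using lc[unfolded levi_civita_def, rule_format, of U X Y Z "\<lambda>q. 0" "\<lambda>q. 0"] assms o by blast+
qed

text \<open>Compatibility with the metric makes the connection matrix of an orthonormal frame skew, so
  it has one coefficient.\<close>

lemma frame_connection:
  assumes f: "smooth_vf A U u" "smooth_vf A U v" "\<And>x. x \<in> U \<Longrightarrow> on_basis A g x (u x) (v x)"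
    and X: "smooth_vf A U X" and p: "p \<in> U"
  shows "nabla S X u p = lincomb 0 (u p) (g p (nabla S X u p) (v p)) (v p)"
    "nabla S X v p = lincomb (g p (nabla S X u p) (v p)) (u p) 0 (v p)"
proof -
  note b = on_basisD(1-6)[OF f(3)[OF p]]
  have o: "open U" by (rule smooth_vfD(3)[OF X])
  have N: "nabla S X u p \<in> T p" "nabla S X v p \<in> T p"
    using smooth_vfD(1)[OF levi_civitaD(1)[OF X f(1) X p] p] smooth_vfD(1)[OF levi_civitaD(1)[OF X f(2) X p] p] .
  have const: "X p (\<lambda>q. h q) = 0" if "\<And>x. x \<in> U \<Longrightarrow> h x = k" for h k
    using tv_local[OF smooth_vfD(1)[OF X p] o p, of h "\<lambda>_. k"] that tv_const[OF smooth_vfD(1)[OF X p]] by simp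
  have 1: "g p (nabla S X u p) (u p) = 0"
    using levi_civitaD(2)[OF X f(1) f(1) p] const[of "\<lambda>q. g q (u q) (u q)" "- 1"] on_basisD(3)[OF f(3)] g_sym[OF N(1) b(1)] by simp
  have 2: "g p (nabla S X v p) (v p) = 0"
    using levi_civitaD(2)[OF X f(2) f(2) p] const[of "\<lambda>q. g q (v q) (v q)" 1] on_basisD(4)[OF f(3)] g_sym[OF N(2) b(2)] by simp
  have 3: "g p (nabla S X v p) (u p) = - g p (nabla S X u p) (v p)"
    using levi_civitaD(2)[OF X f(1) f(2) p] const[of "\<lambda>q. g q (u q) (v q)" 0] on_basisD(5)[OF f(3)] g_sym[OF N(2) b(1)] by simp
  show "nabla S X u p = lincomb 0 (u p) (g p (nabla S X u p) (v p)) (v p)"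
    using on_basis_expand[OF f(3)[OF p] N(1)] 1 by simp
  show "nabla S X v p = lincomb (g p (nabla S X u p) (v p)) (u p) 0 (v p)"
    using on_basis_expand[OF f(3)[OF p] N(2)] 2 3 by simp
qed

lemma frame_bracket:
  assumes f: "smooth_vf A U u" "smooth_vf A U v" "\<And>x. x \<in> U \<Longrightarrow> on_basis A g x (u x) (v x)" and p: "p \<in> U"
  shows "lie_bracket A u v p = lincomb (g p (nabla S u u p) (v p)) (u p) (- g p (nabla S v u p) (v p)) (v p)"
proof -
  have 1: "nabla S u v p = lincomb (g p (nabla S u u p) (v p)) (u p) 0 (v p)"
    by (rule frame_connection(2)[OF f f(1) p])
  have 2: "nabla S v u p = lincomb 0 (u p) (g p (nabla S v u p) (v p)) (v p)"
    by (rule frame_connection(1)[OF f f(2) p])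
  have "lie_bracket A u v p = lincomb 1 (nabla S u v p) (- 1) (nabla S v u p)"
    by (rule levi_civitaD(3)[OF f(1,2,1) p, symmetric])
  then show ?thesis by (subst (asm) 1, subst (asm) 2) (simp add: lincomb_def)
qed

text \<open>By \<open>frame_bracket\<close> the connection coefficients are components of the bracket, which depends
  only on the vector fields near the point. So frame fields that agree only locally have the
  same coefficients.\<close>

lemma frame_connection_local:
  assumes f: "smooth_vf A U u" "smooth_vf A U v" "\<And>x. x \<in> U \<Longrightarrow> on_basis A g x (u x) (v x)" and p: "p \<in> U"
    and eq: "\<And>x. x \<in> U \<Longrightarrow> u' x = u x" "\<And>x. x \<in> U \<Longrightarrow> v' x = v x"
  shows "g p (nabla S u' u' p) (v' p) = g p (nabla S u u p) (v p)"
    "g p (nabla S v' u' p) (v' p) = g p (nabla S v u p) (v p)"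
proof -
  have f': "smooth_vf A U u'" "smooth_vf A U v'" "\<And>x. x \<in> U \<Longrightarrow> on_basis A g x (u' x) (v' x)"
    using smooth_vf_cong[OF f(1)] smooth_vf_cong[OF f(2)] f(3) eq by auto
  note b = on_basisD(1-6)[OF f(3)[OF p]]
  have o: "open U" by (rule smooth_vfD(3)[OF f(1)])
  have "lie_bracket A u' v' p = lie_bracket A u v p"
    unfolding lie_bracket_def eq(1)[OF p] eq(2)[OF p]
    using tv_local[OF b(1) o p, of "\<lambda>q. v' q _" "\<lambda>q. v q _"] tv_local[OF b(2) o p, of "\<lambda>q. u' q _" "\<lambda>q. u q _"] eq by auto
  then have L: "lincomb (g p (nabla S u' u' p) (v' p)) (u p) (- g p (nabla S v' u' p) (v' p)) (v p) =
    lincomb (g p (nabla S u u p) (v p)) (u p) (- g p (nabla S v u p) (v p)) (v p)"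
    using frame_bracket[OF f p] frame_bracket[OF f' p] eq p by simp
  show "g p (nabla S u' u' p) (v' p) = g p (nabla S u u p) (v p)"
    using arg_cong[OF L, of "\<lambda>t. g p t (u p)"] by (simp add: g_lin b)
  show "g p (nabla S v' u' p) (v' p) = g p (nabla S v u p) (v p)"
    using arg_cong[OF L, of "\<lambda>t. g p t (v p)"] by (simp add: g_lin b)
qed

end

section \<open>The transformed spinor field\<close>

context lorentzian_surface
begin

text \<open>For a spin frame \<open>s\<close>, the underlying frame of \<open>E\<close> at \<open>x\<close> is \<open>c e\<^sub>0 - d e\<^sub>1\<close>, \<open>c e\<^sub>1 - d e\<^sub>0\<close>
  with \<open>c, d\<close> the hyperbolic cosine and sine of its rapidity, and the underlying tangent frame
  is \<open>u, v\<close>.\<close>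

definition fr_c :: "('m \<Rightarrow> 'e \<times> 'q) \<Rightarrow> 'm \<Rightarrow> real" where "fr_c s x = fst (fst (snd (covE S (fst (s x)))))"
definition fr_d :: "('m \<Rightarrow> 'e \<times> 'q) \<Rightarrow> 'm \<Rightarrow> real" where "fr_d s x = - snd (fst (snd (covE S (fst (s x)))))"
definition fr_u :: "('m \<Rightarrow> 'e \<times> 'q) \<Rightarrow> 'm \<Rightarrow> 'm tvec" where "fr_u s x = fst (snd (covM S (snd (s x))))"
definition fr_v :: "('m \<Rightarrow> 'e \<times> 'q) \<Rightarrow> 'm \<Rightarrow> 'm tvec" where "fr_v s x = snd (snd (covM S (snd (s x))))"

context
  fixes U s assumes s: "spin_frame S U s"
begin

lemma fr_open: "open U" using s unfolding spin_frame_def spin_section_def by blast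

lemma fr_smooth: "smooth_on A U (fr_c s)" "smooth_on A U (fr_d s)" "smooth_vf A U (fr_u s)" "smooth_vf A U (fr_v s)"
proof -
  have E: "frame_fieldE A U (\<lambda>x. covE S (fst (s x)))" and M: "frame_fieldM A (framesM S) U (\<lambda>x. covM S (snd (s x)))"
    using s unfolding spin_frame_def spin_section_def by blast+
  show "smooth_on A U (fr_c s)" "smooth_on A U (fr_d s)"
    using E unfolding frame_fieldE_def fr_c_def[abs_def] fr_d_def[abs_def] by (auto intro: smooth_on_uminus)
  show "smooth_vf A U (fr_u s)" "smooth_vf A U (fr_v s)"
    using M unfolding frame_fieldM_def fr_u_def[abs_def] fr_v_def[abs_def] by simp_all
qed

context
  fixes x assumes x: "x \<in> U"
begin

lemma fr_base: "fst (covE S (fst (s x))) = x" "fst (covM S (snd (s x))) = x"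
  using s x unfolding spin_frame_def spin_section_def frame_fieldE_def frame_fieldM_def by auto

lemma fr_Qt: "s x \<in> Qt S" "base S (s x) = x"
  using fr_base by (auto simp: Qt_def base_def case_prod_unfold)

lemma fr_covE: "covE S (fst (s x)) = (x, (fr_c s x, - fr_d s x), (- fr_d s x, fr_c s x))"
  "fr_c s x * fr_c s x - fr_d s x * fr_d s x = 1"
proof -
  obtain c d where cd: "covE S (fst (s x)) = (fst (covE S (fst (s x))), (c, - d), (- d, c))" "c * c - d * d = 1"
    by (rule covE_frame)
  then have "fr_c s x = c" "fr_d s x = d" unfolding fr_c_def fr_d_def by (metis fst_conv snd_conv minus_minus)+
  then show "covE S (fst (s x)) = (x, (fr_c s x, - fr_d s x), (- fr_d s x, fr_c s x))"
    "fr_c s x * fr_c s x - fr_d s x * fr_d s x = 1" using cd fr_base(1) by metis+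
qed

lemma fr_covM: "covM S (snd (s x)) = (x, fr_u s x, fr_v s x)"
  unfolding fr_u_def fr_v_def using fr_base(2) by (metis prod.collapse)

lemma fr_basis: "on_basis A g x (fr_u s x) (fr_v s x)"
proof -
  obtain u v where "covM S (snd (s x)) = (fst (covM S (snd (s x))), u, v)" "on_basis A g (fst (covM S (snd (s x)))) u v"
    by (rule covM_frame)
  then show ?thesis using fr_covM fr_base(2) by (metis prod.inject)
qed

lemma fr_tangent: "fr_u s x \<in> T x" "fr_v s x \<in> T x"
  using on_basisD(1,2)[OF fr_basis] .

lemma fr_coord: "coord S (w, t) (s x) = vecq (fr_c s x * fst w + fr_d s x * snd w) (fr_d s x * fst w + fr_c s x * snd w)
    (- g x t (fr_u s x)) (g x t (fr_v s x))"
  using coord_vecq[OF fr_covE(1) fr_covM, of w t] by simp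

lemma fr_coord_simps:
  "coord S (e0 y) (s x) = vecq (fr_c s x) (fr_d s x) 0 0"
  "coord S (e1 y) (s x) = vecq (fr_d s x) (fr_c s x) 0 0"
  "coord S (tang t y) (s x) = vecq 0 0 (- g x t (fr_u s x)) (g x t (fr_v s x))"
  unfolding e0_def e1_def tang_def fr_coord using g_zero[OF fr_tangent(1)] g_zero[OF fr_tangent(2)] by simp_all

lemma fr_coord_uv: "coord S (tang (fr_u s x) y) (s x) = qi * qJ" "coord S (tang (fr_v s x) y) (s x) = qK"
  unfolding fr_coord_simps using on_basisD(1-6)[OF fr_basis]
  by (simp_all add: vecq_def qreal_hom) 

lemma cov_deriv_eq:
  "cov_deriv S s X \<psi> x = dH (X x) (\<lambda>x. \<psi> (s x)) - spin_term (omegaE S s X x) (omegaM S s X x) * \<psi> (s x)"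
  unfolding cov_deriv_def spin_term_def ..

text \<open>Since \<open>c\<^sup>2 - d\<^sup>2 = 1\<close>, the derivatives of \<open>c\<close> and \<open>d\<close> are determined by the connection
  coefficient. These two equations express that \<open>e\<^sub>0\<close> and \<open>e\<^sub>1\<close> are parallel.\<close>

lemma omegaE_eq:
  assumes "t \<in> T x" "X x = t"
  shows "t (fr_c s) = - omegaE S s X x * fr_d s x" "t (fr_d s) = - omegaE S s X x * fr_c s x"
proof -
  note sm = smooth_atI[OF fr_smooth(1) x] smooth_atI[OF fr_smooth(2) x]
  have "omegaE S s X x = t (fr_c s) * fr_d s x - t (fr_d s) * fr_c s x"
  proof -
    have 1: "(\<lambda>x. snd (fst (snd (covE S (fst (s x)))))) = (\<lambda>x. - fr_d s x)"
      "(\<lambda>x. fst (fst (snd (covE S (fst (s x)))))) = fr_c s"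
      unfolding fr_d_def fr_c_def by (auto simp: fun_eq_iff)
    have "snd (snd (covE S (fst (s x)))) = (- fr_d s x, fr_c s x)" using fr_covE(1) by simp
    then show ?thesis
      unfolding omegaE_def Let_def 1 assms(2) eprod_def using tv_uminus[OF assms(1) sm(2)] by simp
  qed
  moreover have "fr_c s x * t (fr_c s) = fr_d s x * t (fr_d s)"
  proof -
    have "t (\<lambda>x. fr_c s x * fr_c s x - fr_d s x * fr_d s x) = t (\<lambda>x. 1)"
      using tv_local[OF assms(1) fr_open x, of "\<lambda>x. fr_c s x * fr_c s x - fr_d s x * fr_d s x" "\<lambda>x. 1"]
        lorentzian_surface.fr_covE(2)[OF lorentzian_surface_axioms s] by blast
    then show ?thesis
      using tv_const[OF assms(1)] tv_diff[OF assms(1) smooth_at_mult[OF sm(1,1)] smooth_at_mult[OF sm(2,2)]]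
        tv_mult[OF assms(1) sm(1,1)] tv_mult[OF assms(1) sm(2,2)] by (simp add: mult.commute)
  qed
  moreover note fr_covE(2)
  ultimately show "t (fr_c s) = - omegaE S s X x * fr_d s x" "t (fr_d s) = - omegaE S s X x * fr_c s x"
    by algebra+
qed

end

lemma fr_normal_deriv:
  assumes "x \<in> U" "t \<in> T x" "X x = t"
  shows "dH t (\<lambda>x. vecq (fr_d s x) (fr_c s x) 0 0) = - qreal (omegaE S s X x) * vecq (fr_c s x) (fr_d s x) 0 0"
proof -
  have "dH t (\<lambda>x. vecq (fr_d s x) (fr_c s x) 0 0) = vecq (t (fr_d s)) (t (fr_c s)) 0 0"
    unfolding vecq_def
    by (simp add: dH_def dL_def dC_def hquat_defs tv_const[OF assms(2)] complex_eq_iff)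
  then show ?thesis
    unfolding omegaE_eq[where X = X, OF assms] vecq_def by (simp add: hquat_defs complex_eq_iff)
qed

lemma fr_dirac:
  assumes "has_dirac S \<psi> (clifford S e0 \<psi>)" "x \<in> U"
  shows "vecq (fr_c s x) (fr_d s x) 0 0 * qhat (\<psi> (s x)) =
    qK * qhat (cov_deriv S s (fr_v s) \<psi> x) - qi * qJ * qhat (cov_deriv S s (fr_u s) \<psi> x)"
proof -
  have "clifford S e0 \<psi> (s x) =
       - (q\<sigma> * qi * (qi * qJ) * qhat (cov_deriv S s (fr_u s) \<psi> x))
       + q\<sigma> * qi * qK * qhat (cov_deriv S s (fr_v s) \<psi> x)"
    using assms s unfolding has_dirac_def fr_u_def[abs_def] fr_v_def[abs_def] by blast
  then have "q\<sigma> * qi * (vecq (fr_c s x) (fr_d s x) 0 0 * qhat (\<psi> (s x))) =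
     q\<sigma> * qi * (qK * qhat (cov_deriv S s (fr_v s) \<psi> x) - qi * qJ * qhat (cov_deriv S s (fr_u s) \<psi> x))"
    unfolding clifford_def fr_coord_simps(1)[OF assms(2)] by (simp add: right_diff_distrib mult.assoc)
  then show ?thesis unfolding tau_inj .
qed

lemma fr_diracI:
  assumes "x \<in> U" "vecq (fr_c s x) (fr_d s x) 0 0 * qhat (\<psi> (s x)) =
    qK * qhat (cov_deriv S s (fr_v s) \<psi> x) - qi * qJ * qhat (cov_deriv S s (fr_u s) \<psi> x)"
  shows "clifford S e0 \<psi> (s x) =
       - (q\<sigma> * qi * (qi * qJ) * qhat (cov_deriv S s (\<lambda>x. fst (snd (covM S (snd (s x))))) \<psi> x))
       + q\<sigma> * qi * qK * qhat (cov_deriv S s (\<lambda>x. snd (snd (covM S (snd (s x))))) \<psi> x)"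
proof -
  have "clifford S e0 \<psi> (s x) = q\<sigma> * qi * (vecq (fr_c s x) (fr_d s x) 0 0 * qhat (\<psi> (s x)))"
    unfolding clifford_def fr_coord_simps(1)[OF assms(1)] by (simp add: mult.assoc)
  then show ?thesis unfolding assms(2) fr_u_def[abs_def] fr_v_def[abs_def] by (simp add: right_diff_distrib mult.assoc)
qed

end

lemma tilde_twist: "tilde S \<phi> x = twist (coord S (e1 (base S x)) x) (\<phi> x)"
proof -
  have "clifford S e1 (bullet (plus_part \<phi>) qI) x =
      - (q\<sigma> * qi * coord S (e1 (base S x)) x * (q\<sigma> * qi * (qhat (plus_part \<phi> x) * qI)))"
    unfolding clifford_def bullet_def by (simp add: q_hom q_units_hat mult.assoc)
  then show ?thesis
    unfolding tilde_def twist_def tau_cancel by (simp add: plus_part_def mult.assoc)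
qed

lemma zero_T: "(\<lambda>_. 0) \<in> T p"
proof -
  obtain u v where "on_basis A g p u v" using metric unfolding lorentzian_metric_def by blast
  then show ?thesis using zero_tangent on_basisD(1) by blast
qed

lemma Qt_coord:
  assumes "x \<in> Qt S"
  obtains c d u v where "c * c - d * d = 1" "on_basis A g (base S x) u v"
    "\<forall>w t. coord S (w, t) x = vecq (c * fst w + d * snd w) (d * fst w + c * snd w) (- g (base S x) t u) (g (base S x) t v)"
proof -
  obtain c d where cd: "covE S (fst x) = (fst (covE S (fst x)), (c, - d), (- d, c))" "c * c - d * d = 1" by (rule covE_frame)
  obtain u v where uv: "covM S (snd x) = (fst (covM S (snd x)), u, v)" "on_basis A g (fst (covM S (snd x))) u v" by (rule covM_frame)
  show ?thesis
    by (rule that[OF cd(2), of u v]) (use uv(2) coord_vecq[OF cd(1) uv(1)] in \<open>simp_all add: base_def\<close>)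
qed

lemma coord_e1:
  assumes "x \<in> Qt S"
  obtains c d where "c * c - d * d = 1" "coord S (e1 y) x = vecq d c 0 0" "coord S (e0 y) x = vecq c d 0 0"
    "\<forall>t\<in>T (base S x). \<exists>a b. coord S (tang t y) x = vecq 0 0 a b \<and>
       (\<forall>t'\<in>T (base S x). \<exists>a' b'. coord S (tang t' y) x = vecq 0 0 a' b' \<and> - a * a' + b * b' = g (base S x) t t')"
proof -
  obtain c d u v where cd: "c * c - d * d = 1" "on_basis A g (base S x) u v"
    "\<forall>w t. coord S (w, t) x = vecq (c * fst w + d * snd w) (d * fst w + c * snd w) (- g (base S x) t u) (g (base S x) t v)"
    by (rule Qt_coord[OF assms])
  note b = on_basisD(1-6)[OF cd(2)]
  have m: "- (- g (base S x) t u) * (- g (base S x) t' u) + g (base S x) t v * g (base S x) t' v = g (base S x) t t'"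
    if t: "t \<in> T (base S x)" "t' \<in> T (base S x)" for t t'
  proof -
    have "g (base S x) t t' = g (base S x) (lincomb (- g (base S x) t u) u (g (base S x) t v) v) t'"
      using on_basis_expand[OF cd(2) t(1)] by simp
    then show ?thesis using t b by (simp add: g_lin g_sym[of _ "base S x" t'])
  qed
  have tc: "coord S (tang t y) x = vecq 0 0 (- g (base S x) t u) (g (base S x) t v)" for t
    unfolding tang_def using cd(3) by simp
  show ?thesis
  proof (rule that[OF cd(1)])
    show "coord S (e1 y) x = vecq d c 0 0" "coord S (e0 y) x = vecq c d 0 0"
      unfolding e0_def e1_def using cd(3) g_zero[OF b(1)] g_zero[OF b(2)] by simp_all
    show "\<forall>t\<in>T (base S x). \<exists>a b. coord S (tang t y) x = vecq 0 0 a b \<and>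
       (\<forall>t'\<in>T (base S x). \<exists>a' b'. coord S (tang t' y) x = vecq 0 0 a' b' \<and> - a * a' + b * b' = g (base S x) t t')"
      by (intro ballI exI conjI) (rule tc, rule tc, rule m)
  qed
qed

lemma tilde_spinor_field:
  assumes \<phi>: "spinor_field S \<phi>"
  shows "spinor_field S (tilde S \<phi>)"
  unfolding spinor_field_def
proof (intro conjI ballI allI impI)
  fix x assume x: "x \<in> Qt S"
  have y: "qtheta (\<phi> x) = \<phi> x" using \<phi> x unfolding spinor_field_def H0_iff by blast
  obtain c d where e: "coord S (e1 (base S x)) x = vecq d c 0 0" by (rule coord_e1[OF x])
  have p: "qtheta plusq = plusq" by (simp add: qtheta_hom qtheta_units)
  show "tilde S \<phi> x \<in> H0"
    unfolding H0_iff tilde_twist e twist_def by (simp only: qtheta_hom qtheta_units y p) simp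
next
  fix x assume "x \<in> Qt S"
  then obtain r q where x: "x = (r, q)" "(r, q) \<in> Qt S" by (cases x) auto
  have "spinE h * spinM k * tilde S \<phi> (actE S r h, actM S q k) = tilde S \<phi> (r, q)"
    if hk: "h \<in> spin11" "k \<in> spin11" for h k
  proof -
    let ?G = "spinE h * spinM k" and ?x' = "(actE S r h, actM S q k)" and ?X = "coord S (e1 (base S (r, q))) (r, q)"
    have \<phi>': "\<phi> (r, q) = ?G * \<phi> ?x'" by (rule spinor_act[OF \<phi> x(2) hk])
    have c: "coord S (e1 (base S ?x')) ?x' = qconj ?G * ?X * qhat ?G"
      unfolding act_Qt(2)[OF x(2) hk] e1_def by (rule coord_act[OF hk zero_T, symmetric])
    have "?G * tilde S \<phi> ?x' = plusq * (?G * \<phi> ?x') + (?G * qconj ?G) * ?X * qhat (plusq * (?G * \<phi> ?x')) * qI"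
    proof -
      have pc: "plusq * (?G * z) = ?G * (plusq * z)" for z by (metis plusq_central mult.assoc)
      show ?thesis
        unfolding tilde_twist twist_def c pc qhat_mult[of ?G] by (simp add: distrib_left mult.assoc)
    qed
    then show ?thesis unfolding spin_pair_inverse(2)[OF hk] tilde_twist twist_def \<phi>' by simp
  qed
  then show "case x of (r, q) \<Rightarrow> \<forall>h\<in>spin11. \<forall>k\<in>spin11. spinE h * spinM k * tilde S \<phi> (actE S r h, actM S q k) = tilde S \<phi> (r, q)"
    using x(1) by simp
next
  fix U s assume s: "spin_frame S U s"
  have y: "hsmooth_on A U (\<lambda>x. \<phi> (s x))" using \<phi> s unfolding spinor_field_def by blast
  note o = fr_open[OF s]
  have "hsmooth_on A U (\<lambda>x. twist (vecq (fr_d s x) (fr_c s x) 0 0) (\<phi> (s x)))"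
    unfolding twist_def vecq_def
    by (intro hsmooth_intros o y fr_smooth(1,2)[OF s] smooth_on_const)
  then show "hsmooth_on A U (\<lambda>x. tilde S \<phi> (s x))"
    by (rule hsmooth_on_cong) (simp add: tilde_twist fr_coord_simps[OF s])
qed

lemma tilde_cov_deriv:
  assumes \<phi>: "spinor_field S \<phi>" and s: "spin_frame S U s" and x: "x \<in> U" and X: "X x \<in> T x"
  shows "cov_deriv S s X (tilde S \<phi>) x = twist (vecq (fr_d s x) (fr_c s x) 0 0) (cov_deriv S s X \<phi> x)"
proof -
  let ?X = "\<lambda>x. vecq (fr_d s x) (fr_c s x) 0 0" and ?y = "\<lambda>x. \<phi> (s x)"
  note o = fr_open[OF s]
  have y: "hsmooth_on A U ?y" using \<phi> s unfolding spinor_field_def by blast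
  have Xs: "hsmooth_on A U ?X" unfolding vecq_def
    by (intro hsmooth_intros o fr_smooth(1,2)[OF s] smooth_on_const)
  have t: "tilde S \<phi> (s z) = twist (?X z) (?y z)" if "z \<in> U" for z
    using that by (simp add: tilde_twist fr_coord_simps[OF s])
  have const: "hsmooth_on A U (\<lambda>x. c)" for c by (rule hsmooth_on_const[OF o])
  have 1: "dH (X x) (\<lambda>z. plusq * ?y z) = plusq * dH (X x) ?y"
    by (simp add: dH_mult[OF X x const y] dH_const[OF X])
  have "dH (X x) (\<lambda>z. tilde S \<phi> (s z)) = dH (X x) (\<lambda>z. plusq * ?y z + ?X z * qhat (plusq * ?y z) * qI)"
    by (rule dH_local[OF X o x]) (simp add: t twist_def)
  also have "\<dots> = plusq * dH (X x) ?y + (dH (X x) ?X * qhat (plusq * ?y x) + ?X x * qhat (plusq * dH (X x) ?y)) * qI"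
    by (simp add: dH_add[OF X x] dH_mult[OF X x] dH_hat[OF X x] dH_const[OF X] hsmooth_intros o y Xs const 1)
  finally have d: "dH (X x) (\<lambda>z. tilde S \<phi> (s z)) = plusq * dH (X x) ?y +
     (dH (X x) ?X * qhat (plusq * ?y x) + ?X x * qhat (plusq * dH (X x) ?y)) * qI" .
  have dX: "dH (X x) ?X = spin_term (omegaE S s X x) (omegaM S s X x) * ?X x - ?X x * qhat (spin_term (omegaE S s X x) (omegaM S s X x))"
    unfolding spin_term_normal by (rule fr_normal_deriv[where X = X, OF s x X refl])
  show ?thesis
    unfolding cov_deriv_eq[OF s x] d t[OF x] by (rule twist_cov_deriv[OF dX])
qed

lemma tilde_dirac:
  assumes \<phi>: "spinor_field S \<phi>" "has_dirac S \<phi> (clifford S e0 \<phi>)"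
  shows "has_dirac S (tilde S \<phi>) (clifford S e0 (tilde S \<phi>))"
  unfolding has_dirac_def
proof (intro allI impI ballI)
  fix U s x assume s: "spin_frame S U s" and x: "x \<in> U"
  show "clifford S e0 (tilde S \<phi>) (s x) =
       - (q\<sigma> * qi * (qi * qJ) * qhat (cov_deriv S s (\<lambda>x. fst (snd (covM S (snd (s x))))) (tilde S \<phi>) x))
       + q\<sigma> * qi * qK * qhat (cov_deriv S s (\<lambda>x. snd (snd (covM S (snd (s x))))) (tilde S \<phi>) x)"
  proof (rule fr_diracI[OF s x])
    have t: "tilde S \<phi> (s x) = twist (vecq (fr_d s x) (fr_c s x) 0 0) (\<phi> (s x))"
      by (simp add: tilde_twist fr_coord_simps[OF s x])
    show "vecq (fr_c s x) (fr_d s x) 0 0 * qhat (tilde S \<phi> (s x)) =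
      qK * qhat (cov_deriv S s (fr_v s) (tilde S \<phi>) x) - qi * qJ * qhat (cov_deriv S s (fr_u s) (tilde S \<phi>) x)"
      unfolding t tilde_cov_deriv[where X = "fr_u s", OF \<phi>(1) s x fr_tangent(1)[OF s x]]
        tilde_cov_deriv[where X = "fr_v s", OF \<phi>(1) s x fr_tangent(2)[OF s x]]
      by (rule twist_dirac[OF fr_dirac[OF s \<phi>(2) x] normal_exchange])
  qed
qed

lemma tilde_unit:
  assumes "qH (\<phi> x) (\<phi> x) = 1" "x \<in> Qt S"
  shows "qH (tilde S \<phi> x) (tilde S \<phi> x) = 1"
proof -
  obtain c d where cd: "c * c - d * d = 1" and e: "coord S (e1 (base S x)) x = vecq d c 0 0" by (rule coord_e1[OF assms(2)])
  have "qH (vecq d c 0 0) (vecq d c 0 0) = 1"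
    unfolding qH_vecq using cd by (simp add: lreal_def one_lorc_def algebra_simps)
  then show ?thesis unfolding tilde_twist e by (rule twist_unit[OF assms(1)])
qed

lemma tilde_eigen:
  assumes "x \<in> Qt S"
  shows "clifford S e1 (tilde S \<phi>) x = - bullet (tilde S \<phi>) qI x"
proof -
  obtain c d where cd: "c * c - d * d = 1" and e: "coord S (e1 (base S x)) x = vecq d c 0 0" by (rule coord_e1[OF assms])
  show ?thesis
    unfolding clifford_def bullet_def tilde_twist e
    using twist_eigen[OF vecq_hat_inverse[OF cd], of "\<phi> x"] by (simp add: mult.assoc)
qed

end

section \<open>The immersion into three-dimensional Minkowski space\<close>

text \<open>The form of the product is respected by \<open>qtheta\<close> and by the composition of hat and
  conjugation, and these change the sign of the vector in the middle.\<close>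

lemma image_R22:
  assumes "qtheta y = y"
  shows "qtheta (- (qconj y * vecq a b c d * qhat y)) = - (- (qconj y * vecq a b c d * qhat y))"
    "qhat (qconj (- (qconj y * vecq a b c d * qhat y))) = - (- (qconj y * vecq a b c d * qhat y))"
proof -
  show "qtheta (- (qconj y * vecq a b c d * qhat y)) = - (- (qconj y * vecq a b c d * qhat y))"
    by (simp add: qtheta_hom qtheta_units assms)
  have "qhat (qconj (qconj y * vecq a b c d * qhat y)) = qconj y * qhat (qconj (vecq a b c d)) * qhat y"
    by (simp add: q_hom mult.assoc)
  then show "qhat (qconj (- (qconj y * vecq a b c d * qhat y))) = - (- (qconj y * vecq a b c d * qhat y))"
    unfolding vecq_star by (simp add: q_hom)
qed

lemma image_qH:
  assumes "qH y y = 1"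
  shows "qH (- (qconj y * X * qhat y)) (- (qconj y * Z * qhat y)) = qH X Z"
proof -
  have "lhat 1 = 1" by (simp add: lhat_def one_lorc_def)
  then show ?thesis unfolding qH_uminus qH_mult_right qH_mult_left qH_qconj qH_qhat assms by simp
qed

text \<open>The Dirac equation will make \<open>xi\<close> closed and determine the mean curvature; the condition
  \<open>eigen\<close> puts the integral of \<open>xi\<close> into \<open>R12\<close>.\<close>

locale dirac_spinor = lorentzian_surface S
  for S :: "('m::{t2_space, second_countable_topology}, 'e::topological_space, 'q::topological_space) spin_surface" +
  fixes \<psi> :: "('e, 'q) spinor"
  assumes spinor: "spinor_field S \<psi>"
    and dirac: "has_dirac S \<psi> (clifford S e0 \<psi>)"
    and unit: "x \<in> Qt S \<Longrightarrow> qH (\<psi> x) (\<psi> x) = 1"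
    and eigen: "x \<in> Qt S \<Longrightarrow> clifford S e1 \<psi> x = - bullet \<psi> qI x"
begin

lemma omegaM_frame: "omegaM S s X p = g p (nabla S X (fr_u s) p) (fr_v s p)"
proof -
  have "fr_u s = (\<lambda>x. fst (snd (covM S (snd (s x)))))" by (rule ext) (rule fr_u_def)
  then show ?thesis unfolding omegaM_def Let_def fr_v_def by simp
qed

text \<open>An arbitrary spin frame at each point. Values of the pairing are the same for all of them.\<close>

definition lift :: "'m \<Rightarrow> 'e \<times> 'q" where "lift p = (SOME x. x \<in> Qt S \<and> base S x = p)"

lemma lift: "lift p \<in> Qt S" "base S (lift p) = p"
proof -
  have "\<exists>x. x \<in> Qt S \<and> base S x = p" using Qt_fibre[of p] by blast
  from someI_ex[OF this] show "lift p \<in> Qt S" "base S (lift p) = p" by (simp_all add: lift_def)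
qed

definition xi :: "'m \<Rightarrow> 'm tvec \<Rightarrow> hquat" where
  "xi p t = pairing (clifford S (tang t) \<psi>) \<psi> (lift p)"

definition normal :: "'m \<Rightarrow> hquat" where
  "normal p = pairing (clifford S e0 \<psi>) \<psi> (lift p)"

lemma xi_eq:
  assumes "x \<in> Qt S" "t \<in> T (base S x)"
  shows "xi (base S x) t = pairing (clifford S (tang t) \<psi>) \<psi> x"
  unfolding xi_def
  by (rule pairing_well_defined[OF spinor lift(1) assms(1)]) (use lift(2) assms(2) in \<open>simp_all add: tang_def\<close>)

lemma normal_eq:
  assumes "x \<in> Qt S"
  shows "normal (base S x) = pairing (clifford S e0 \<psi>) \<psi> x"
  unfolding normal_def
  by (rule pairing_well_defined[OF spinor lift(1) assms(1)]) (use lift(2) zero_T in \<open>simp_all add: e0_def\<close>)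

lemma theta: "x \<in> Qt S \<Longrightarrow> qtheta (\<psi> x) = \<psi> x"
  using spinor unfolding spinor_field_def H0_iff by blast

lemma e1_image:
  assumes x: "x \<in> Qt S" shows "- (qconj (\<psi> x) * coord S (e1 (base S x)) x * qhat (\<psi> x)) = qI"
proof -
  have "q\<sigma> * qi * (coord S (e1 (base S x)) x * qhat (\<psi> x)) = q\<sigma> * qi * (- (\<psi> x * qI))"
    using eigen[OF x] unfolding clifford_def bullet_def by (simp add: mult.assoc)
  then have 1: "coord S (e1 (base S x)) x * qhat (\<psi> x) = - (\<psi> x * qI)" unfolding tau_inj .
  have "qconj (\<psi> x) * (\<psi> x * qI) = qI"
    using mult_qconj(2)[of "\<psi> x"] unit[OF x] by (simp add: qscal_1 flip: mult.assoc)
  then show ?thesis unfolding mult.assoc 1 by simp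
qed

lemma image_R12:
  assumes x: "x \<in> Qt S" and perp: "qH (vecq a0 a1 a2 a3) (coord S (e1 (base S x)) x) = 0"
  shows "\<exists>a b c. - (qconj (\<psi> x) * vecq a0 a1 a2 a3 * qhat (\<psi> x)) = vecq a 0 b c"
proof -
  obtain x0 x1 x2 x3 where v: "- (qconj (\<psi> x) * vecq a0 a1 a2 a3 * qhat (\<psi> x)) = vecq x0 x1 x2 x3"
    using R22I[OF image_R22[OF theta[OF x], of a0 a1 a2 a3]] by blast
  have "lreal x1 = qH (vecq x0 x1 x2 x3) qI" unfolding qH_vecq_qI ..
  also have "\<dots> = 0" unfolding v[symmetric] e1_image[OF x, symmetric] image_qH[OF unit[OF x]] by (rule perp)
  finally have "x1 = 0" by (simp add: lreal_def zero_lorc_def)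
  then show ?thesis using v by blast
qed

text \<open>The map \<open>X \<mapsto> \<langle>\<langle>X \<cdot> \<psi>, \<psi>\<rangle>\<rangle>\<close> preserves the inner product and takes \<open>e\<^sub>1\<close> to \<open>I\<close> (\<open>e1_image\<close>).
  So the images of tangent vectors are orthogonal to \<open>I\<close> and to the image of \<open>e\<^sub>0\<close>.\<close>

lemma xi_properties:
  assumes "t \<in> T p"
  shows "\<exists>a b c. xi p t = vecq a 0 b c"
    and "t' \<in> T p \<Longrightarrow> qH (xi p t) (xi p t') = lreal (g p t t')"
    and "qH (xi p t) (normal p) = 0"
proof -
  let ?x = "lift p"
  note x = lift[of p]
  obtain c d where cd: "c * c - d * d = 1" "coord S (e1 p) ?x = vecq d c 0 0" "coord S (e0 p) ?x = vecq c d 0 0"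
    "\<forall>t\<in>T (base S ?x). \<exists>a b. coord S (tang t p) ?x = vecq 0 0 a b \<and>
       (\<forall>t'\<in>T (base S ?x). \<exists>a' b'. coord S (tang t' p) ?x = vecq 0 0 a' b' \<and> - a * a' + b * b' = g (base S ?x) t t')"
    by (rule coord_e1[OF x(1)])
  obtain a b where ab: "coord S (tang t p) ?x = vecq 0 0 a b"
      "\<And>t'. t'\<in>T p \<Longrightarrow> \<exists>a' b'. coord S (tang t' p) ?x = vecq 0 0 a' b' \<and> - a * a' + b * b' = g p t t'"
    using cd(4) assms unfolding x(2) by blast
  have xi: "xi p t = - (qconj (\<psi> ?x) * vecq 0 0 a b * qhat (\<psi> ?x))"
    unfolding xi_def pairing_clifford x(2) ab(1) ..
  have n: "normal p = - (qconj (\<psi> ?x) * vecq c d 0 0 * qhat (\<psi> ?x))"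
    unfolding normal_def pairing_clifford x(2) cd(3) ..
  show "qH (xi p t) (normal p) = 0"
    unfolding xi n image_qH[OF unit[OF x(1)]] qH_vecq by (simp add: lreal_def zero_lorc_def)
  show "\<exists>a b c. xi p t = vecq a 0 b c"
    unfolding xi using image_R12[OF x(1), unfolded x(2) cd(2), of 0 0 a b] by (simp add: qH_vecq lreal_def zero_lorc_def)
  show "qH (xi p t) (xi p t') = lreal (g p t t')" if "t' \<in> T p"
  proof -
    obtain a' b' where ab': "coord S (tang t' p) ?x = vecq 0 0 a' b'" "- a * a' + b * b' = g p t t'"
      using ab(2)[OF \<open>t' \<in> T p\<close>] by blast
    have "xi p t' = - (qconj (\<psi> ?x) * vecq 0 0 a' b' * qhat (\<psi> ?x))"
      unfolding xi_def pairing_clifford x(2) ab'(1) ..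
    then show ?thesis unfolding xi using image_qH[OF unit[OF x(1)]] ab'(2) by (simp add: qH_vecq)
  qed
qed

lemma normal_properties: "\<exists>a b c. normal p = vecq a 0 b c" "qH (normal p) (normal p) = - 1"
proof -
  let ?x = "lift p"
  note x = lift[of p]
  obtain c d where cd: "c * c - d * d = 1" "coord S (e1 p) ?x = vecq d c 0 0" "coord S (e0 p) ?x = vecq c d 0 0"
    by (rule coord_e1[OF x(1)])
  have n: "normal p = - (qconj (\<psi> ?x) * vecq c d 0 0 * qhat (\<psi> ?x))"
    unfolding normal_def pairing_clifford x(2) cd(3) ..
  have "- (c * c) + d * d = - 1" using cd(1) by simp
  then show "qH (normal p) (normal p) = - 1"
    unfolding n image_qH[OF unit[OF x(1)]] qH_vecq by (simp add: lreal_def uminus_lorc_def one_lorc_def)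
  show "\<exists>a b c. normal p = vecq a 0 b c"
    unfolding n using image_R12[OF x(1), unfolded x(2) cd(2), of c d 0 0]
    by (simp add: qH_vecq lreal_def zero_lorc_def mult.commute)
qed

lemma xi_linear:
  assumes t: "t \<in> T p" "t' \<in> T p"
  shows "xi p (lincomb a t b t') = qreal a * xi p t + qreal b * xi p t'"
proof -
  let ?x = "lift p"
  obtain c d u v where cd: "on_basis A g (base S ?x) u v"
    "\<forall>w t. coord S (w, t) ?x = vecq (c * fst w + d * snd w) (d * fst w + c * snd w) (- g (base S ?x) t u) (g (base S ?x) t v)"
    using Qt_coord[OF lift(1)] by metis
  note bs = on_basisD(1,2)[OF cd(1), unfolded lift(2)]
  have "coord S (tang (lincomb a t b t') p) ?x = qreal a * coord S (tang t p) ?x + qreal b * coord S (tang t' p) ?x"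
    unfolding tang_def using cd(2) bs by (simp add: lift(2) vecq_lin g_lin t algebra_simps)
  moreover have "qconj y * (qreal a * X + qreal b * Z) * w = qreal a * (qconj y * X * w) + qreal b * (qconj y * Z * w)" for y X Z w
  proof -
    have 1: "qconj y * (qreal r * X) = qreal r * (qconj y * X)" for r X by (metis q_central(3) mult.assoc)
    show ?thesis by (simp add: distrib_left distrib_right mult.assoc 1[unfolded mult.assoc])
  qed
  ultimately show ?thesis
    unfolding xi_def pairing_clifford lift(2) by simp
qed

context
  fixes U s assumes s: "spin_frame S U s"
begin

lemma xi_frame:
  assumes "x \<in> U"
  shows "xi x (fr_u s x) = - (qconj (\<psi> (s x)) * (qi * qJ) * qhat (\<psi> (s x)))"
    "xi x (fr_v s x) = - (qconj (\<psi> (s x)) * qK * qhat (\<psi> (s x)))"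
    "normal x = - (qconj (\<psi> (s x)) * vecq (fr_c s x) (fr_d s x) 0 0 * qhat (\<psi> (s x)))"
  using xi_eq[OF fr_Qt(1)[OF s assms]] normal_eq[OF fr_Qt(1)[OF s assms]] fr_tangent[OF s assms]
  unfolding fr_Qt(2)[OF s assms] pairing_clifford
  by (simp_all add: fr_coord_uv[OF s assms] fr_coord_simps(1)[OF s assms])

lemma psi_smooth: "hsmooth_on A U (\<lambda>x. \<psi> (s x))"
  using spinor s unfolding spinor_field_def by blast

lemma xi_smooth:
  "hsmooth_on A U (\<lambda>x. xi x (fr_u s x))" "hsmooth_on A U (\<lambda>x. xi x (fr_v s x))" "hsmooth_on A U normal"
proof -
  note o = fr_open[OF s] and y = psi_smooth
  have 1: "hsmooth_on A U (\<lambda>x. - (qconj (\<psi> (s x)) * Z * qhat (\<psi> (s x))))" for Z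
    by (intro hsmooth_intros o y)
  show "hsmooth_on A U (\<lambda>x. xi x (fr_u s x))" by (rule hsmooth_on_cong[OF 1]) (simp add: xi_frame)
  show "hsmooth_on A U (\<lambda>x. xi x (fr_v s x))" by (rule hsmooth_on_cong[OF 1]) (simp add: xi_frame)
  have "hsmooth_on A U (\<lambda>x. - (qconj (\<psi> (s x)) * vecq (fr_c s x) (fr_d s x) 0 0 * qhat (\<psi> (s x))))"
    unfolding vecq_def by (intro hsmooth_intros o y fr_smooth(1,2)[OF s] smooth_on_const)
  then show "hsmooth_on A U normal" by (rule hsmooth_on_cong) (simp add: xi_frame)
qed

text \<open>The Leibniz rule, with the connection term of the spinor derivative moved into the
  coefficient of the other frame vector by \<open>frame_deriv\<close>.\<close>

lemma xi_deriv:
  assumes x: "x \<in> U" and X: "X x \<in> T x"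
  shows "dH (X x) (\<lambda>x. xi x (fr_v s x)) = qreal (omegaM S s X x) * xi x (fr_u s x) -
      (qconj (cov_deriv S s X \<psi> x) * qK * qhat (\<psi> (s x)) + qconj (\<psi> (s x)) * qK * qhat (cov_deriv S s X \<psi> x))" (is ?dv)
    "dH (X x) (\<lambda>x. xi x (fr_u s x)) = qreal (omegaM S s X x) * xi x (fr_v s x) -
      (qconj (cov_deriv S s X \<psi> x) * (qi * qJ) * qhat (\<psi> (s x)) + qconj (\<psi> (s x)) * (qi * qJ) * qhat (cov_deriv S s X \<psi> x))" (is ?du)
proof -
  note o = fr_open[OF s] and y = psi_smooth
  have const: "hsmooth_on A U (\<lambda>x. c)" for c by (rule hsmooth_on_const[OF o])
  have d: "dH (X x) (\<lambda>x. - (qconj (\<psi> (s x)) * Z * qhat (\<psi> (s x)))) =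
     - (qconj (dH (X x) (\<lambda>x. \<psi> (s x))) * Z * qhat (\<psi> (s x)) + qconj (\<psi> (s x)) * Z * qhat (dH (X x) (\<lambda>x. \<psi> (s x))))" for Z
    by (simp add: dH_uminus[OF X x] dH_mult[OF X x] dH_hat[OF X x] dH_conj[OF X x] dH_const[OF X] hsmooth_intros o y const)
  have P: "dH (X x) (\<lambda>x. \<psi> (s x)) = cov_deriv S s X \<psi> x + spin_term (omegaE S s X x) (omegaM S s X x) * \<psi> (s x)"
    unfolding cov_deriv_eq[OF s x] by simp
  have "dH (X x) (\<lambda>x. xi x (fr_v s x)) = dH (X x) (\<lambda>x. - (qconj (\<psi> (s x)) * qK * qhat (\<psi> (s x))))"
    by (rule dH_local[OF X o x]) (simp add: xi_frame)
  then show ?dv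
    unfolding d P frame_deriv xi_frame[OF x] by simp
  have "dH (X x) (\<lambda>x. xi x (fr_u s x)) = dH (X x) (\<lambda>x. - (qconj (\<psi> (s x)) * (qi * qJ) * qhat (\<psi> (s x))))"
    by (rule dH_local[OF X o x]) (simp add: xi_frame)
  then show ?du
    unfolding d P frame_deriv xi_frame[OF x] by simp
qed

lemma xi_closed:
  assumes x: "x \<in> U"
  shows "dH (fr_u s x) (\<lambda>x. xi x (fr_v s x)) - dH (fr_v s x) (\<lambda>x. xi x (fr_u s x)) =
    qreal (omegaM S s (fr_u s) x) * xi x (fr_u s x) - qreal (omegaM S s (fr_v s) x) * xi x (fr_v s x)"
proof -
  have c: "vecq a b 0 0 * qI = qI * vecq a b 0 0" for a b unfolding vecq_def by (simp add: hquat_defs)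
  show ?thesis
    unfolding xi_deriv(1)[where X = "fr_u s", OF x fr_tangent(1)[OF s x]] xi_deriv(2)[where X = "fr_v s", OF x fr_tangent(2)[OF s x]]
      dirac_closed[OF fr_dirac[OF s dirac x] vecq_star c] by simp
qed

text \<open>The left side is twice the mean curvature vector of an integral of \<open>xi\<close>: by
  \<open>frame_connection\<close>, the subtracted terms are the values of \<open>xi\<close> on the covariant derivatives
  of the frame.\<close>

lemma xi_trace:
  assumes x: "x \<in> U"
  shows "- (dH (fr_u s x) (\<lambda>x. xi x (fr_u s x)) - qreal (omegaM S s (fr_u s) x) * xi x (fr_v s x)) +
    (dH (fr_v s x) (\<lambda>x. xi x (fr_v s x)) - qreal (omegaM S s (fr_v s) x) * xi x (fr_u s x)) = qreal 2 * normal x"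
  unfolding xi_deriv(2)[where X = "fr_u s", OF x fr_tangent(1)[OF s x]] xi_deriv(1)[where X = "fr_v s", OF x fr_tangent(2)[OF s x]]
  using dirac_trace[OF fr_dirac[OF s dirac x] vecq_star] by (simp add: xi_frame[OF x] algebra_simps)

end

text \<open>Applied to the real-valued components of \<open>xi\<close>, because gluing was done for real-valued
  potentials.\<close>

lemma xi_component_closed:
  assumes \<kappa>: "\<And>x y. \<kappa> (x + y) = \<kappa> x + \<kappa> y" "\<And>a x. \<kappa> (qreal a * x) = a * \<kappa> x"
    "\<And>(v :: 'm tvec) F. \<kappa> (dH v F) = v (\<lambda>x. \<kappa> (F x))" "\<And>U F. hsmooth_on A U F \<Longrightarrow> smooth_on A U (\<lambda>x. \<kappa> (F x))"
  shows "closed_form (\<lambda>p t. \<kappa> (xi p t))"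
  unfolding closed_form_def
proof (intro conjI allI ballI)
  fix p a b u v assume "u \<in> T p" "v \<in> T p"
  then show "\<kappa> (xi p (lincomb a u b v)) = a * \<kappa> (xi p u) + b * \<kappa> (xi p v)"
    by (simp add: xi_linear \<kappa>(1,2))
next
  fix p
  obtain W s where W: "p \<in> W" "spin_frame S W s" using spin_frame_exists by blast
  let ?u = "fr_u s" and ?v = "fr_v s"
  let ?\<alpha> = "omegaM S s ?u" and ?\<beta> = "\<lambda>x. - omegaM S s ?v x"
  note sm = fr_smooth(3,4)[OF W(2)]
  have \<kappa>d: "\<kappa> (x - y) = \<kappa> x - \<kappa> y" for x y
    using \<kappa>(1)[of "x - y" y] by simp
  have "T q = {lincomb a (?u q) b (?v q) | a b. True} \<and>
           lie_bracket A ?u ?v q = lincomb (?\<alpha> q) (?u q) (?\<beta> q) (?v q) \<and>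
           ?u q (\<lambda>x. \<kappa> (xi x (?v x))) - ?v q (\<lambda>x. \<kappa> (xi x (?u x))) = ?\<alpha> q * \<kappa> (xi q (?u q)) + ?\<beta> q * \<kappa> (xi q (?v q))"
    if q: "q \<in> W" for q
  proof (intro conjI)
    show "T q = {lincomb a (?u q) b (?v q) | a b. True}" by (rule on_basisD(7)[OF fr_basis[OF W(2) q]])
    show "lie_bracket A ?u ?v q = lincomb (?\<alpha> q) (?u q) (?\<beta> q) (?v q)"
      using frame_bracket[OF sm fr_basis[OF W(2)] q] by (simp add: omegaM_frame)
    show "?u q (\<lambda>x. \<kappa> (xi x (?v x))) - ?v q (\<lambda>x. \<kappa> (xi x (?u x))) = ?\<alpha> q * \<kappa> (xi q (?u q)) + ?\<beta> q * \<kappa> (xi q (?v q))"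
      using arg_cong[OF xi_closed[OF W(2) q], of \<kappa>] by (simp add: \<kappa>d \<kappa>(2,3))
  qed
  then have "closed_in_frame (\<lambda>p t. \<kappa> (xi p t)) W ?u ?v ?\<alpha> ?\<beta>"
    unfolding closed_in_frame_def
    by (intro conjI sm \<kappa>(4)[OF xi_smooth(1)[OF W(2)]] \<kappa>(4)[OF xi_smooth(2)[OF W(2)]]) (rule ballI)
  then show "\<exists>U u v \<alpha> \<beta>. p \<in> U \<and> closed_in_frame (\<lambda>p t. \<kappa> (xi p t)) U u v \<alpha> \<beta>"
    using W(1) by blast
qed

lemma xi_primitive:
  assumes "simply_connected (UNIV :: 'm set)"
  shows "\<exists>G. hsmooth_on A UNIV G \<and> range G \<subseteq> R12 \<and> (\<forall>p. \<forall>t\<in>T p. dH t G = xi p t)"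
proof -
  let ?k0 = "\<lambda>x. Im (sg (q0 x))" and ?k2 = "\<lambda>x. Im (sc (q2 x))" and ?k3 = "\<lambda>x. Re (sc (q3 x))"
  note d = dH_def dL_def dC_def hsmooth_on_def hquat_defs
  obtain G0 where G0: "smooth_on A UNIV G0" "\<And>p t. t \<in> T p \<Longrightarrow> t G0 = ?k0 (xi p t)"
    using closed_form_exact[OF assms xi_component_closed[of ?k0]] by (auto simp: d)
  obtain G2 where G2: "smooth_on A UNIV G2" "\<And>p t. t \<in> T p \<Longrightarrow> t G2 = ?k2 (xi p t)"
    using closed_form_exact[OF assms xi_component_closed[of ?k2]] by (auto simp: d)
  obtain G3 where G3: "smooth_on A UNIV G3" "\<And>p t. t \<in> T p \<Longrightarrow> t G3 = ?k3 (xi p t)"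
    using closed_form_exact[OF assms xi_component_closed[of ?k3]] by (auto simp: d)
  \<comment> \<open>the second component of \<open>xi\<close> vanishes, so that 0 is an integral of it\<close>
  define G where "G x = vecq (G0 x) 0 (G2 x) (G3 x)" for x
  have "hsmooth_on A UNIV G"
    unfolding G_def[abs_def] vecq_def by (intro hsmooth_intros open_UNIV G0 G2 G3 smooth_on_const)
  moreover have "range G \<subseteq> R12"
    unfolding R12_def G_def using vecq_R22 by (auto simp: qH_vecq_qI lreal_def zero_lorc_def)
  moreover have "dH t G = xi p t" if t: "t \<in> T p" for p t
  proof -
    have "dH t G = vecq (t G0) 0 (t G2) (t G3)"
      unfolding G_def[abs_def] vecq_def
      by (simp add: dH_def dL_def dC_def hquat_defs tv_const[OF t] complex_eq_iff)
    moreover obtain a b c where v: "xi p t = vecq a 0 b c" using xi_properties(1)[OF t] by blast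
    have "?k0 (xi p t) = a" "?k2 (xi p t) = b" "?k3 (xi p t) = c"
      unfolding v vecq_def by (simp_all add: hquat_defs)
    ultimately show ?thesis using G0(2)[OF t] G2(2)[OF t] G3(2)[OF t] v by simp
  qed
  ultimately show ?thesis by blast
qed

text \<open>The mean curvature vector is computed for a given frame field by lifting it to a spin frame
  near the point; the lifted frame agrees with the given one only there, whence the use of
  \<open>frame_connection_local\<close>.\<close>

lemma induced_immersion:
  assumes G: "hsmooth_on A UNIV G" "range G \<subseteq> R12" "\<And>p t. t \<in> T p \<Longrightarrow> dH t G = xi p t"
  shows "induced_by S \<psi> G" "isometric_immersion S G R12" "normal_image S \<psi> e0 normal"
    "has_mean_curvature_R12 S G normal (\<lambda>_. 1)"
proof -
  show "induced_by S \<psi> G"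
    unfolding induced_by_def using G(1,2) G(3) xi_eq by (auto simp: R12_def)
  show "normal_image S \<psi> e0 normal"
    unfolding normal_image_def using normal_eq by blast
  have inj: "inj_on (\<lambda>v. dH v G) (T p)" for p
  proof (rule inj_onI)
    fix t t' assume t: "t \<in> T p" "t' \<in> T p" "dH t G = dH t' G"
    obtain u v where uv: "on_basis A g p u v" using metric unfolding lorentzian_metric_def by blast
    have "lreal (g p t w) = lreal (g p t' w)" if "w \<in> T p" for w
      using xi_properties(2)[OF t(1) that] xi_properties(2)[OF t(2) that] t(3) G(3)[OF t(1)] G(3)[OF t(2)] by simp
    then have "g p t w = g p t' w" if "w \<in> T p" for w using that by (simp add: lreal_def)
    then show "t = t'"
      using on_basis_expand[OF uv t(1)] on_basis_expand[OF uv t(2)] on_basisD(1,2)[OF uv] by simp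
  qed
  show "isometric_immersion S G R12"
    unfolding isometric_immersion_def using G inj xi_properties(2) by simp
  have n: "hsmooth_on A UNIV normal"
  proof (rule hsmooth_on_local)
    fix p show "\<exists>W. p \<in> W \<and> hsmooth_on A W normal"
      using spin_frame_exists[of p] xi_smooth(3) by blast
  qed simp
  have "unit_timelike_normal_R12 S G normal"
    unfolding unit_timelike_normal_R12_def
  proof (intro conjI n allI ballI)
    show "range normal \<subseteq> R12"
    proof (rule image_subsetI)
      fix p
      obtain a b c where v: "normal p = vecq a 0 b c" using normal_properties(1) by blast
      show "normal p \<in> R12" unfolding R12_def v using vecq_R22 by (simp add: qH_vecq_qI lreal_def zero_lorc_def)
    qed
    show "qH (normal p) (normal p) = - 1" for p by (rule normal_properties(2))
    show "qH (dH v G) (normal p) = 0" if "v \<in> T p" for p v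
      unfolding G(3)[OF that] by (rule xi_properties(3)[OF that])
  qed
  moreover have "has_mean_curvature_vector S G (\<lambda>p. qreal 1 * normal p)"
    unfolding has_mean_curvature_vector_def
  proof (intro allI impI ballI)
    fix U e p assume e: "frame_fieldM A (framesM S) U e" and p: "p \<in> U"
    define u v where "u x = fst (snd (e x))" and "v x = snd (snd (e x))" for x
    obtain W s where W: "p \<in> W" "W \<subseteq> U" "spin_frame S W s" "\<And>x. x \<in> W \<Longrightarrow> covM S (snd (s x)) = e x"
      using spin_frame_lift[OF e p] by blast
    have eq: "u x = fr_u s x" "v x = fr_v s x" if "x \<in> W" for x
      using W(4)[OF that] by (simp_all add: u_def v_def fr_u_def fr_v_def)
    note o = fr_open[OF W(3)]
    have uv: "smooth_vf A U u" "smooth_vf A U v"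
      using e unfolding frame_fieldM_def u_def[abs_def] v_def[abs_def] by blast+
    have bs: "on_basis A g x (u x) (v x)" if "x \<in> W" for x
      using fr_basis[OF W(3) that] eq[OF that] by simp
    note uvW = smooth_vf_subset[OF uv(1) o W(2)] smooth_vf_subset[OF uv(2) o W(2)]
    note T = on_basisD(1,2)[OF bs[OF W(1)]]
    have om: "omegaM S s (fr_u s) p = g p (nabla S u u p) (v p)" "omegaM S s (fr_v s) p = g p (nabla S v u p) (v p)"
      using frame_connection_local[OF fr_smooth(3,4)[OF W(3)] fr_basis[OF W(3)] W(1) eq]
      by (simp_all add: omegaM_frame)
    have dG: "dH (w p) (\<lambda>x. dH (z x) G) = dH (w p) (\<lambda>x. xi x (z' x))"
      if "w p \<in> T p" "\<And>x. x \<in> W \<Longrightarrow> z x = z' x" "\<And>x. x \<in> W \<Longrightarrow> z x \<in> T x" for w z z'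
      by (rule dH_local[OF that(1) o W(1)]) (use that(2,3) G(3) in simp)
    have dL: "dH (lincomb a (u p) b (v p)) G = qreal a * xi p (u p) + qreal b * xi p (v p)" for a b
      unfolding dH_lincomb G(3)[OF T(1)] G(3)[OF T(2)] ..
    have dN: "dH (nabla S u u p) G = qreal (g p (nabla S u u p) (v p)) * xi p (v p)"
      using arg_cong[OF frame_connection(1)[OF uvW bs uvW(1) W(1)], of "\<lambda>t. dH t G"] unfolding dL by (simp add: qreal_hom)
    have dN': "dH (nabla S v v p) G = qreal (g p (nabla S v u p) (v p)) * xi p (u p)"
      using arg_cong[OF frame_connection(2)[OF uvW bs uvW(2) W(1)], of "\<lambda>t. dH t G"] unfolding dL by (simp add: qreal_hom)
    have sff: "second_ff S G u u p = dH (fr_u s p) (\<lambda>x. xi x (fr_u s x)) - qreal (omegaM S s (fr_u s) p) * xi p (fr_v s p)"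
      "second_ff S G v v p = dH (fr_v s p) (\<lambda>x. xi x (fr_v s x)) - qreal (omegaM S s (fr_v s) p) * xi p (fr_u s p)"
      unfolding second_ff_def dN dN' om
      using dG[where w = u and z = u and z' = "fr_u s", OF T(1)] dG[where w = v and z = v and z' = "fr_v s", OF T(2)] eq on_basisD(1,2)[OF bs] W(1)
      by (simp_all add: qreal_hom)
    have h: "qreal (1/2) * (qreal 2 * z) = z" for z
      by (simp add: qreal_hom(6) flip: mult.assoc qreal_hom(2))
    show "qreal 1 * normal p = qreal (1/2) *
          (- second_ff S G (\<lambda>x. fst (snd (e x))) (\<lambda>x. fst (snd (e x))) p
           + second_ff S G (\<lambda>x. snd (snd (e x))) (\<lambda>x. snd (snd (e x))) p)"
      using xi_trace[OF W(3,1)] unfolding u_def[abs_def, symmetric] v_def[abs_def, symmetric] sff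
      by (simp add: h qreal_hom(6))
  qed
  ultimately show "has_mean_curvature_R12 S G normal (\<lambda>_. 1)"
    unfolding has_mean_curvature_R12_def by blast
qed

end

theorem mainTheorem6:
  fixes S :: "('m::{t2_space, second_countable_topology}, 'e::topological_space, 'q::topological_space) spin_surface"
    and F :: "'m \<Rightarrow> hquat"
    and \<phi> :: "('e, 'q) spinor"
  assumes surface: "lorentzian_spin_surface S" "simply_connected (UNIV :: 'm set)"
    and minimal: "minimal_in_H21 S F"
    and spinor: "spinor_field S \<phi>"
    and represented: "induced_by S \<phi> F" "normal_image S \<phi> e0 F"
    and dirac: "has_dirac S \<phi> (clifford S e0 \<phi>)"
    and unit: "\<forall>x\<in>Qt S. qH (\<phi> x) (\<phi> x) = 1"
  shows "spinor_field S (tilde S \<phi>)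
    \<and> has_dirac S (tilde S \<phi>) (clifford S e0 (tilde S \<phi>))
    \<and> (\<forall>x\<in>Qt S. qH (tilde S \<phi> x) (tilde S \<phi> x) = 1)
    \<and> (\<forall>x\<in>Qt S. clifford S e1 (tilde S \<phi>) x = - bullet (tilde S \<phi>) qI x)
    \<and> (\<exists>G N. induced_by S (tilde S \<phi>) G
          \<and> isometric_immersion S G R12
          \<and> normal_image S (tilde S \<phi>) e0 N
          \<and> has_mean_curvature_R12 S G N (\<lambda>_. 1))"
proof -
  interpret lorentzian_surface S by unfold_locales (rule surface)
  have tilde: "spinor_field S (tilde S \<phi>)" "has_dirac S (tilde S \<phi>) (clifford S e0 (tilde S \<phi>))"
    "\<And>x. x \<in> Qt S \<Longrightarrow> qH (tilde S \<phi> x) (tilde S \<phi> x) = 1"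
    "\<And>x. x \<in> Qt S \<Longrightarrow> clifford S e1 (tilde S \<phi>) x = - bullet (tilde S \<phi>) qI x"
    using tilde_spinor_field[OF spinor] tilde_dirac[OF spinor dirac] tilde_unit tilde_eigen unit by blast+
  interpret dirac_spinor S "tilde S \<phi>" by unfold_locales (rule tilde; assumption?)+
  obtain G where G: "hsmooth_on A UNIV G" "range G \<subseteq> R12" "\<And>p t. t \<in> T p \<Longrightarrow> dH t G = xi p t"
    using xi_primitive[OF surface(2)] by blast
  show ?thesis using tilde induced_immersion[OF G] by blast
qed

end
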